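(* Suppose $f_0$ is a Gaussian density (so $f_0=f$) and both experts $\varphi$ and $\sigma$ are the identity function. Writing $\Delta G=(\Delta a,\Delta b,\Delta\nu):=(a-a_0,b-b_0,\nu-\nu_0)$ and $\Delta G_*=(\Delta a^*,\Delta b^*,\Delta\nu^* ):=(a^*-a_0,b^*-b_0,\nu^*-\nu_0)$, for a sequence $(l_n)_{n\ge1}$ define $$\Xi_1(l_n):=\Big\{(\lambda,a,b,\nu)\in\Xi:\ \frac{l_n}{\min_{1\le i\le d}\{|(\Delta a)_i|^2,|\Delta b|^4,|\Delta\nu|^2\}\sqrt n}\le\lambda\Big\}.$$ Then for any sequence $(l_n)$ with $l_n/\log n\to\infty$, $$\sup_{(\lambda^*,G_* )\in\Xi_1(l_n)}\mathbb E_{p_{\lambda^*,G_*}}\Big[(\|\Delta a^*\|^4+|\Delta b^*|^8+|\Delta\nu^*|^4)\,|\hat\lambda_n-\lambda^*|^2\Big]\lesssim\frac{\log n}{n},$$ $$\sup_{(\lambda^*,G_* )\in\Xi_1(l_n)}\mathbb E_{p_{\lambda^*,G_*}}\Big[(\lambda^* )^2(\|\Delta a^*\|^2+|\Delta b^*|^4+|\Delta\nu^*|^2)(\|\hat a_n-a^*\|^2+|\hat b_n-b^*|^4+|\hat\nu_n-\nu^*|^2)\Big]\lesssim\frac{\log n}{n}.$$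
   Context: Setting: $d\ge1$; $\mathcal X\subset\mathbb R^d$ bounded, $\mathcal Y\subset\mathbb R$; $X$ has density $\bar f$. $f(\cdot|\mu,\nu)$ is the univariate Gaussian density (mean $\mu$, variance $\nu>0$). $\Theta\subset\mathbb R^d\times\mathbb R\times(0,\infty)$ compact, $\Xi=[0,1]\times\Theta$, $(a_0,b_0,\nu_0)\in\Theta$ known with $a_0\ne0$. Model $p_{\lambda,G}(Y|X)=(1-\lambda)f_0(Y|\varphi(a_0^\top X+b_0),\nu_0)+\lambda f(Y|\sigma(a^\top X+b),\nu)$ for $(\lambda,G)=(\lambda,a,b,\nu)\in\Xi$. Data $(X_i,Y_i)_{i=1}^n$ i.i.d. from $p_{\lambda^*,G_*}(Y|X)\bar f(X)$, $G_*=(a^*,b^*,\nu^* )$, true parameters possibly depending on $n$. MLE $(\hat\lambda_n,\hat a_n,\hat b_n,\hat\nu_n)\in\arg\max_\Xi\sum_i\log p_{\lambda,G}(Y_i|X_i)$. $\lesssim$ hides a constant independent of $n$ and of the true parameters. *)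

theory Defs
  imports "HOL-Probability.Probability"
begin

definition gauss :: "real \<Rightarrow> real \<Rightarrow> real \<Rightarrow> real" where
  "gauss mu nu y = normal_density mu (sqrt nu) y"

text \<open>Conditional density of the model with f0 Gaussian and both experts the identity:
  p(y|x) = (1-lam) f(y | a0.x+b0, nu0) + lam f(y | a.x+b, nu).\<close>
definition mix_dens ::
  "(real ^ 'd) \<Rightarrow> real \<Rightarrow> real \<Rightarrow> real \<Rightarrow> (real ^ 'd) \<Rightarrow> real \<Rightarrow> real \<Rightarrow> (real ^ 'd) \<Rightarrow> real \<Rightarrow> real" where
  "mix_dens a0 b0 nu0 lam a b nu x y =
     (1 - lam) * gauss (a0 \<bullet> x + b0) nu0 y + lam * gauss (a \<bullet> x + b) nu y"

definition Xi :: "((real ^ 'd) \<times> real \<times> real) set \<Rightarrow> (real \<times> (real ^ 'd) \<times> real \<times> real) set" where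
  "Xi Theta = {(lam, a, b, nu). lam \<in> {0..1} \<and> (a, b, nu) \<in> Theta}"

definition obs_law ::
  "((real ^ 'd) \<Rightarrow> real) \<Rightarrow> (real ^ 'd) \<Rightarrow> real \<Rightarrow> real \<Rightarrow> real \<times> (real ^ 'd) \<times> real \<times> real
   \<Rightarrow> ((real ^ 'd) \<times> real) measure" where
  "obs_law fbar a0 b0 nu0 par =
     (case par of (lam, a, b, nu) \<Rightarrow>
        density lborel (\<lambda>(x, y). ennreal (fbar x * mix_dens a0 b0 nu0 lam a b nu x y)))"

definition sample_law ::
  "((real ^ 'd) \<Rightarrow> real) \<Rightarrow> (real ^ 'd) \<Rightarrow> real \<Rightarrow> real \<Rightarrow> real \<times> (real ^ 'd) \<times> real \<times> real
   \<Rightarrow> nat \<Rightarrow> (nat \<Rightarrow> (real ^ 'd) \<times> real) measure" where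
  "sample_law fbar a0 b0 nu0 par n = (\<Pi>\<^sub>M i\<in>{..<n}. obs_law fbar a0 b0 nu0 par)"

definition loglik ::
  "(real ^ 'd) \<Rightarrow> real \<Rightarrow> real \<Rightarrow> nat \<Rightarrow> (nat \<Rightarrow> (real ^ 'd) \<times> real)
   \<Rightarrow> real \<times> (real ^ 'd) \<times> real \<times> real \<Rightarrow> real" where
  "loglik a0 b0 nu0 n D par =
     (case par of (lam, a, b, nu) \<Rightarrow>
        (\<Sum>i<n. ln (mix_dens a0 b0 nu0 lam a b nu (fst (D i)) (snd (D i)))))"

definition is_MLE ::
  "((real ^ 'd) \<times> real \<times> real) set \<Rightarrow> (real ^ 'd) \<Rightarrow> real \<Rightarrow> real
   \<Rightarrow> (nat \<Rightarrow> (nat \<Rightarrow> (real ^ 'd) \<times> real) \<Rightarrow> real \<times> (real ^ 'd) \<times> real \<times> real) \<Rightarrow> bool" where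
  "is_MLE Theta a0 b0 nu0 est \<longleftrightarrow>
     (\<forall>n. est n \<in> measurable (\<Pi>\<^sub>M i\<in>{..<n}. (borel :: ((real ^ 'd) \<times> real) measure)) borel \<and>
          (\<forall>D. est n D \<in> Xi Theta \<and>
               (\<forall>par \<in> Xi Theta. loglik a0 b0 nu0 n D par \<le> loglik a0 b0 nu0 n D (est n D))))"

definition min_dev :: "(real ^ 'd) \<Rightarrow> real \<Rightarrow> real \<Rightarrow> (real ^ 'd) \<Rightarrow> real \<Rightarrow> real \<Rightarrow> real" where
  "min_dev a0 b0 nu0 a b nu =
     Min ((\<lambda>i. \<bar>(a - a0) $ i\<bar> ^ 2) ` UNIV \<union> {\<bar>b - b0\<bar> ^ 4, \<bar>nu - nu0\<bar> ^ 2})"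

text \<open>Xi_1(l_n). The quotient l_n / (m sqrt n) is read as +infinity when m = 0,
  so such parameters are excluded (m > 0 is required).\<close>
definition Xi1 ::
  "((real ^ 'd) \<times> real \<times> real) set \<Rightarrow> (real ^ 'd) \<Rightarrow> real \<Rightarrow> real \<Rightarrow> (nat \<Rightarrow> real) \<Rightarrow> nat
   \<Rightarrow> (real \<times> (real ^ 'd) \<times> real \<times> real) set" where
  "Xi1 Theta a0 b0 nu0 l n =
     {(lam, a, b, nu) \<in> Xi Theta.
        min_dev a0 b0 nu0 a b nu > 0 \<and>
        l n / (min_dev a0 b0 nu0 a b nu * sqrt (real n)) \<le> lam}"

end

theory Submission
  imports Defs
begin

text \<open>The loss is controlled by the Hellinger distance $h$ between the fitted and the true joint law,
  and $h^2 = O(\log n / n)$ outside an event of probability $O(1/n)$.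

  For the first statement let $\lambda$ be the mixing weight, $u = \Delta a \cdot x + \Delta b$ and
  $s = \Delta\nu$. By Cauchy--Schwarz the first four conditional moments of $Y$, centred at
  $a_0 \cdot x + b_0$, differ by $O(h)$ in $L^1(\bar f)$. They are polynomials in $x$ that are equivalent to
  $\lambda u$, $\lambda(u^2 + s)$, $\lambda(u^3 + 3us)$, $\lambda(u^4 + 6u^2s + 3s^2)$,
  and a Remez-type inequality turns the $L^1$ bound into a bound at every point, in
  particular at $0$ and $\pm e_i$. The first two moments at these points show that
  $\lambda (\Delta a)_i$ and $\lambda (\Delta a)_i^2$ are known up to $O(h)$; since
  $h$ is small compared with $\lambda^* |(\Delta a^*)_i|^2$, this gives
  $\hat\lambda / \lambda^* \approx 1$. Near this ratio the four moments at $0$ determine $\hat\lambda$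
  with error $O(h)/(|\Delta b^*|^4 + |\Delta\nu^*|^2)$, by elementary algebra.

  The second statement is a union bound over upper brackets of a finite net.\<close>

text \<open>The obstacle is the heat equation for Gaussian densities: the second derivative in the
  mean is twice the first derivative in the variance. With B = \<Delta>b and S = \<Delta>\<nu>, the
  first two moments at x = 0 show only \<lambda> B and \<lambda> (B^2 + S), two equations for three
  unknowns. The third and fourth moments supply the rest, and the scale B^2 ~ S is why \<Delta>b
  carries twice the exponent of the other deviations. The coordinates of \<Delta>a escape this
  degeneracy, since a second difference in x of the second moment isolates \<lambda>
  (\<Delta>a)_i^2. Every step is an explicit inequality, not a limit along a sequence of parameters,
  so the constants are uniform in the true parameter by construction. The support of the density of
  X has no prescribed shape: polynomial bounds must start from a set of positive measure and reach
  points outside the support. The bad event is represented by a measurable random variable W that is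
  at least 1 on it, so that no set defined through the estimator has to be measured.\<close>

section \<open>Finite nets\<close>

text \<open>Points in the same cell of the cubic grid of side \<epsilon> / DIM are within \<epsilon>
  already in the l1 norm, so one representative per occupied cell suffices. Representatives are
  taken from S itself: in the application each net point must be far from the truth in Hellinger
  distance.\<close>

lemma finite_net_card_le:
  fixes S :: "'a::euclidean_space set"
  assumes S: "\<And>x. x \<in> S \<Longrightarrow> norm x \<le> r" and r: "0 \<le> r" and \<epsilon>: "0 < \<epsilon>" "\<epsilon> \<le> 1"
  obtains F where "finite F" "F \<subseteq> S" "\<And>x. x \<in> S \<Longrightarrow> \<exists>y\<in>F. norm (x - y) \<le> \<epsilon>"
    "real (card F) \<le> ((2 * r * DIM('a) + 3) / \<epsilon>) ^ DIM('a)"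
proof
  define \<delta> where "\<delta> = \<epsilon> / DIM('a)"
  have \<delta>: "0 < \<delta>" using \<epsilon> by (simp add: \<delta>_def)
  define \<phi> where "\<phi> x = (\<lambda>i\<in>Basis. \<lfloor>(x \<bullet> i) / \<delta>\<rfloor>)" for x :: 'a
  define m where "m = \<lceil>r / \<delta>\<rceil>"
  have "0 \<le> r / \<delta>" using r \<delta> by simp
  then have m: "0 \<le> m" unfolding m_def by linarith
  define F where "F = inv_into S \<phi> ` (\<phi> ` S)"
  have sub: "\<phi> ` S \<subseteq> (\<Pi>\<^sub>E i\<in>Basis. {-m..m})"
  proof (rule image_subsetI)
    fix x assume x: "x \<in> S"
    have "\<lfloor>(x \<bullet> i) / \<delta>\<rfloor> \<in> {-m..m}" if i: "i \<in> Basis" for i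
    proof -
      have "\<bar>x \<bullet> i\<bar> \<le> r" using Basis_le_norm[OF i, of x] S[OF x] by linarith
      then have "(x \<bullet> i) / \<delta> \<le> r / \<delta>" "- (r / \<delta>) \<le> (x \<bullet> i) / \<delta>"
        using \<delta> by (auto simp: field_simps abs_le_iff)
      then have "\<lfloor>(x \<bullet> i) / \<delta>\<rfloor> \<le> \<lfloor>r / \<delta>\<rfloor>" "\<lfloor>- (r / \<delta>)\<rfloor> \<le> \<lfloor>(x \<bullet> i) / \<delta>\<rfloor>"
        by (auto intro: floor_mono)
      then show ?thesis
        unfolding m_def floor_minus atLeastAtMost_iff by linarith
    qed
    then show "\<phi> x \<in> (\<Pi>\<^sub>E i\<in>Basis. {-m..m})" by (auto simp: \<phi>_def)
  qed
  have fin: "finite (\<Pi>\<^sub>E i\<in>(Basis::'a set). {-m..m})" by (intro finite_PiE) auto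
  show "finite F" unfolding F_def using finite_subset[OF sub fin] by simp
  show "F \<subseteq> S" unfolding F_def by (auto simp: inv_into_into)
  show "\<exists>y\<in>F. norm (x - y) \<le> \<epsilon>" if x: "x \<in> S" for x
  proof
    define y where "y = inv_into S \<phi> (\<phi> x)"
    show "inv_into S \<phi> (\<phi> x) \<in> F" using x by (simp add: F_def)
    have "\<phi> y = \<phi> x" unfolding y_def using x by (intro f_inv_into_f) auto
    have "\<bar>(x - y) \<bullet> i\<bar> \<le> \<delta>" if i: "i \<in> Basis" for i
    proof -
      have "\<lfloor>(x \<bullet> i) / \<delta>\<rfloor> = \<lfloor>(y \<bullet> i) / \<delta>\<rfloor>"
        using fun_cong[OF \<open>\<phi> y = \<phi> x\<close>, of i] i by (simp add: \<phi>_def)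
      then have "\<bar>(x \<bullet> i) / \<delta> - (y \<bullet> i) / \<delta>\<bar> \<le> 1" by linarith
      then have "\<bar>(x - y) \<bullet> i\<bar> / \<delta> \<le> 1"
        using \<delta> by (simp add: inner_diff_left diff_divide_distrib[symmetric] abs_divide)
      then show ?thesis using \<delta> by (simp add: field_simps)
    qed
    then have "(\<Sum>i\<in>Basis. \<bar>(x - y) \<bullet> i\<bar>) \<le> (\<Sum>i\<in>(Basis::'a set). \<delta>)" by (intro sum_mono) auto
    then show "norm (x - inv_into S \<phi> (\<phi> x)) \<le> \<epsilon>"
      using norm_le_l1[of "x - y"] unfolding y_def[symmetric] by (simp add: \<delta>_def)
  qed
  have "card F \<le> card (\<phi> ` S)" unfolding F_def
    using finite_subset[OF sub fin] by (rule card_image_le)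
  also have "\<dots> \<le> card (\<Pi>\<^sub>E i\<in>(Basis::'a set). {-m..m})" by (rule card_mono[OF fin sub])
  also have "\<dots> = nat (2 * m + 1) ^ DIM('a)" using m by (simp add: card_PiE)
  finally have "real (card F) \<le> real (nat (2 * m + 1)) ^ DIM('a)"
    by (metis of_nat_le_iff of_nat_power)
  also have "\<dots> \<le> ((2 * r * DIM('a) + 3) / \<epsilon>) ^ DIM('a)"
  proof (intro power_mono)
    have "real_of_int m \<le> r / \<delta> + 1" unfolding m_def by linarith
    then have "2 * m + 1 \<le> 2 * r * DIM('a) / \<epsilon> + 3" by (simp add: \<delta>_def)
    also have "3 \<le> 3 / \<epsilon>" using \<epsilon> by (simp add: le_divide_eq)
    finally show "real (nat (2 * m + 1)) \<le> (2 * r * DIM('a) + 3) / \<epsilon>"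
      using m by (simp add: add_divide_distrib)
  qed simp
  finally show "real (card F) \<le> ((2 * r * DIM('a) + 3) / \<epsilon>) ^ DIM('a)" .
qed

section \<open>A Remez-type inequality\<close>

text \<open>One node is eliminated at a time: in P(x) = (x - c) Q(x) + P(c) the quotient Q has lower
  degree and is at most 2 \<epsilon> / \<delta> at the other nodes. Returning to 0 multiplies by c
  \<le> 2 and adds \<epsilon>, which \<delta> \<le> 1 absorbs, so a node costs the factor (2 * 2 +
  1) / \<delta> = 5 / \<delta>.\<close>

lemma poly_at_0_le:
  fixes P :: "real poly"
  assumes "degree P \<le> k" "finite X" "card X = Suc k" "X \<subseteq> {1..2}" "0 < \<delta>" "\<delta> \<le> 1"
    and "\<And>x y. x \<in> X \<Longrightarrow> y \<in> X \<Longrightarrow> x \<noteq> y \<Longrightarrow> \<delta> \<le> \<bar>x - y\<bar>"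
    and "\<And>x. x \<in> X \<Longrightarrow> \<bar>poly P x\<bar> \<le> \<epsilon>"
  shows "\<bar>poly P 0\<bar> \<le> (5 / \<delta>) ^ k * \<epsilon>"
  using assms
proof (induction k arbitrary: P \<epsilon> X)
  case 0
  then obtain c where c: "X = {c}" by (auto simp: card_Suc_eq)
  obtain a where "P = [:a:]" using 0 by (auto elim: degree_eq_zeroE)
  then show ?case using 0 c by auto
next
  case (Suc k)
  obtain c where c: "c \<in> X" using Suc.prems by fastforce
  define Q where "Q = synthetic_div P c"
  have eq: "poly P x = (x - c) * poly Q x + poly P c" for x
  proof -
    have "poly ([:-c, 1:] * Q + [:poly P c:]) x = poly P x"
      unfolding Q_def by (simp only: synthetic_div_correct')
    then show ?thesis by (simp add: algebra_simps)
  qed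
  have e0: "0 \<le> \<epsilon>" using Suc.prems(8)[OF c] by linarith
  have c12: "1 \<le> c" "c \<le> 2" using c Suc.prems(4) by auto
  have IH: "\<bar>poly Q 0\<bar> \<le> (5 / \<delta>) ^ k * (2 * \<epsilon> / \<delta>)"
  proof (rule Suc.IH[where X = "X - {c}"])
    show "degree Q \<le> k" using Suc.prems(1) by (simp add: Q_def degree_synthetic_div)
    show "card (X - {c}) = Suc k" using Suc.prems c by simp
    fix x assume x: "x \<in> X - {c}"
    then have d: "\<delta> \<le> \<bar>x - c\<bar>" using Suc.prems(7) c by auto
    have "\<bar>x - c\<bar> * \<bar>poly Q x\<bar> = \<bar>poly P x - poly P c\<bar>"
      by (simp add: eq[of x] abs_mult)
    also have "\<dots> \<le> 2 * \<epsilon>" using Suc.prems(8)[of x] Suc.prems(8)[OF c] x by auto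
    finally have "\<delta> * \<bar>poly Q x\<bar> \<le> 2 * \<epsilon>"
      using mult_right_mono[OF d, of "\<bar>poly Q x\<bar>"] by simp
    then show "\<bar>poly Q x\<bar> \<le> 2 * \<epsilon> / \<delta>" using \<open>0 < \<delta>\<close> by (simp add: field_simps)
  qed (use Suc.prems in auto)
  have one: "1 \<le> (5 / \<delta>) ^ k" using Suc.prems by (intro one_le_power) simp
  have "\<bar>poly P 0\<bar> \<le> c * \<bar>poly Q 0\<bar> + \<bar>poly P c\<bar>"
    using c12 abs_triangle_ineq[of "- c * poly Q 0" "poly P c"] by (simp add: eq[of 0] abs_mult)
  also have "\<dots> \<le> 2 * ((5 / \<delta>) ^ k * (2 * \<epsilon> / \<delta>)) + \<epsilon>"
    using c12 IH Suc.prems(8)[OF c] by (intro add_mono mult_mono) auto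
  finally have bnd: "\<bar>poly P 0\<bar> \<le> 2 * ((5 / \<delta>) ^ k * (2 * \<epsilon> / \<delta>)) + \<epsilon>" .
  have "\<epsilon> \<le> (5 / \<delta>) ^ k * (\<epsilon> / \<delta>)"
  proof -
    have "\<epsilon> \<le> \<epsilon> / \<delta>" using e0 Suc.prems by (simp add: le_divide_eq mult_left_le)
    also have "\<dots> \<le> (5 / \<delta>) ^ k * (\<epsilon> / \<delta>)"
      using mult_right_mono[OF one, of "\<epsilon> / \<delta>"] e0 Suc.prems by simp
    finally show ?thesis .
  qed
  moreover have "(5 / \<delta>) ^ Suc k * \<epsilon> = 2 * ((5 / \<delta>) ^ k * (2 * \<epsilon> / \<delta>)) + (5 / \<delta>) ^ k * (\<epsilon> / \<delta>)"
    by (simp add: algebra_simps)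
  ultimately show ?case using bnd by linarith
qed

text \<open>The integral is the volume of the preimage of B under the dilation about z, which
  shrinks volume by c to the power DIM. It is written with a composed indicator so that a sum over
  several c can later be moved inside the integral.\<close>

lemma emeasure_lborel_le_dilate:
  fixes z :: "'a::euclidean_space"
  assumes [measurable]: "B \<in> sets borel" and c: "1 \<le> c" "c \<le> 2"
  shows "emeasure lborel B \<le> 2 ^ DIM('a) * (\<integral>\<^sup>+x. indicator B (z + c *\<^sub>R (x - z)) \<partial>lborel)"
proof -
  have eq: "(z - c *\<^sub>R z) + c *\<^sub>R x = z + c *\<^sub>R (x - z)" for x
    by (simp add: algebra_simps)
  have "emeasure lborel B = emeasure (density (distr lborel borel (\<lambda>x. (z - c *\<^sub>R z) + c *\<^sub>R x))
      (\<lambda>_. ennreal (\<bar>c\<bar> ^ DIM('a)))) B"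
    using c by (intro arg_cong2[where f = emeasure] lborel_affine[of c "z - c *\<^sub>R z"]) auto
  also have "\<dots> = (\<integral>\<^sup>+x. ennreal (\<bar>c\<bar> ^ DIM('a)) * indicator B (z + c *\<^sub>R (x - z)) \<partial>lborel)"
    by (simp add: emeasure_density nn_integral_distr eq)
  also have "\<dots> = ennreal (c ^ DIM('a)) * (\<integral>\<^sup>+x. indicator B (z + c *\<^sub>R (x - z)) \<partial>lborel)"
    using c by (simp add: nn_integral_cmult)
  also have "\<dots> \<le> ennreal (2 ^ DIM('a)) * (\<integral>\<^sup>+x. indicator B (z + c *\<^sub>R (x - z)) \<partial>lborel)"
    using c by (intro mult_right_mono ennreal_leI power_mono) auto
  finally show ?thesis by (simp add: ennreal_power[symmetric] del: ennreal_power)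
qed

text \<open>Restrictions to lines through a fixed point are all that the Remez argument uses, so
  multivariate polynomials and their degrees are avoided.\<close>

definition poly_on_lines :: "nat \<Rightarrow> ('a::real_vector \<Rightarrow> real) \<Rightarrow> bool" where
  "poly_on_lines k q \<longleftrightarrow> (\<forall>z v. \<exists>P. degree P \<le> k \<and> (\<forall>s. q (z + s *\<^sub>R v) = poly P s))"

lemma poly_on_lines_affine:
  fixes a :: "'a::real_inner"
  assumes "degree p \<le> k"
  shows "poly_on_lines k (\<lambda>x. poly p (a \<bullet> x + b))"
  unfolding poly_on_lines_def
proof (intro allI exI conjI)
  fix z v :: 'a
  let ?P = "pcompose p [:a \<bullet> z + b, a \<bullet> v:]"
  have "degree ?P \<le> degree p * degree [:a \<bullet> z + b, a \<bullet> v:]" by (rule degree_pcompose_le)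
  also have "\<dots> \<le> degree p * 1" by (intro mult_left_mono) (auto simp: degree_pCons_eq_if)
  finally show "degree ?P \<le> k" using assms by simp
  fix s
  show "poly p (a \<bullet> (z + s *\<^sub>R v) + b) = poly ?P s"
    by (simp add: poly_pcompose inner_add_right algebra_simps)
qed

lemma poly_on_lines_diff:
  assumes "poly_on_lines k f" "poly_on_lines k g"
  shows "poly_on_lines k (\<lambda>x. f x - g x)"
  unfolding poly_on_lines_def
proof (intro allI)
  fix z v :: 'a
  obtain P where P: "degree P \<le> k" "\<And>s. f (z + s *\<^sub>R v) = poly P s"
    using assms(1) unfolding poly_on_lines_def by metis
  obtain Q where Q: "degree Q \<le> k" "\<And>s. g (z + s *\<^sub>R v) = poly Q s"
    using assms(2) unfolding poly_on_lines_def by metis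
  show "\<exists>R. degree R \<le> k \<and> (\<forall>s. f (z + s *\<^sub>R v) - g (z + s *\<^sub>R v) = poly R s)"
    using P Q by (intro exI[of _ "P - Q"]) (auto intro: degree_diff_le)
qed

text \<open>If $q$ is small compared with $|q(z)|$ on a set $B$, then of
  $n$ dilates of $B$ about $z$ at most $k$ can contain a given point, since a polynomial of degree
  at most $k$ cannot be small at $k + 1$ points of $[1,2]$ and large at $0$. Hence
  $B$ has small measure.\<close>
lemma poly_on_lines_le_integral:
  fixes f :: "'a::euclidean_space \<Rightarrow> real"
  assumes f [measurable]: "f \<in> borel_measurable borel" and f0: "\<And>x. 0 \<le> f x"
    and supp: "\<And>x. R < norm x \<Longrightarrow> f x = 0"
    and pos: "(\<integral>\<^sup>+x. ennreal (f x) \<partial>lborel) \<noteq> 0"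
  obtains C where "0 < C"
    "\<And>q z e. q \<in> borel_measurable borel \<Longrightarrow> poly_on_lines k q \<Longrightarrow> norm z \<le> R \<Longrightarrow> 0 \<le> e \<Longrightarrow>
       (\<integral>\<^sup>+x. ennreal (f x * \<bar>q x\<bar>) \<partial>lborel) \<le> ennreal e \<Longrightarrow> \<bar>q z\<bar> \<le> C * e"
proof -
  \<comment> \<open>Some level set of f has positive measure, since otherwise f vanishes almost
    everywhere. This gives a set G on which f is bounded below by a positive constant.\<close>
  have "\<exists>i. emeasure lborel {x. 1 / real (Suc i) < f x} \<noteq> 0"
  proof (rule ccontr)
    assume "\<not> ?thesis"
    then have "AE x in lborel. \<forall>i. \<not> 1 / real (Suc i) < f x"
      by (subst AE_all_countable) (auto intro!: AE_I[where N = "{x. 1 / real (Suc _) < f x}"])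
    then have "AE x in lborel. ennreal (f x) = 0"
    proof eventually_elim
      case (elim x)
      then have "\<not> 0 < f x" using reals_Archimedean[of "f x"] by (auto simp: inverse_eq_divide)
      then show ?case using f0[of x] by simp
    qed
    then show False using pos by (subst (asm) nn_integral_0_iff_AE[symmetric]) auto
  qed
  then obtain i where i: "emeasure lborel {x. 1 / real (Suc i) < f x} \<noteq> 0" by blast
  define \<tau> where "\<tau> = 1 / real (Suc i)"
  have \<tau>: "0 < \<tau>" by (simp add: \<tau>_def)
  define G where "G = {x. \<tau> < f x}"
  have G [measurable]: "G \<in> sets borel" unfolding G_def by measurable
  have Gsub: "G \<subseteq> cball 0 R"
  proof
    fix x assume "x \<in> G"
    then show "x \<in> cball 0 R" using supp[of x] \<tau> by (cases "R < norm x") (auto simp: G_def)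
  qed
  have Gfin: "emeasure lborel G < \<infinity>"
    using emeasure_bounded_finite[OF bounded_subset[OF bounded_cball Gsub]] by simp
  define m where "m = measure lborel G"
  have Gm: "emeasure lborel G = ennreal m"
    using Gfin by (simp add: m_def emeasure_eq_ennreal_measure)
  have m: "0 < m" using i unfolding G_def[symmetric] \<tau>_def[symmetric] Gm
    by (simp add: ennreal_eq_0_iff not_le)
  \<comment> \<open>A point x whose dilate z + c (x - z), c \<ge> 1, lies in the ball of radius R
    has distance at most 2 R from z, hence norm at most 3 R.\<close>
  define V where "V = measure lborel (cball (0::'a) (3 * R))"
  have V: "emeasure lborel (cball (0::'a) (3 * R)) = ennreal V" "0 \<le> V"
    using emeasure_bounded_finite[OF bounded_cball[of "0::'a" "3 * R"]]
    unfolding V_def by (simp_all add: emeasure_eq_ennreal_measure less_top)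
  \<comment> \<open>The overlap count below yields n |B| \<le> 2^DIM k V; this n forces |B| < m / 2,
    so that B misses at least half of G.\<close>
  obtain n :: nat where n: "2 ^ DIM('a) * real k * V * 2 / m < real n"
    using reals_Archimedean2 by blast
  have n0: "0 < n" using n V m by (cases n) (auto simp: divide_less_0_iff mult_less_0_iff not_less)
  define \<delta> where "\<delta> = 1 / real n"
  have \<delta>: "0 < \<delta>" "\<delta> \<le> 1" using n0 by (auto simp: \<delta>_def)
  \<comment> \<open>Chosen so that values of size \<epsilon> w at k + 1 nodes of spacing \<delta>
    force |q z| \<le> w / 2, contradicting w = |q z| > 0.\<close>
  define \<epsilon> where "\<epsilon> = (\<delta> / 5) ^ k / 2"
  have \<epsilon>: "0 < \<epsilon>" using \<delta> by (simp add: \<epsilon>_def)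
  have \<delta>\<epsilon>: "(5 / \<delta>) ^ k * \<epsilon> = 1 / 2"
    using \<delta> by (simp add: \<epsilon>_def power_divide)
  define C where "C = 2 / (\<tau> * \<epsilon> * m)"
  show thesis
  proof (rule that)
    show "0 < C" using \<tau> \<epsilon> m by (simp add: C_def)
    fix q :: "'a \<Rightarrow> real" and z :: 'a and e :: real
    assume q [measurable]: "q \<in> borel_measurable borel" and lines: "poly_on_lines k q"
      and z: "norm z \<le> R" and e: "0 \<le> e"
      and int: "(\<integral>\<^sup>+x. ennreal (f x * \<bar>q x\<bar>) \<partial>lborel) \<le> ennreal e"
    show "\<bar>q z\<bar> \<le> C * e"
    proof (cases "q z = 0")
      case True
      then show ?thesis using \<open>0 < C\<close> e by simp
    next
      case False
      define w where "w = \<bar>q z\<bar>"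
      have w: "0 < w" using False by (simp add: w_def)
      define B where "B = {x \<in> G. \<bar>q x\<bar> \<le> \<epsilon> * w}"
      have B [measurable]: "B \<in> sets borel" unfolding B_def by measurable
      define c where "c j = 1 + real j / real n" for j
      have c: "1 \<le> c j" "c j \<le> 2" if "j < n" for j
        using that by (auto simp: c_def)
      have few: "(\<Sum>j<n. indicator B (z + c j *\<^sub>R (x - z)))
          \<le> (of_nat k * indicator (cball 0 (3 * R)) x :: ennreal)" for x
      proof -
        define J where "J = {j. j < n \<and> z + c j *\<^sub>R (x - z) \<in> B}"
        have J: "finite J" by (simp add: J_def)
        have "(\<Sum>j<n. indicator B (z + c j *\<^sub>R (x - z))) = (\<Sum>j<n. if j \<in> J then 1 else (0::ennreal))"
          by (intro sum.cong) (auto simp: J_def)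
        also have "\<dots> = of_nat (card J)"
          by (subst sum.inter_filter[symmetric]) (auto simp: J_def intro!: arg_cong[where f = card])
        finally have S: "(\<Sum>j<n. indicator B (z + c j *\<^sub>R (x - z))) = (of_nat (card J) :: ennreal)" .
        have "card J \<le> k"
        proof (rule ccontr)
          assume "\<not> card J \<le> k"
          then obtain J' where J': "J' \<subseteq> J" "card J' = Suc k"
            using obtain_subset_with_card_n[of "Suc k" J] by (metis not_less_eq_eq)
          have fin: "finite J'" using J' J finite_subset by blast
          obtain P where P: "degree P \<le> k" "\<And>s. q (z + s *\<^sub>R (x - z)) = poly P s"
            using lines unfolding poly_on_lines_def by metis
          have inj: "inj_on c J'" using n0 by (auto simp: inj_on_def c_def)
          have "\<bar>poly P 0\<bar> \<le> (5 / \<delta>) ^ k * (\<epsilon> * w)"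
          proof (rule poly_at_0_le[where X = "c ` J'"])
            show "card (c ` J') = Suc k" using inj J' by (simp add: card_image)
            show "c ` J' \<subseteq> {1..2}" using J' c by (force simp: J_def)
            fix x y assume "x \<in> c ` J'" "y \<in> c ` J'" "x \<noteq> y"
            then obtain i j where ij: "x = c i" "y = c j" "i \<noteq> j" by auto
            have "x - y = (real i - real j) / real n"
              by (simp add: ij c_def diff_divide_distrib)
            moreover have "1 \<le> \<bar>real i - real j\<bar>" using ij by linarith
            ultimately show "\<delta> \<le> \<bar>x - y\<bar>" by (simp add: \<delta>_def divide_right_mono)
          next
            fix s assume "s \<in> c ` J'"
            then show "\<bar>poly P s\<bar> \<le> \<epsilon> * w"
              using J' by (auto simp: J_def B_def P(2)[symmetric])
          qed (use P \<delta> fin in auto)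
          also have "\<dots> = w / 2" using \<delta>\<epsilon> by (simp add: mult.assoc[symmetric])
          finally show False using P(2)[of 0] w by (simp add: w_def)
        qed
        moreover have "norm x \<le> 3 * R" if ne: "J \<noteq> {}"
        proof -
          obtain j where j: "j < n" "z + c j *\<^sub>R (x - z) \<in> B" using ne by (auto simp: J_def)
          then have "norm (z + c j *\<^sub>R (x - z)) \<le> R" using Gsub by (auto simp: B_def)
          then have "norm (c j *\<^sub>R (x - z)) \<le> 2 * R"
            using z norm_triangle_ineq4[of "z + c j *\<^sub>R (x - z)" z] by simp
          moreover have "norm (x - z) \<le> norm (c j *\<^sub>R (x - z))"
            using c[OF j(1)] mult_right_mono[of 1 "c j" "norm (x - z)"] by simp
          ultimately show ?thesis using z norm_triangle_ineq[of "x - z" z] by simp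
        qed
        ultimately show ?thesis unfolding S
          by (cases "J = {}") (auto simp: indicator_def)
      qed
      have "of_nat n * emeasure lborel B = (\<Sum>j<n. emeasure lborel B)" by simp
      also have "\<dots> \<le> (\<Sum>j<n. 2 ^ DIM('a) * (\<integral>\<^sup>+x. indicator B (z + c j *\<^sub>R (x - z)) \<partial>lborel))"
        using c by (intro sum_mono emeasure_lborel_le_dilate) auto
      also have "\<dots> = 2 ^ DIM('a) * (\<integral>\<^sup>+x. (\<Sum>j<n. indicator B (z + c j *\<^sub>R (x - z))) \<partial>lborel)"
        by (subst nn_integral_sum) (auto simp: sum_distrib_left)
      also have "\<dots> \<le> 2 ^ DIM('a) * (\<integral>\<^sup>+x. of_nat k * indicator (cball 0 (3 * R)) x \<partial>(lborel::'a measure))"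
        by (intro mult_left_mono nn_integral_mono few) auto
      also have "\<dots> = ennreal (2 ^ DIM('a) * (real k * V))"
        using V by (simp add: nn_integral_cmult_indicator ennreal_mult ennreal_of_nat_eq_real_of_nat ennreal_power[symmetric] del: ennreal_power)
      finally have nB: "of_nat n * emeasure lborel B \<le> ennreal (2 ^ DIM('a) * (real k * V))" .
      have BG: "B \<subseteq> G" by (auto simp: B_def)
      have "emeasure lborel B < \<infinity>"
        using Gfin emeasure_mono[OF BG, of lborel] G by (simp add: order_le_less_trans)
      then obtain b where b: "emeasure lborel B = ennreal b" "0 \<le> b"
        by (metis ennreal_cases infinity_ennreal_def less_irrefl)
      have "real n * b \<le> 2 ^ DIM('a) * (real k * V)"
        using nB V b by (simp add: ennreal_of_nat_eq_real_of_nat ennreal_mult[symmetric])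
      also have "\<dots> < real n * (m / 2)" using n m by (simp add: field_simps)
      finally have bm: "b < m / 2" using n0 by simp
      have GB: "emeasure lborel (G - B) = ennreal (m - b)"
        using b BG Gm by (subst emeasure_Diff) (auto simp: ennreal_minus)
      \<comment> \<open>On G - B both factors are bounded below: f by \<tau> and |q| by \<epsilon>
        w.\<close>
      have "ennreal (\<tau> * (\<epsilon> * w) * (m - b)) = (\<integral>\<^sup>+x. ennreal (\<tau> * (\<epsilon> * w)) * indicator (G - B) x \<partial>lborel)"
        using GB bm \<tau> \<epsilon> w b by (simp add: nn_integral_cmult_indicator ennreal_mult)
      also have "\<dots> \<le> (\<integral>\<^sup>+x. ennreal (f x * \<bar>q x\<bar>) \<partial>lborel)"
        using \<tau> \<epsilon> w f0
        by (intro nn_integral_mono) (auto simp: indicator_def B_def G_def intro!: ennreal_leI mult_mono)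
      also note int
      finally have "\<tau> * (\<epsilon> * w) * (m - b) \<le> e" using e by simp
      moreover have "\<tau> * (\<epsilon> * w) * (m / 2) \<le> \<tau> * (\<epsilon> * w) * (m - b)"
        using bm \<tau> \<epsilon> w by (intro mult_left_mono) auto
      ultimately have "\<tau> * (\<epsilon> * w) * (m / 2) \<le> e" by linarith
      then show ?thesis using \<tau> \<epsilon> m by (simp add: C_def w_def[symmetric] field_simps)
    qed
  qed
qed

section \<open>Gaussian densities\<close>

lemma gauss_eq: "0 < \<nu> \<Longrightarrow> gauss \<mu> \<nu> y = exp (- (y - \<mu>)\<^sup>2 / (2 * \<nu>)) / sqrt (2 * pi * \<nu>)"
  by (simp add: gauss_def normal_density_def)

lemma gauss_pos: "0 < \<nu> \<Longrightarrow> 0 < gauss \<mu> \<nu> y"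
  by (simp add: gauss_def normal_density_pos)

lemma gauss_nonneg: "0 \<le> gauss \<mu> \<nu> y"
  by (simp add: gauss_def)

lemma power_mult_exp_minus_le: "0 \<le> w \<Longrightarrow> w ^ j * exp (- w) \<le> fact j" for w :: real
proof -
  assume w: "0 \<le> w"
  have "(\<Sum>i\<in>{j}. w ^ i /\<^sub>R fact i) \<le> (\<Sum>i. w ^ i /\<^sub>R fact i)"
    using w by (intro sum_le_suminf summable_exp_generic) auto
  then have "w ^ j / fact j \<le> exp w" by (simp add: exp_def divide_inverse mult.commute)
  then show ?thesis by (simp add: exp_minus field_simps)
qed

text \<open>The inequality (y - 2 \<mu>)^2 \<ge> 0 says that -(y - \<mu>)^2 \<le> \<mu>^2 - y^2 / 2,
  so the exponent is at most a constant minus w = (1 + y^2) / (4 v1). Any power of w is then beaten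
  by exp (- w), uniformly over the mean and the variance.\<close>

lemma gauss_decay:
  fixes v0 v1 m :: real
  assumes v: "0 < v0" "v0 \<le> v1" and m: "0 \<le> m"
  obtains C where "0 < C"
    "\<And>\<mu> \<nu> y. \<bar>\<mu>\<bar> \<le> m \<Longrightarrow> v0 \<le> \<nu> \<Longrightarrow> \<nu> \<le> v1 \<Longrightarrow> gauss \<mu> \<nu> y * (1 + y\<^sup>2) ^ j \<le> C"
proof
  define K where "K = exp (m\<^sup>2 / (2 * v0) + 1 / (4 * v1)) / sqrt (2 * pi * v0)"
  have K: "0 < K" using v by (simp add: K_def)
  show "0 < K * ((4 * v1) ^ j * fact j)" using K v by simp
  fix \<mu> \<nu> y :: real
  assume \<mu>: "\<bar>\<mu>\<bar> \<le> m" and \<nu>: "v0 \<le> \<nu>" "\<nu> \<le> v1"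
  define w where "w = (1 + y\<^sup>2) / (4 * v1)"
  have w0: "0 \<le> w" using v by (simp add: w_def)
  have "- (y - \<mu>)\<^sup>2 / (2 * \<nu>) \<le> m\<^sup>2 / (2 * v0) + 1 / (4 * v1) - w"
  proof -
    have "\<mu>\<^sup>2 \<le> m\<^sup>2" using \<mu> m by (simp add: abs_le_square_iff[symmetric])
    moreover have "0 \<le> (y - 2 * \<mu>)\<^sup>2" by simp
    ultimately have "- (y - \<mu>)\<^sup>2 \<le> m\<^sup>2 - y\<^sup>2 / 2"
      by (simp add: power2_eq_square algebra_simps)
    then have "- (y - \<mu>)\<^sup>2 / (2 * \<nu>) \<le> (m\<^sup>2 - y\<^sup>2 / 2) / (2 * \<nu>)"
      using v \<nu> by (intro divide_right_mono) auto
    also have "\<dots> = m\<^sup>2 / (2 * \<nu>) - y\<^sup>2 / (4 * \<nu>)" by (simp add: diff_divide_distrib)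
    also have "\<dots> \<le> m\<^sup>2 / (2 * v0) - y\<^sup>2 / (4 * v1)"
      using v \<nu> by (intro diff_mono divide_left_mono) auto
    also have "\<dots> = m\<^sup>2 / (2 * v0) + 1 / (4 * v1) - w"
      by (simp add: w_def add_divide_distrib)
    finally show ?thesis .
  qed
  then have "exp (- (y - \<mu>)\<^sup>2 / (2 * \<nu>)) \<le> exp (m\<^sup>2 / (2 * v0) + 1 / (4 * v1)) * exp (- w)"
    by (simp add: exp_add[symmetric] add_ac)
  moreover have "sqrt (2 * pi * v0) \<le> sqrt (2 * pi * \<nu>)" using \<nu> by simp
  ultimately have "gauss \<mu> \<nu> y \<le> K * exp (- w)"
    using v \<nu> unfolding gauss_eq[OF less_le_trans[OF v(1) \<nu>(1)]] K_def times_divide_eq_left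
    by (intro frac_le) auto
  then have "gauss \<mu> \<nu> y * (1 + y\<^sup>2) ^ j \<le> K * exp (- w) * (1 + y\<^sup>2) ^ j"
    by (intro mult_right_mono) auto
  also have "\<dots> = K * ((4 * v1) ^ j * (w ^ j * exp (- w)))"
    using v by (simp add: w_def power_divide)
  also have "\<dots> \<le> K * ((4 * v1) ^ j * fact j)"
    using K v w0 by (intro mult_left_mono power_mult_exp_minus_le) auto
  finally show "gauss \<mu> \<nu> y * (1 + y\<^sup>2) ^ j \<le> K * ((4 * v1) ^ j * fact j)" .
qed

lemma has_real_derivative_gauss_mean:
  assumes "0 < \<nu>"
  shows "((\<lambda>\<mu>. gauss \<mu> \<nu> y) has_real_derivative gauss \<mu> \<nu> y * ((y - \<mu>) / \<nu>)) (at \<mu> within S)"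
proof -
  have "((\<lambda>\<mu>. exp (- (y - \<mu>)\<^sup>2 / (2 * \<nu>)) / q) has_real_derivative
      exp (- (y - \<mu>)\<^sup>2 / (2 * \<nu>)) / q * ((y - \<mu>) / \<nu>)) (at \<mu> within S)" if "q \<noteq> 0" for q
    using assms that by (auto intro!: derivative_eq_intros simp: divide_simps) (simp add: algebra_simps)
  then show ?thesis unfolding gauss_eq[OF assms] using assms by simp
qed

text \<open>The explicit formula is differentiated in place of \<open>gauss\<close>, since
  \<open>gauss_eq\<close> needs a positive variance and cannot be applied under the binder.\<close>

lemma has_real_derivative_gauss_variance:
  assumes "0 < \<nu>"
  shows "((\<lambda>\<nu>. exp (- (y - \<mu>)\<^sup>2 / (2 * \<nu>)) / sqrt (2 * pi * \<nu>)) has_real_derivative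
    gauss \<mu> \<nu> y * ((y - \<mu>)\<^sup>2 / (2 * \<nu>\<^sup>2) - 1 / (2 * \<nu>))) (at \<nu> within S)"
proof -
  let ?q = "\<lambda>\<nu>. sqrt (2 * pi * \<nu>)" and ?E = "\<lambda>\<nu>. exp (- (y - \<mu>)\<^sup>2 / (2 * \<nu>))"
  have "0 < 2 * pi * \<nu>" using assms by simp
  then have q: "0 < ?q \<nu>" "?q \<nu> * ?q \<nu> = 2 * pi * \<nu>"
    by (metis real_sqrt_gt_zero, metis abs_of_pos real_sqrt_mult_self)
  then have "pi / ?q \<nu> = ?q \<nu> / (2 * \<nu>)" using assms by (simp add: divide_simps)
  moreover have "(?q has_real_derivative pi / ?q \<nu>) (at \<nu> within S)"
  proof -
    have "((\<lambda>\<nu>. 2 * pi * \<nu>) has_real_derivative 2 * pi) (at \<nu> within S)"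
      by (auto intro!: derivative_eq_intros)
    then have "(?q has_real_derivative inverse (?q \<nu>) / 2 * (2 * pi)) (at \<nu> within S)"
      by (rule DERIV_chain2[where f = sqrt and g = "\<lambda>\<nu>. 2 * pi * \<nu>", OF DERIV_real_sqrt, rotated]) fact
    moreover have "inverse z / 2 * (2 * pi) = pi / z" for z :: real
      by (cases "z = 0") (auto simp: field_simps)
    ultimately show ?thesis by simp
  qed
  ultimately have dq: "(?q has_real_derivative ?q \<nu> / (2 * \<nu>)) (at \<nu> within S)" by simp
  have dE: "(?E has_real_derivative ?E \<nu> * ((y - \<mu>)\<^sup>2 / (2 * \<nu>\<^sup>2))) (at \<nu> within S)"
    using assms by (auto intro!: derivative_eq_intros simp: divide_simps power2_eq_square)
  have "((\<lambda>\<nu>. ?E \<nu> / ?q \<nu>) has_real_derivative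
      (?E \<nu> * ((y - \<mu>)\<^sup>2 / (2 * \<nu>\<^sup>2)) * ?q \<nu> - ?E \<nu> * (?q \<nu> / (2 * \<nu>))) / (?q \<nu> * ?q \<nu>)) (at \<nu> within S)"
    using q by (intro DERIV_divide dE dq) auto
  note deriv = this
  have quot: "(e * a * q - e * (q / b)) / (q * q) = e / q * (a - 1 / b)"
    if "0 < q" for a b e q :: real
  proof -
    have "(e * a * q - e * (q / b)) = (e * (a - 1 / b)) * q"
      by (simp add: right_diff_distrib left_diff_distrib)
    then show ?thesis using that by simp
  qed
  show ?thesis using deriv unfolding gauss_eq[OF assms] quot[OF q(1)] .
qed

text \<open>Both partial derivatives are the density times a polynomial of degree at most 2 in y.
  Decay of order (1 + y^2)^2 pays for the polynomial with one power and leaves the other as an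
  integrable weight; the mean value theorem does the rest in one variable at a time.\<close>

lemma gauss_lipschitz:
  fixes v0 v1 m :: real
  assumes v: "0 < v0" "v0 \<le> v1" and m: "0 \<le> m"
  obtains L where "0 < L"
    "\<And>\<mu> \<mu>' \<nu> \<nu>' y. \<bar>\<mu>\<bar> \<le> m \<Longrightarrow> \<bar>\<mu>'\<bar> \<le> m \<Longrightarrow> v0 \<le> \<nu> \<Longrightarrow> \<nu> \<le> v1 \<Longrightarrow> v0 \<le> \<nu>' \<Longrightarrow> \<nu>' \<le> v1 \<Longrightarrow>
      \<bar>gauss \<mu> \<nu> y - gauss \<mu>' \<nu>' y\<bar> \<le> L * (\<bar>\<mu> - \<mu>'\<bar> + \<bar>\<nu> - \<nu>'\<bar>) / (1 + y\<^sup>2)"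
proof -
  obtain C where C: "0 < C"
    "\<And>\<mu> \<nu> y. \<bar>\<mu>\<bar> \<le> m \<Longrightarrow> v0 \<le> \<nu> \<Longrightarrow> \<nu> \<le> v1 \<Longrightarrow> gauss \<mu> \<nu> y * (1 + y\<^sup>2) ^ 2 \<le> C"
    using gauss_decay[OF v m, of 2] by blast
  define L1 where "L1 = C * ((1 + m) / v0)"
  define L2 where "L2 = C * ((1 + m\<^sup>2) / v0\<^sup>2 + 1 / (2 * v0))"
  have key: "\<bar>gauss \<mu> \<nu> y * a\<bar> \<le> C * A / (1 + y\<^sup>2)"
    if "\<bar>\<mu>\<bar> \<le> m" "v0 \<le> \<nu>" "\<nu> \<le> v1" "\<bar>a\<bar> \<le> A * (1 + y\<^sup>2)" for \<mu> \<nu> y a A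
  proof -
    have y: "0 < 1 + y\<^sup>2" by (simp add: add_pos_nonneg)
    have "0 \<le> A" using that(4) y by (smt (verit) mult_neg_pos)
    have "\<bar>gauss \<mu> \<nu> y * a\<bar> \<le> gauss \<mu> \<nu> y * (A * (1 + y\<^sup>2))"
      using that by (simp add: abs_mult gauss_nonneg mult_left_mono)
    also have "\<dots> = (gauss \<mu> \<nu> y * (1 + y\<^sup>2) ^ 2) * A / (1 + y\<^sup>2)"
      using y by (simp add: power2_eq_square)
    also have "\<dots> \<le> C * A / (1 + y\<^sup>2)"
      using C(2)[OF that(1-3)] y \<open>0 \<le> A\<close> by (intro divide_right_mono mult_right_mono) auto
    finally show ?thesis .
  qed
  have mean: "\<bar>gauss \<mu> \<nu> y - gauss \<mu>' \<nu> y\<bar> \<le> L1 / (1 + y\<^sup>2) * \<bar>\<mu> - \<mu>'\<bar>"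
    if \<mu>: "\<bar>\<mu>\<bar> \<le> m" "\<bar>\<mu>'\<bar> \<le> m" and \<nu>: "v0 \<le> \<nu>" "\<nu> \<le> v1" for \<mu> \<mu>' \<nu> y
  proof -
    have "norm (gauss \<mu> \<nu> y - gauss \<mu>' \<nu> y) \<le> L1 / (1 + y\<^sup>2) * norm (\<mu> - \<mu>')"
    proof (rule field_differentiable_bound[where S = "{-m..m}"])
      fix x assume x: "x \<in> {-m..m}"
      show "((\<lambda>\<mu>. gauss \<mu> \<nu> y) has_field_derivative gauss x \<nu> y * ((y - x) / \<nu>)) (at x within {-m..m})"
        using v \<nu> by (intro has_real_derivative_gauss_mean) auto
      have "2 * \<bar>y\<bar> \<le> 1 + y\<^sup>2" using sum_squares_bound[of 1 "\<bar>y\<bar>"] by simp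
      moreover have "\<bar>y - x\<bar> \<le> \<bar>y\<bar> + m" using x by auto
      moreover have "m \<le> m * (1 + y\<^sup>2)" using m by (simp add: mult_le_cancel_left1)
      ultimately have "\<bar>y - x\<bar> \<le> (1 + m) * (1 + y\<^sup>2)" by (simp add: algebra_simps)
      then have "\<bar>(y - x) / \<nu>\<bar> \<le> (1 + m) * (1 + y\<^sup>2) / v0"
        using v \<nu> m unfolding abs_divide by (intro frac_le) auto
      then show "norm (gauss x \<nu> y * ((y - x) / \<nu>)) \<le> L1 / (1 + y\<^sup>2)"
        unfolding L1_def real_norm_def using x \<nu> by (intro key) auto
    qed (use \<mu> in auto)
    then show ?thesis by simp
  qed
  have var: "\<bar>gauss \<mu> \<nu> y - gauss \<mu> \<nu>' y\<bar> \<le> L2 / (1 + y\<^sup>2) * \<bar>\<nu> - \<nu>'\<bar>"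
    if \<mu>: "\<bar>\<mu>\<bar> \<le> m" and \<nu>: "v0 \<le> \<nu>" "\<nu> \<le> v1" "v0 \<le> \<nu>'" "\<nu>' \<le> v1" for \<mu> \<nu> \<nu>' y
  proof -
    let ?g = "\<lambda>\<nu>. exp (- (y - \<mu>)\<^sup>2 / (2 * \<nu>)) / sqrt (2 * pi * \<nu>)"
    have "norm (?g \<nu> - ?g \<nu>') \<le> L2 / (1 + y\<^sup>2) * norm (\<nu> - \<nu>')"
    proof (rule field_differentiable_bound[where S = "{v0..v1}"])
      fix x assume x: "x \<in> {v0..v1}"
      show "(?g has_field_derivative gauss \<mu> x y * ((y - \<mu>)\<^sup>2 / (2 * x\<^sup>2) - 1 / (2 * x))) (at x within {v0..v1})"
        using v x by (intro has_real_derivative_gauss_variance) auto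
      have "(y - \<mu>)\<^sup>2 \<le> 2 * y\<^sup>2 + 2 * \<mu>\<^sup>2" using sum_squares_bound[of y "-\<mu>"]
        by (simp add: power2_eq_square algebra_simps)
      moreover have "\<mu>\<^sup>2 \<le> m\<^sup>2" using \<mu> m by (simp add: abs_le_square_iff[symmetric])
      moreover have "m\<^sup>2 \<le> m\<^sup>2 * (1 + y\<^sup>2)" by (simp add: mult_le_cancel_left1)
      moreover have "2 * ((1 + m\<^sup>2) * (1 + y\<^sup>2)) = 2 + 2 * y\<^sup>2 + 2 * (m\<^sup>2 * (1 + y\<^sup>2))"
        by (simp add: algebra_simps)
      ultimately have y2: "(y - \<mu>)\<^sup>2 \<le> 2 * ((1 + m\<^sup>2) * (1 + y\<^sup>2))" by linarith
      have "(y - \<mu>)\<^sup>2 / (2 * x\<^sup>2) \<le> 2 * ((1 + m\<^sup>2) * (1 + y\<^sup>2)) / (2 * v0\<^sup>2)"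
        using v x m by (intro frac_le y2 mult_left_mono power_mono) auto
      also have "\<dots> = (1 + m\<^sup>2) / v0\<^sup>2 * (1 + y\<^sup>2)"
        using v by (simp only: mult_divide_mult_cancel_left[of 2] times_divide_eq_left)
      finally have 1: "(y - \<mu>)\<^sup>2 / (2 * x\<^sup>2) \<le> (1 + m\<^sup>2) / v0\<^sup>2 * (1 + y\<^sup>2)" .
      have 2: "1 / (2 * x) \<le> 1 / (2 * v0) * (1 + y\<^sup>2)"
      proof -
        have "1 / (2 * x) \<le> 1 / (2 * v0) * 1" using v x by (simp add: frac_le)
        also have "\<dots> \<le> 1 / (2 * v0) * (1 + y\<^sup>2)" using v by (intro mult_left_mono) auto
        finally show ?thesis .
      qed
      have "0 \<le> (y - \<mu>)\<^sup>2 / (2 * x\<^sup>2)" "0 \<le> 1 / (2 * x)" using v x by auto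
      then have "\<bar>(y - \<mu>)\<^sup>2 / (2 * x\<^sup>2) - 1 / (2 * x)\<bar> \<le> ((1 + m\<^sup>2) / v0\<^sup>2 + 1 / (2 * v0)) * (1 + y\<^sup>2)"
        using 1 2 unfolding distrib_right[of _ _ "1 + y\<^sup>2"] by linarith
      then show "norm (gauss \<mu> x y * ((y - \<mu>)\<^sup>2 / (2 * x\<^sup>2) - 1 / (2 * x))) \<le> L2 / (1 + y\<^sup>2)"
        unfolding L2_def real_norm_def using x \<mu> by (intro key) auto
    qed (use \<nu> in auto)
    then show ?thesis using v \<nu> by (simp add: gauss_eq)
  qed
  show thesis
  proof (rule that)
    have "0 < 1 + m" using m by linarith
    then have "0 < L1" using C v by (simp add: L1_def)
    moreover have "0 \<le> L2" using C v m by (simp add: L2_def)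
    ultimately show "0 < L1 + L2" by simp
    have L: "0 \<le> L1" "0 \<le> L2" using \<open>0 < L1\<close> \<open>0 \<le> L2\<close> by auto
    fix \<mu> \<mu>' \<nu> \<nu>' y :: real
    assume H: "\<bar>\<mu>\<bar> \<le> m" "\<bar>\<mu>'\<bar> \<le> m" "v0 \<le> \<nu>" "\<nu> \<le> v1" "v0 \<le> \<nu>'" "\<nu>' \<le> v1"
    have "\<bar>gauss \<mu> \<nu> y - gauss \<mu>' \<nu>' y\<bar> \<le> \<bar>gauss \<mu> \<nu> y - gauss \<mu>' \<nu> y\<bar> + \<bar>gauss \<mu>' \<nu> y - gauss \<mu>' \<nu>' y\<bar>"
      by linarith
    also have "\<dots> \<le> L1 / (1 + y\<^sup>2) * \<bar>\<mu> - \<mu>'\<bar> + L2 / (1 + y\<^sup>2) * \<bar>\<nu> - \<nu>'\<bar>"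
      using mean[of \<mu> \<mu>' \<nu> y] var[of \<mu>' \<nu> \<nu>' y] H by (intro add_mono) auto
    also have "\<dots> \<le> (L1 + L2) / (1 + y\<^sup>2) * \<bar>\<mu> - \<mu>'\<bar> + (L1 + L2) / (1 + y\<^sup>2) * \<bar>\<nu> - \<nu>'\<bar>"
      using L by (intro add_mono mult_right_mono divide_right_mono) auto
    finally show "\<bar>gauss \<mu> \<nu> y - gauss \<mu>' \<nu>' y\<bar> \<le> (L1 + L2) * (\<bar>\<mu> - \<mu>'\<bar> + \<bar>\<nu> - \<nu>'\<bar>) / (1 + y\<^sup>2)"
      by (simp add: distrib_left add_divide_distrib[of "(L1 + L2) * \<bar>\<mu> - \<mu>'\<bar>"])
  qed
qed

text \<open>Binomial expansion around c of the moments centred at the mean. The centre c is free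
  because both components of the mixture will be centred at the mean of the known one.\<close>

lemma gauss_moments:
  assumes "0 < \<nu>"
  shows "has_bochner_integral lborel (gauss \<mu> \<nu>) 1"
    and "has_bochner_integral lborel (\<lambda>y. gauss \<mu> \<nu> y * (y - c)) (\<mu> - c)"
    and "has_bochner_integral lborel (\<lambda>y. gauss \<mu> \<nu> y * (y - c) ^ 2) ((\<mu> - c)\<^sup>2 + \<nu>)"
    and "has_bochner_integral lborel (\<lambda>y. gauss \<mu> \<nu> y * (y - c) ^ 3) ((\<mu> - c) ^ 3 + 3 * (\<mu> - c) * \<nu>)"
    and "has_bochner_integral lborel (\<lambda>y. gauss \<mu> \<nu> y * (y - c) ^ 4)
      ((\<mu> - c) ^ 4 + 6 * (\<mu> - c)\<^sup>2 * \<nu> + 3 * \<nu>\<^sup>2)"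
proof -
  let ?s = "sqrt \<nu>" and ?u = "\<mu> - c"
  have s: "0 < ?s" "?s\<^sup>2 = \<nu>" using assms by auto
  let ?g = "\<lambda>j y. gauss \<mu> \<nu> y * (y - \<mu>) ^ j"
  have N0: "has_bochner_integral lborel (?g 0) 1"
    using normal_moment_even[OF s(1), of \<mu> 0] by (simp add: gauss_def)
  have N1: "has_bochner_integral lborel (?g 1) 0"
    using normal_moment_odd[OF s(1), of \<mu> 0] by (simp add: gauss_def)
  have N2: "has_bochner_integral lborel (?g 2) \<nu>"
    using normal_moment_even[OF s(1), of \<mu> 1] assms by (simp add: gauss_def)
  have N3: "has_bochner_integral lborel (?g 3) 0"
    using normal_moment_odd[OF s(1), of \<mu> 1] by (simp add: gauss_def)
  have "fact 4 / ((2 / \<nu>) ^ 2 * fact 2) = 3 * \<nu>\<^sup>2"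
    by (simp add: fact_numeral power_divide)
  then have N4: "has_bochner_integral lborel (?g 4) (3 * \<nu>\<^sup>2)"
    using normal_moment_even[OF s(1), of \<mu> 2] assms by (simp add: gauss_def)
  have expand: "g * d ^ 1 + u * (g * d ^ 0) = g * (d + u)"
    "g * d ^ 2 + 2 * u * (g * d ^ 1) + u\<^sup>2 * (g * d ^ 0) = g * (d + u) ^ 2"
    "g * d ^ 3 + 3 * u * (g * d ^ 2) + 3 * u\<^sup>2 * (g * d ^ 1) + u ^ 3 * (g * d ^ 0) = g * (d + u) ^ 3"
    "g * d ^ 4 + 4 * u * (g * d ^ 3) + 6 * u\<^sup>2 * (g * d ^ 2) + 4 * u ^ 3 * (g * d ^ 1) + u ^ 4 * (g * d ^ 0)
      = g * (d + u) ^ 4" for g d u :: real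
    by (simp_all add: eval_nat_numeral algebra_simps)
  show "has_bochner_integral lborel (gauss \<mu> \<nu>) 1" using N0 by simp
  have "has_bochner_integral lborel (\<lambda>y. ?g 1 y + ?u * ?g 0 y) (0 + ?u * 1)"
    by (intro has_bochner_integral_add has_bochner_integral_mult_right impI N0 N1)
  then show "has_bochner_integral lborel (\<lambda>y. gauss \<mu> \<nu> y * (y - c)) (\<mu> - c)"
    unfolding expand by simp
  have "has_bochner_integral lborel (\<lambda>y. ?g 2 y + 2 * ?u * ?g 1 y + ?u\<^sup>2 * ?g 0 y) (\<nu> + 2 * ?u * 0 + ?u\<^sup>2 * 1)"
    by (intro has_bochner_integral_add has_bochner_integral_mult_right impI N0 N1 N2)
  then show "has_bochner_integral lborel (\<lambda>y. gauss \<mu> \<nu> y * (y - c) ^ 2) ((\<mu> - c)\<^sup>2 + \<nu>)"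
    unfolding expand by (simp add: add.commute)
  have "has_bochner_integral lborel (\<lambda>y. ?g 3 y + 3 * ?u * ?g 2 y + 3 * ?u\<^sup>2 * ?g 1 y + ?u ^ 3 * ?g 0 y)
      (0 + 3 * ?u * \<nu> + 3 * ?u\<^sup>2 * 0 + ?u ^ 3 * 1)"
    by (intro has_bochner_integral_add has_bochner_integral_mult_right impI N0 N1 N2 N3)
  then show "has_bochner_integral lborel (\<lambda>y. gauss \<mu> \<nu> y * (y - c) ^ 3) ((\<mu> - c) ^ 3 + 3 * (\<mu> - c) * \<nu>)"
    unfolding expand by (simp add: add.commute)
  have "has_bochner_integral lborel
      (\<lambda>y. ?g 4 y + 4 * ?u * ?g 3 y + 6 * ?u\<^sup>2 * ?g 2 y + 4 * ?u ^ 3 * ?g 1 y + ?u ^ 4 * ?g 0 y)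
      (3 * \<nu>\<^sup>2 + 4 * ?u * 0 + 6 * ?u\<^sup>2 * \<nu> + 4 * ?u ^ 3 * 0 + ?u ^ 4 * 1)"
    by (intro has_bochner_integral_add has_bochner_integral_mult_right impI N0 N1 N2 N3 N4)
  then show "has_bochner_integral lborel (\<lambda>y. gauss \<mu> \<nu> y * (y - c) ^ 4)
      ((\<mu> - c) ^ 4 + 6 * (\<mu> - c)\<^sup>2 * \<nu> + 3 * \<nu>\<^sup>2)"
    unfolding expand by (simp add: add.commute add.left_commute)
qed

section \<open>Moments and Hellinger distance in the mixture model\<close>

lemma nn_integral_inverse_1_plus_square:
  obtains I where "0 \<le> I" "(\<integral>\<^sup>+y. ennreal (1 / (1 + (y::real)\<^sup>2)) \<partial>lborel) = ennreal I"
proof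
  have "integrable lborel (\<lambda>y::real. 1 / (1 + y\<^sup>2))"
    using integrable_inverse_1_plus_square by (simp add: set_integrable_def inverse_eq_divide)
  then show "(\<integral>\<^sup>+y. ennreal (1 / (1 + (y::real)\<^sup>2)) \<partial>lborel) = ennreal (\<integral>y. 1 / (1 + y\<^sup>2) \<partial>lborel)"
    by (intro nn_integral_eq_integral) auto
  show "0 \<le> (\<integral>y. 1 / (1 + (y::real)\<^sup>2) \<partial>lborel)" by simp
qed

lemma square_le_mult_1_plus_square: "(y - c)\<^sup>2 \<le> 2 * (1 + c\<^sup>2) * (1 + y\<^sup>2)" for y c :: real
proof -
  have "0 \<le> (y + c)\<^sup>2" "0 \<le> c\<^sup>2 * y\<^sup>2" by simp_all
  then show ?thesis by (simp add: power2_eq_square algebra_simps)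
qed

text \<open>The compact parameter set is replaced by bounds: one radius r for the support, the
  slopes and the intercepts, and an interval for the variances. The normalisation r \<ge> 1 places
  the unit vectors in the ball where moments will be compared.\<close>

locale gaussian_mixture =
  fixes fbar :: "real ^ 'd \<Rightarrow> real" and a0 :: "real ^ 'd" and b0 nu0 r v0 v1 :: real
  assumes fbar_measurable [measurable]: "fbar \<in> borel_measurable borel"
    and fbar_nonneg: "0 \<le> fbar x"
    and fbar_supp: "r < norm x \<Longrightarrow> fbar x = 0"
    and fbar_integral: "(\<integral>\<^sup>+x. ennreal (fbar x) \<partial>lborel) = 1"
    and r: "1 \<le> r" and v: "0 < v0" "v0 \<le> v1"
    and par0: "norm a0 \<le> r" "\<bar>b0\<bar> \<le> r" "v0 \<le> nu0" "nu0 \<le> v1"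
begin

definition box :: "(real \<times> (real ^ 'd) \<times> real \<times> real) set" where
  "box = {(lam, a, b, nu). 0 \<le> lam \<and> lam \<le> 1 \<and> norm a \<le> r \<and> \<bar>b\<bar> \<le> r \<and> v0 \<le> nu \<and> nu \<le> v1}"

definition mix :: "real \<times> (real ^ 'd) \<times> real \<times> real \<Rightarrow> real ^ 'd \<Rightarrow> real \<Rightarrow> real" where
  "mix par x y = (case par of (lam, a, b, nu) \<Rightarrow> mix_dens a0 b0 nu0 lam a b nu x y)"

lemma mean_bound: "norm a \<le> r \<Longrightarrow> \<bar>b\<bar> \<le> r \<Longrightarrow> norm x \<le> r \<Longrightarrow> \<bar>a \<bullet> x + b\<bar> \<le> r\<^sup>2 + r"
  for a x :: "real ^ 'd"
proof -
  assume H: "norm a \<le> r" "\<bar>b\<bar> \<le> r" "norm x \<le> r"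
  have "\<bar>a \<bullet> x\<bar> \<le> r * r"
    using H Cauchy_Schwarz_ineq2[of a x] mult_mono[of "norm a" r "norm x" r] r by auto
  then show ?thesis using H by (simp add: power2_eq_square)
qed

lemma measurable_mix [measurable]:
  "(\<lambda>z. mix par (fst z) (snd z)) \<in> borel_measurable (borel \<Otimes>\<^sub>M borel)"
  "mix par x \<in> borel_measurable borel"
proof -
  obtain lam a b nu where p: "par = (lam, a, b, nu)" by (cases par) auto
  show "(\<lambda>z. mix par (fst z) (snd z)) \<in> borel_measurable (borel \<Otimes>\<^sub>M borel)"
    unfolding p mix_def mix_dens_def gauss_def normal_density_def prod.case by measurable
  show "mix par x \<in> borel_measurable borel"
    unfolding p mix_def mix_dens_def gauss_def normal_density_def prod.case by measurable
qed

lemma mix_pos: "par \<in> box \<Longrightarrow> 0 < mix par x y"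
proof -
  assume "par \<in> box"
  then obtain lam a b nu where p: "par = (lam, a, b, nu)" "0 \<le> lam" "lam \<le> 1" "v0 \<le> nu"
    by (auto simp: box_def)
  then have "0 < gauss (a0 \<bullet> x + b0) nu0 y" "0 < gauss (a \<bullet> x + b) nu y"
    using v par0 by (auto intro: gauss_pos)
  then show ?thesis using p
    by (cases "lam = 0") (auto simp: mix_def mix_dens_def intro!: add_nonneg_pos)
qed

lemma mix_decay:
  obtains C where "0 < C"
    "\<And>par x y. par \<in> box \<Longrightarrow> norm x \<le> r \<Longrightarrow> mix par x y * (1 + y\<^sup>2) ^ j \<le> C"
proof -
  have "0 \<le> r\<^sup>2 + r" using r by simp
  then obtain C where C: "0 < C"
    "\<And>\<mu> \<nu> y. \<bar>\<mu>\<bar> \<le> r\<^sup>2 + r \<Longrightarrow> v0 \<le> \<nu> \<Longrightarrow> \<nu> \<le> v1 \<Longrightarrow> gauss \<mu> \<nu> y * (1 + y\<^sup>2) ^ j \<le> C"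
    using gauss_decay[OF v, of "r\<^sup>2 + r" j] by blast
  show thesis
  proof (rule that[OF C(1)])
    fix par x y assume "par \<in> box" and x: "norm (x :: real ^ 'd) \<le> r"
    then obtain lam a b nu where p: "par = (lam, a, b, nu)" "0 \<le> lam" "lam \<le> 1" "norm a \<le> r"
      "\<bar>b\<bar> \<le> r" "v0 \<le> nu" "nu \<le> v1" by (auto simp: box_def)
    have "mix par x y * (1 + y\<^sup>2) ^ j = (1 - lam) * (gauss (a0 \<bullet> x + b0) nu0 y * (1 + y\<^sup>2) ^ j)
        + lam * (gauss (a \<bullet> x + b) nu y * (1 + y\<^sup>2) ^ j)"
      by (simp add: p mix_def mix_dens_def algebra_simps)
    also have "\<dots> \<le> (1 - lam) * C + lam * C"
      using p x par0 by (intro add_mono mult_left_mono C mean_bound) auto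
    finally show "mix par x y * (1 + y\<^sup>2) ^ j \<le> C" by (simp add: algebra_simps)
  qed
qed

text \<open>Unlike the decay and Lipschitz bounds, this one holds for every x. It supplies the
  bracket outside the ball of radius r, where the data may lie because the estimator is controlled
  at every sample.\<close>

lemma mix_bounded: obtains C where "0 < C" "\<And>par x y. par \<in> box \<Longrightarrow> mix par x y \<le> C"
proof -
  define C where "C = 1 / sqrt (2 * pi * v0)"
  have C: "0 < C" using v by (simp add: C_def)
  have g: "gauss \<mu> \<nu> y \<le> C" if "v0 \<le> \<nu>" for \<mu> \<nu> y
    using that v unfolding gauss_eq[OF less_le_trans[OF v(1) that]] C_def by (intro frac_le) auto
  show thesis
  proof (rule that[OF C])
    fix par x y assume "par \<in> box"
    then obtain lam a b nu where p: "par = (lam, a, b, nu)" "0 \<le> lam" "lam \<le> 1" "v0 \<le> nu"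
      by (auto simp: box_def)
    then have "mix par x y \<le> (1 - lam) * C + lam * C"
      unfolding mix_def mix_dens_def using par0 by (auto intro!: add_mono mult_left_mono g)
    then show "mix par x y \<le> C" by (simp add: algebra_simps)
  qed
qed

text \<open>The weight 1 / (1 + y^2) is kept because this bound becomes the margin of the upper
  brackets, which must be integrable in y.\<close>

lemma mix_lipschitz:
  obtains L where "0 < L"
    "\<And>par par' x y. par \<in> box \<Longrightarrow> par' \<in> box \<Longrightarrow> norm x \<le> r \<Longrightarrow>
      \<bar>mix par x y - mix par' x y\<bar> \<le> L * norm (par - par') / (1 + y\<^sup>2)"
proof -
  define m where "m = r\<^sup>2 + r"
  have m: "0 \<le> m" using r by (simp add: m_def)
  obtain C where C: "0 < C"
    "\<And>\<mu> \<nu> y. \<bar>\<mu>\<bar> \<le> m \<Longrightarrow> v0 \<le> \<nu> \<Longrightarrow> \<nu> \<le> v1 \<Longrightarrow> gauss \<mu> \<nu> y * (1 + y\<^sup>2) ^ 1 \<le> C"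
    using gauss_decay[OF v m, of 1] by blast
  obtain L where L: "0 < L"
    "\<And>\<mu> \<mu>' \<nu> \<nu>' y. \<bar>\<mu>\<bar> \<le> m \<Longrightarrow> \<bar>\<mu>'\<bar> \<le> m \<Longrightarrow> v0 \<le> \<nu> \<Longrightarrow> \<nu> \<le> v1 \<Longrightarrow> v0 \<le> \<nu>' \<Longrightarrow> \<nu>' \<le> v1 \<Longrightarrow>
      \<bar>gauss \<mu> \<nu> y - gauss \<mu>' \<nu>' y\<bar> \<le> L * (\<bar>\<mu> - \<mu>'\<bar> + \<bar>\<nu> - \<nu>'\<bar>) / (1 + y\<^sup>2)"
    using gauss_lipschitz[OF v m] by blast
  show thesis
  proof (rule that)
    show "0 < 2 * C + L * (r + 2)" using C L r by (simp add: add_pos_pos)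
    fix par par' :: "real \<times> (real ^ 'd) \<times> real \<times> real" and x :: "real ^ 'd" and y :: real
    assume "par \<in> box" "par' \<in> box" and x: "norm x \<le> r"
    then obtain lam a b nu lam' a' b' nu' where p: "par = (lam, a, b, nu)" "0 \<le> lam" "lam \<le> 1" "norm a \<le> r"
      "\<bar>b\<bar> \<le> r" "v0 \<le> nu" "nu \<le> v1" and p': "par' = (lam', a', b', nu')" "0 \<le> lam'" "lam' \<le> 1" "norm a' \<le> r"
      "\<bar>b'\<bar> \<le> r" "v0 \<le> nu'" "nu' \<le> v1" by (auto simp: box_def)
    define d where "d = norm (par - par')"
    have d: "par - par' = (lam - lam', a - a', b - b', nu - nu')" by (simp add: p p')
    have d1: "\<bar>lam - lam'\<bar> \<le> d"
      using norm_fst_le[of "lam - lam'" "(a - a', b - b', nu - nu')"] unfolding d_def d by simp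
    have s1: "norm (a - a', b - b', nu - nu') \<le> d"
      using norm_snd_le[of "(a - a', b - b', nu - nu')" "lam - lam'"] unfolding d_def d by simp
    have d2: "norm (a - a') \<le> d" using norm_fst_le[of "a - a'" "(b - b', nu - nu')"] s1 by linarith
    have s2: "norm (b - b', nu - nu') \<le> d" using norm_snd_le[of "(b - b', nu - nu')" "a - a'"] s1 by linarith
    have d3: "\<bar>b - b'\<bar> \<le> d" using norm_fst_le[of "b - b'" "nu - nu'"] s2 by simp
    have d4: "\<bar>nu - nu'\<bar> \<le> d" using norm_snd_le[of "nu - nu'" "b - b'"] s2 by simp
    let ?w = "1 + y\<^sup>2"
    have w: "0 < ?w" by (simp add: add_pos_nonneg)
    let ?h = "gauss (a0 \<bullet> x + b0) nu0 y" and ?g = "gauss (a \<bullet> x + b) nu y" and ?g' = "gauss (a' \<bullet> x + b') nu' y"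
    have g: "?h \<le> C / ?w" "?g \<le> C / ?w" "0 \<le> ?h" "0 \<le> ?g"
      using C(2)[of "a0 \<bullet> x + b0" nu0 y] C(2)[of "a \<bullet> x + b" nu y] p par0 x w
      by (auto simp: m_def mean_bound le_divide_eq gauss_nonneg)
    have "\<bar>(a \<bullet> x + b) - (a' \<bullet> x + b')\<bar> = \<bar>(a - a') \<bullet> x + (b - b')\<bar>" by (simp add: inner_diff_left)
    also have "\<dots> \<le> d * r + d"
      using Cauchy_Schwarz_ineq2[of "a - a'" x] mult_mono[OF d2 x] d2 d3 r
      by (smt (verit) norm_ge_zero)
    finally have "\<bar>(a \<bullet> x + b) - (a' \<bullet> x + b')\<bar> + \<bar>nu - nu'\<bar> \<le> (r + 2) * d"
      using d4 by (simp add: algebra_simps)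
    then have "L * (\<bar>(a \<bullet> x + b) - (a' \<bullet> x + b')\<bar> + \<bar>nu - nu'\<bar>) / ?w \<le> L * ((r + 2) * d) / ?w"
      using L w by (intro divide_right_mono mult_left_mono) auto
    then have gg: "\<bar>?g - ?g'\<bar> \<le> L * ((r + 2) * d) / ?w"
      using L(2)[of "a \<bullet> x + b" "a' \<bullet> x + b'" nu nu' y] p p' x by (auto simp: m_def mean_bound)
    have "(1 - l) * u + l * w - ((1 - l') * u + l' * w') = (l - l') * (w - u) + l' * (w - w')"
      for l l' u w w' :: real by (simp add: algebra_simps)
    then have "mix par x y - mix par' x y = (lam - lam') * (?g - ?h) + lam' * (?g - ?g')"
      unfolding p p' mix_def mix_dens_def prod.case .
    then have "\<bar>mix par x y - mix par' x y\<bar> \<le> \<bar>lam - lam'\<bar> * \<bar>?g - ?h\<bar> + lam' * \<bar>?g - ?g'\<bar>"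
      using p' abs_triangle_ineq[of "(lam - lam') * (?g - ?h)" "lam' * (?g - ?g')"] by (simp add: abs_mult)
    also have "\<dots> \<le> d * (2 * (C / ?w)) + 1 * (L * ((r + 2) * d) / ?w)"
      using g gg d1 p' by (intro add_mono mult_mono) auto
    also have "\<dots> = (2 * C + L * (r + 2)) * d / ?w" by (simp add: add_divide_distrib algebra_simps)
    finally show "\<bar>mix par x y - mix par' x y\<bar> \<le> (2 * C + L * (r + 2)) * norm (par - par') / ?w"
      by (simp add: d_def)
  qed
qed

lemma nn_integral_mix: "par \<in> box \<Longrightarrow> (\<integral>\<^sup>+y. ennreal (mix par x y) \<partial>lborel) = 1"
proof -
  assume p: "par \<in> box"
  then obtain lam a b nu where q: "par = (lam, a, b, nu)" "0 < nu"
    using v by (auto simp: box_def)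
  have "has_bochner_integral lborel (mix par x) ((1 - lam) * 1 + lam * 1)"
    unfolding mix_def q mix_dens_def prod.case using q v par0
    by (intro has_bochner_integral_add has_bochner_integral_mult_right impI gauss_moments) auto
  then show ?thesis
    using mix_pos[OF p] by (subst nn_integral_eq_integral) (auto simp: has_bochner_integral_iff less_imp_le)
qed

lemma nn_integral_fbar_mult:
  assumes [measurable]: "(\<lambda>z. g (fst z) (snd z)) \<in> borel_measurable (borel \<Otimes>\<^sub>M borel)"
    and "\<And>x y. 0 \<le> g x y"
  shows "(\<integral>\<^sup>+z. ennreal (fbar (fst z) * g (fst z) (snd z)) \<partial>lborel)
    = (\<integral>\<^sup>+x. ennreal (fbar x) * (\<integral>\<^sup>+y. ennreal (g x y) \<partial>lborel) \<partial>lborel)"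
proof -
  have [measurable]: "(\<lambda>y. g x y) \<in> borel_measurable borel" for x
  proof -
    have "(\<lambda>y. (\<lambda>z. g (fst z) (snd z)) (x, y)) \<in> borel_measurable borel" by measurable
    then show ?thesis by simp
  qed
  have "(\<integral>\<^sup>+z. ennreal (fbar (fst z) * g (fst z) (snd z)) \<partial>lborel)
      = (\<integral>\<^sup>+z. ennreal (fbar (fst z) * g (fst z) (snd z)) \<partial>(lborel \<Otimes>\<^sub>M lborel))"
    by (simp add: lborel_prod)
  also have "\<dots> = (\<integral>\<^sup>+x. \<integral>\<^sup>+y. ennreal (fbar x * g x y) \<partial>lborel \<partial>lborel)"
    by (subst lborel.nn_integral_fst[symmetric]) (simp, measurable)
  also have "\<dots> = (\<integral>\<^sup>+x. ennreal (fbar x) * (\<integral>\<^sup>+y. ennreal (g x y) \<partial>lborel) \<partial>lborel)"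
    using assms fbar_nonneg by (simp add: ennreal_mult nn_integral_cmult)
  finally show ?thesis .
qed

lemma nn_integral_fbar_mix:
  "par \<in> box \<Longrightarrow> (\<integral>\<^sup>+z. ennreal (fbar (fst z) * mix par (fst z) (snd z)) \<partial>lborel) = 1"
  by (subst nn_integral_fbar_mult)
    (auto simp: mix_pos less_imp_le nn_integral_mix fbar_integral)

text \<open>Squared Hellinger distance of the two joint laws without the customary factor 1/2, so
  its range is [0, 2]; \<open>affinity\<close> is the Bhattacharyya coefficient of the same
  laws.\<close>

definition hellinger2 where
  "hellinger2 par par' = (\<integral>\<^sup>+z. ennreal (fbar (fst z) *
     (sqrt (mix par (fst z) (snd z)) - sqrt (mix par' (fst z) (snd z)))\<^sup>2) \<partial>lborel)"

definition affinity where
  "affinity par par' = (\<integral>\<^sup>+z. ennreal (fbar (fst z) *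
     sqrt (mix par (fst z) (snd z) * mix par' (fst z) (snd z))) \<partial>lborel)"

lemma measurable_mix_borel [measurable]:
  "(fst :: (real ^ 'd) \<times> real \<Rightarrow> _) \<in> borel_measurable borel"
  "(snd :: (real ^ 'd) \<times> real \<Rightarrow> _) \<in> borel_measurable borel"
  "(\<lambda>z. mix par (fst z) (snd z)) \<in> borel_measurable borel"
  using measurable_fst[of "borel :: (real ^ 'd) measure" "borel :: real measure"]
    measurable_snd[of "borel :: (real ^ 'd) measure" "borel :: real measure"] measurable_mix(1)
  unfolding borel_prod by auto

text \<open>Integrate the expanded square; both joint laws have mass 1. The additive form avoids
  subtraction in \<open>ennreal\<close>.\<close>

lemma hellinger2_add_affinity:
  assumes "par \<in> box" "par' \<in> box"
  shows "hellinger2 par par' + 2 * affinity par par' = 2"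
proof -
  let ?p = "\<lambda>z. mix par (fst z) (snd z)" and ?q = "\<lambda>z. mix par' (fst z) (snd z)"
  note nn = mix_pos[OF assms(1), THEN less_imp_le] mix_pos[OF assms(2), THEN less_imp_le]
  have "hellinger2 par par' + 2 * affinity par par' =
      (\<integral>\<^sup>+z. ennreal (fbar (fst z) * (sqrt (?p z) - sqrt (?q z))\<^sup>2)
        + 2 * ennreal (fbar (fst z) * sqrt (?p z * ?q z)) \<partial>lborel)"
    unfolding hellinger2_def affinity_def
    by (subst nn_integral_add) (auto simp: nn_integral_cmult)
  also have "\<dots> = (\<integral>\<^sup>+z. ennreal (fbar (fst z) * ?p z) + ennreal (fbar (fst z) * ?q z) \<partial>lborel)"
  proof (intro nn_integral_cong)
    fix z
    have "fbar (fst z) * (sqrt (?p z) - sqrt (?q z))\<^sup>2 + 2 * (fbar (fst z) * sqrt (?p z * ?q z))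
        = fbar (fst z) * ?p z + fbar (fst z) * ?q z"
      using nn by (simp add: power2_eq_square algebra_simps real_sqrt_mult)
    then show "ennreal (fbar (fst z) * (sqrt (?p z) - sqrt (?q z))\<^sup>2) + 2 * ennreal (fbar (fst z) * sqrt (?p z * ?q z))
        = ennreal (fbar (fst z) * ?p z) + ennreal (fbar (fst z) * ?q z)"
      using nn fbar_nonneg
      by (simp add: ennreal_plus[symmetric] ennreal_mult''[of _ 2, symmetric, unfolded ennreal_numeral] mult.commute del: ennreal_plus)
  qed
  also have "\<dots> = 1 + 1"
    by (subst nn_integral_add) (auto simp: nn_integral_fbar_mix assms)
  finally show ?thesis by (simp add: one_add_one)
qed

text \<open>Centring at the mean of the known component removes its odd moments and leaves only the
  constants nu0 and 3 nu0^2 from its second and fourth, which cancel in differences.\<close>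

definition moment :: "nat \<Rightarrow> real \<times> (real ^ 'd) \<times> real \<times> real \<Rightarrow> real ^ 'd \<Rightarrow> real" where
  "moment k par x = (\<integral>y. mix par x y * (y - (a0 \<bullet> x + b0)) ^ k \<partial>lborel)"

text \<open>Writing nu = nu0 + S sorts the terms: up to constants, the third moment is its leading
  polynomial plus 3 nu0 times the first, and the fourth is its leading polynomial plus 6 nu0 times
  that of the second. This triangular shape lets the nu0 terms be removed at the cost of a constant
  factor.\<close>

lemma mixture_moments:
  fixes lam b nu :: real and a x :: "real ^ 'd"
  defines "u \<equiv> (a - a0) \<bullet> x + (b - b0)" and "S \<equiv> nu - nu0" and "par \<equiv> (lam, a, b, nu)"
  assumes par: "par \<in> box"
  shows "moment 1 par x = lam * u"
    and "moment 2 par x = lam * (u\<^sup>2 + S) + nu0"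
    and "moment 3 par x = lam * (u ^ 3 + 3 * u * S) + 3 * nu0 * (lam * u)"
    and "moment 4 par x = lam * (u ^ 4 + 6 * u\<^sup>2 * S + 3 * S\<^sup>2) + 6 * nu0 * (lam * (u\<^sup>2 + S)) + 3 * nu0\<^sup>2"
    and "1 \<le> k \<Longrightarrow> k \<le> 4 \<Longrightarrow> integrable lborel (\<lambda>y. mix par x y * (y - (a0 \<bullet> x + b0)) ^ k)"
proof -
  have nu: "0 < nu" "0 < nu0" using par v par0 by (auto simp: box_def par_def)
  let ?c = "a0 \<bullet> x + b0"
  have u: "u = a \<bullet> x + b - ?c" by (simp add: u_def inner_diff_left)
  have mix: "(\<lambda>y. mix par x y * g y) = (\<lambda>y. (1 - lam) * (gauss ?c nu0 y * g y) + lam * (gauss (a \<bullet> x + b) nu y * g y))" for g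
    by (auto simp: par_def mix_def mix_dens_def algebra_simps)
  have H: "has_bochner_integral lborel (\<lambda>y. mix par x y * g y) ((1 - lam) * m0 + lam * m1)"
    if "has_bochner_integral lborel (\<lambda>y. gauss ?c nu0 y * g y) m0"
      "has_bochner_integral lborel (\<lambda>y. gauss (a \<bullet> x + b) nu y * g y) m1" for g m0 m1
    unfolding mix by (intro has_bochner_integral_add has_bochner_integral_mult_right impI that)
  note G0 = gauss_moments(2-5)[OF nu(2), of ?c ?c] and G1 = gauss_moments(2-5)[OF nu(1), of "a \<bullet> x + b" ?c]
  have m: "has_bochner_integral lborel (\<lambda>y. mix par x y * (y - ?c) ^ 1) (lam * u)"
    "has_bochner_integral lborel (\<lambda>y. mix par x y * (y - ?c) ^ 2) (lam * (u\<^sup>2 + S) + nu0)"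
    "has_bochner_integral lborel (\<lambda>y. mix par x y * (y - ?c) ^ 3) (lam * (u ^ 3 + 3 * u * S) + 3 * nu0 * (lam * u))"
    "has_bochner_integral lborel (\<lambda>y. mix par x y * (y - ?c) ^ 4)
      (lam * (u ^ 4 + 6 * u\<^sup>2 * S + 3 * S\<^sup>2) + 6 * nu0 * (lam * (u\<^sup>2 + S)) + 3 * nu0\<^sup>2)"
    using H[OF G0(1) G1(1)] H[OF G0(2) G1(2)] H[OF G0(3) G1(3)] H[OF G0(4) G1(4)]
    unfolding u[symmetric] S_def by (simp_all add: algebra_simps power2_eq_square)
  show "moment 1 par x = lam * u" "moment 2 par x = lam * (u\<^sup>2 + S) + nu0"
    "moment 3 par x = lam * (u ^ 3 + 3 * u * S) + 3 * nu0 * (lam * u)"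
    "moment 4 par x = lam * (u ^ 4 + 6 * u\<^sup>2 * S + 3 * S\<^sup>2) + 6 * nu0 * (lam * (u\<^sup>2 + S)) + 3 * nu0\<^sup>2"
    unfolding moment_def using m by (auto intro: has_bochner_integral_integral_eq)
  assume "1 \<le> k" "k \<le> 4"
  then consider "k = 1" | "k = 2" | "k = 3" | "k = 4" by linarith
  then show "integrable lborel (\<lambda>y. mix par x y * (y - ?c) ^ k)"
    using m by cases (auto simp: has_bochner_integral_iff)
qed

text \<open>The common degree bound 4 allows a single Remez constant for all four moments.\<close>

lemma moment_poly:
  assumes "par \<in> box" "1 \<le> k" "k \<le> 4"
  shows "\<exists>p a b. degree p \<le> 4 \<and> (\<forall>x. moment k par x = poly p (a \<bullet> x + b))"
proof -
  obtain lam a b nu where par: "par = (lam, a, b, nu)" by (cases par) auto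
  note mm = mixture_moments[OF assms(1)[unfolded par]]
  let ?S = "nu - nu0"
  let ?H = "\<lambda>p. degree p \<le> 4 \<and> (\<forall>x. moment k par x = poly p ((a - a0) \<bullet> x + (b - b0)))"
  consider "k = 1" | "k = 2" | "k = 3" | "k = 4" using assms by linarith
  then have "\<exists>p. ?H p"
  proof cases
    case 1
    then show ?thesis by (intro exI[of _ "[:0, lam:]"]) (simp add: par mm(1)[unfolded One_nat_def])
  next
    case 2
    then show ?thesis
      by (intro exI[of _ "[:lam * ?S + nu0, 0, lam:]"]) (simp add: par mm algebra_simps power2_eq_square)
  next
    case 3
    then show ?thesis
      by (intro exI[of _ "[:0, 3 * lam * ?S + 3 * nu0 * lam, 0, lam:]"])
        (simp add: par mm algebra_simps power2_eq_square power3_eq_cube)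
  next
    case 4
    then show ?thesis
      by (intro exI[of _ "[:3 * lam * ?S\<^sup>2 + 6 * nu0 * lam * ?S + 3 * nu0\<^sup>2, 0, 6 * lam * ?S + 6 * nu0 * lam, 0, lam:]"])
        (simp add: par mm algebra_simps power2_eq_square power4_eq_xxxx)
  qed
  then show ?thesis by blast
qed

lemma moment_diff_le_integral:
  assumes "par \<in> box" "par' \<in> box" "1 \<le> k" "k \<le> 4"
  shows "ennreal \<bar>moment k par x - moment k par' x\<bar>
    \<le> (\<integral>\<^sup>+y. ennreal (\<bar>mix par x y - mix par' x y\<bar> * \<bar>y - (a0 \<bullet> x + b0)\<bar> ^ k) \<partial>lborel)"
proof -
  have int: "integrable lborel (\<lambda>y. mix q x y * (y - (a0 \<bullet> x + b0)) ^ k)" if "q \<in> box" for q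
    using mixture_moments(5)[of "fst q" "fst (snd q)" "fst (snd (snd q))" "snd (snd (snd q))" k x] that assms
    by simp
  have "moment k par x - moment k par' x =
      (\<integral>y. mix par x y * (y - (a0 \<bullet> x + b0)) ^ k - mix par' x y * (y - (a0 \<bullet> x + b0)) ^ k \<partial>lborel)"
    unfolding moment_def using int assms by (simp add: Bochner_Integration.integral_diff)
  also have "\<dots> = (\<integral>y. (mix par x y - mix par' x y) * (y - (a0 \<bullet> x + b0)) ^ k \<partial>lborel)"
    by (simp add: left_diff_distrib)
  finally have eq: "moment k par x - moment k par' x = \<dots>" .
  have "integrable lborel (\<lambda>y. (mix par x y - mix par' x y) * (y - (a0 \<bullet> x + b0)) ^ k)"
    using Bochner_Integration.integrable_diff[OF int[OF assms(1)] int[OF assms(2)]]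
    by (simp add: left_diff_distrib)
  from integral_norm_bound_ennreal[OF this] show ?thesis
    unfolding eq by (simp add: abs_mult power_abs)
qed

text \<open>AM-GM with weight $s$: $|p - q|\,|T| = |\sqrt p - \sqrt q|\,|T|(\sqrt p + \sqrt q)$ splits into
  a Hellinger term and a second moment of $T$.\<close>
lemma integral_moment_diff_le:
  obtains C where "0 < C"
    "\<And>par par' s k. par \<in> box \<Longrightarrow> par' \<in> box \<Longrightarrow> 0 < s \<Longrightarrow> hellinger2 par par' \<le> ennreal (s\<^sup>2) \<Longrightarrow>
      1 \<le> k \<Longrightarrow> k \<le> 4 \<Longrightarrow>
      (\<integral>\<^sup>+x. ennreal (fbar x * \<bar>moment k par x - moment k par' x\<bar>) \<partial>lborel) \<le> ennreal (C * s)"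
proof -
  \<comment> \<open>The squared weight (y - c)^(2k) with k \<le> 4 costs four powers of 1 + y^2; the
    fifth leaves the integrable factor 1 / (1 + y^2).\<close>
  obtain B where B: "0 < B" "\<And>par x y. par \<in> box \<Longrightarrow> norm x \<le> r \<Longrightarrow> mix par x y * (1 + y\<^sup>2) ^ 5 \<le> B"
    using mix_decay[of 5] by blast
  obtain I where I: "0 \<le> I" "(\<integral>\<^sup>+y. ennreal (1 / (1 + (y::real)\<^sup>2)) \<partial>lborel) = ennreal I"
    by (rule nn_integral_inverse_1_plus_square)
  define K where "K = 2 * (1 + (r\<^sup>2 + r)\<^sup>2)"
  have K: "1 \<le> K" by (simp add: K_def)
  define D where "D = 4 * (K ^ 4 * B)"
  have D: "0 < D" using K B by (simp add: D_def)
  define C where "C = 1 / 2 + D * I / 2"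
  show thesis
  proof (rule that)
    show "0 < C" using D I by (simp add: C_def add_pos_nonneg)
    fix par par' and s :: real and k :: nat
    assume box: "par \<in> box" "par' \<in> box" and s: "0 < s" and hel: "hellinger2 par par' \<le> ennreal (s\<^sup>2)"
      and k: "1 \<le> k" "k \<le> 4"
    note nn = mix_pos[OF box(1), THEN less_imp_le] mix_pos[OF box(2), THEN less_imp_le]
    let ?p = "\<lambda>x y. mix par x y" and ?q = "\<lambda>x y. mix par' x y"
    let ?T = "\<lambda>x y. \<bar>y - (a0 \<bullet> x + b0)\<bar> ^ k"
    have pt: "\<bar>?p x y - ?q x y\<bar> * ?T x y
        \<le> 1 / (2 * s) * (sqrt (?p x y) - sqrt (?q x y))\<^sup>2 + s * D / 2 * (1 / (1 + y\<^sup>2))"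
      if x: "norm x \<le> r" for x y
    proof -
      define \<alpha> where "\<alpha> = \<bar>sqrt (?p x y) - sqrt (?q x y)\<bar>"
      define \<beta> where "\<beta> = ?T x y * (sqrt (?p x y) + sqrt (?q x y))"
      have w: "1 \<le> 1 + y\<^sup>2" by simp
      have "(y - (a0 \<bullet> x + b0))\<^sup>2 \<le> 2 * (1 + (a0 \<bullet> x + b0)\<^sup>2) * (1 + y\<^sup>2)"
        by (rule square_le_mult_1_plus_square)
      also have "\<dots> \<le> K * (1 + y\<^sup>2)"
        using mean_bound[OF par0(1,2) x] r unfolding K_def
        by (intro mult_right_mono mult_left_mono add_mono order_refl) (auto simp: abs_le_square_iff[symmetric])
      finally have "((y - (a0 \<bullet> x + b0))\<^sup>2) ^ k \<le> (K * (1 + y\<^sup>2)) ^ k"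
        by (intro power_mono) auto
      also have "\<dots> \<le> (K * (1 + y\<^sup>2)) ^ 4"
        using k mult_mono[OF K w] K by (intro power_increasing) auto
      also have "\<dots> = K ^ 4 * (1 + y\<^sup>2) ^ 4" by (rule power_mult_distrib)
      also have "((y - (a0 \<bullet> x + b0))\<^sup>2) ^ k = (?T x y)\<^sup>2"
        by (metis power2_abs power_mult mult.commute)
      finally have T2: "(?T x y)\<^sup>2 \<le> K ^ 4 * (1 + y\<^sup>2) ^ 4" .
      have TB: "(?T x y)\<^sup>2 * mix q x y \<le> K ^ 4 * B / (1 + y\<^sup>2)" if q: "q \<in> box" for q
      proof -
        have "(?T x y)\<^sup>2 * mix q x y \<le> K ^ 4 * (1 + y\<^sup>2) ^ 4 * mix q x y"
          using T2 mix_pos[OF q] by (intro mult_right_mono) (auto intro: less_imp_le)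
        also have "\<dots> = K ^ 4 * (mix q x y * (1 + y\<^sup>2) ^ 5) / (1 + y\<^sup>2)"
          using w by (simp add: eval_nat_numeral)
        also have "\<dots> \<le> K ^ 4 * B / (1 + y\<^sup>2)"
          using B(2)[OF q x] K w by (intro divide_right_mono mult_left_mono) auto
        finally show ?thesis .
      qed
      have "\<bar>?p x y - ?q x y\<bar> = \<alpha> * (sqrt (?p x y) + sqrt (?q x y))"
      proof -
        have "?p x y - ?q x y = (sqrt (?p x y) - sqrt (?q x y)) * (sqrt (?p x y) + sqrt (?q x y))"
          using nn by (simp add: algebra_simps)
        then show ?thesis using nn by (simp add: \<alpha>_def abs_mult)
      qed
      then have 1: "\<bar>?p x y - ?q x y\<bar> * ?T x y = \<alpha> * \<beta>" by (simp add: \<beta>_def)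
      have "0 \<le> (\<alpha> - s * \<beta>)\<^sup>2" by simp
      then have "2 * s * (\<alpha> * \<beta>) \<le> \<alpha>\<^sup>2 + s\<^sup>2 * \<beta>\<^sup>2" by (simp add: power2_eq_square algebra_simps)
      then have 2: "\<alpha> * \<beta> \<le> 1 / (2 * s) * \<alpha>\<^sup>2 + s / 2 * \<beta>\<^sup>2"
        using s by (simp add: field_simps power2_eq_square)
      have "(sqrt (?p x y) + sqrt (?q x y))\<^sup>2 \<le> 2 * (?p x y + ?q x y)"
        using sum_squares_bound[of "sqrt (?p x y)" "sqrt (?q x y)"] nn by (simp add: power2_sum)
      then have "\<beta>\<^sup>2 \<le> (?T x y)\<^sup>2 * (2 * (?p x y + ?q x y))"
        unfolding \<beta>_def power_mult_distrib by (intro mult_left_mono) auto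
      also have "\<dots> \<le> D / (1 + y\<^sup>2)"
      proof -
        have "(?T x y)\<^sup>2 * (2 * (?p x y + ?q x y)) = 2 * ((?T x y)\<^sup>2 * ?p x y) + 2 * ((?T x y)\<^sup>2 * ?q x y)"
          by (simp only: distrib_left mult.left_commute)
        also have "\<dots> \<le> 2 * (K ^ 4 * B / (1 + y\<^sup>2)) + 2 * (K ^ 4 * B / (1 + y\<^sup>2))"
          by (intro add_mono mult_left_mono TB box) auto
        also have "\<dots> = D / (1 + y\<^sup>2)" by (simp add: D_def)
        finally show ?thesis .
      qed
      finally have "s / 2 * \<beta>\<^sup>2 \<le> s / 2 * (D / (1 + y\<^sup>2))"
        using s by (intro mult_left_mono) auto
      also have "\<dots> = s * D / 2 * (1 / (1 + y\<^sup>2))" by simp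
      finally show ?thesis using 1 2 unfolding \<alpha>_def power2_abs by linarith
    qed
    have "(\<integral>\<^sup>+x. ennreal (fbar x * \<bar>moment k par x - moment k par' x\<bar>) \<partial>lborel)
        \<le> (\<integral>\<^sup>+x. ennreal (fbar x) * (\<integral>\<^sup>+y. ennreal (\<bar>?p x y - ?q x y\<bar> * ?T x y) \<partial>lborel) \<partial>lborel)"
      by (intro nn_integral_mono order_trans[OF eq_refl[OF ennreal_mult'[OF fbar_nonneg]]]
          mult_left_mono moment_diff_le_integral box k) simp
    also have "\<dots> = (\<integral>\<^sup>+z. ennreal (fbar (fst z) * (\<bar>?p (fst z) (snd z) - ?q (fst z) (snd z)\<bar> * ?T (fst z) (snd z))) \<partial>lborel)"
      by (subst nn_integral_fbar_mult) auto
    also have "\<dots> \<le> (\<integral>\<^sup>+z. ennreal (1 / (2 * s)) * ennreal (fbar (fst z) * (sqrt (?p (fst z) (snd z)) - sqrt (?q (fst z) (snd z)))\<^sup>2)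
        + ennreal (s * D / 2) * ennreal (fbar (fst z) * (1 / (1 + (snd z)\<^sup>2))) \<partial>lborel)"
    proof (intro nn_integral_mono)
      fix z :: "(real ^ 'd) \<times> real"
      obtain x y where z: "z = (x, y)" by (cases z)
      have "fbar x * (\<bar>?p x y - ?q x y\<bar> * ?T x y) \<le>
          1 / (2 * s) * (fbar x * (sqrt (?p x y) - sqrt (?q x y))\<^sup>2) + s * D / 2 * (fbar x * (1 / (1 + y\<^sup>2)))"
      proof (cases "norm x \<le> r")
        case True
        from mult_left_mono[OF pt[OF True, of y] fbar_nonneg[of x]]
        show ?thesis by (simp only: distrib_left mult.left_commute)
      qed (simp add: fbar_supp)
      then show "ennreal (fbar (fst z) * (\<bar>?p (fst z) (snd z) - ?q (fst z) (snd z)\<bar> * ?T (fst z) (snd z)))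
        \<le> ennreal (1 / (2 * s)) * ennreal (fbar (fst z) * (sqrt (?p (fst z) (snd z)) - sqrt (?q (fst z) (snd z)))\<^sup>2)
        + ennreal (s * D / 2) * ennreal (fbar (fst z) * (1 / (1 + (snd z)\<^sup>2)))"
        using s D fbar_nonneg unfolding z fst_conv snd_conv
        by (subst (1 2) ennreal_mult[symmetric]) (auto simp: ennreal_plus[symmetric] simp del: ennreal_plus intro!: ennreal_leI)
    qed
    also have "\<dots> = ennreal (1 / (2 * s)) * hellinger2 par par' + ennreal (s * D / 2)
        * (\<integral>\<^sup>+z. ennreal (fbar (fst (z :: (real ^ 'd) \<times> real)) * (1 / (1 + (snd z)\<^sup>2))) \<partial>lborel)"
      unfolding hellinger2_def
      by (subst nn_integral_add) (auto simp: nn_integral_cmult)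
    also have "(\<integral>\<^sup>+z. ennreal (fbar (fst (z :: (real ^ 'd) \<times> real)) * (1 / (1 + (snd z)\<^sup>2))) \<partial>lborel) = ennreal I"
      using I fbar_integral by (subst nn_integral_fbar_mult) (auto simp: nn_integral_multc)
    also have "ennreal (1 / (2 * s)) * hellinger2 par par' + ennreal (s * D / 2) * ennreal I
        \<le> ennreal (1 / (2 * s)) * ennreal (s\<^sup>2) + ennreal (s * D / 2) * ennreal I"
      using hel by (intro add_right_mono mult_left_mono) auto
    also have "\<dots> = ennreal (1 / (2 * s) * s\<^sup>2 + s * D / 2 * I)"
      using s D I by (simp add: ennreal_mult[symmetric] ennreal_plus[symmetric] del: ennreal_plus)
    also have "1 / (2 * s) * s\<^sup>2 + s * D / 2 * I = C * s"
      using s by (simp add: C_def power2_eq_square algebra_simps)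
    finally show "(\<integral>\<^sup>+x. ennreal (fbar x * \<bar>moment k par x - moment k par' x\<bar>) \<partial>lborel) \<le> ennreal (C * s)" .
  qed
qed

lemma moment_diff_le:
  obtains C where "0 < C"
    "\<And>par par' s k x. par \<in> box \<Longrightarrow> par' \<in> box \<Longrightarrow> 0 < s \<Longrightarrow> hellinger2 par par' \<le> ennreal (s\<^sup>2) \<Longrightarrow>
      1 \<le> k \<Longrightarrow> k \<le> 4 \<Longrightarrow> norm x \<le> r \<Longrightarrow> \<bar>moment k par x - moment k par' x\<bar> \<le> C * s"
proof -
  obtain A where A: "0 < A"
    "\<And>par par' s k. par \<in> box \<Longrightarrow> par' \<in> box \<Longrightarrow> 0 < s \<Longrightarrow> hellinger2 par par' \<le> ennreal (s\<^sup>2) \<Longrightarrow>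
      1 \<le> k \<Longrightarrow> k \<le> 4 \<Longrightarrow>
      (\<integral>\<^sup>+x. ennreal (fbar x * \<bar>moment k par x - moment k par' x\<bar>) \<partial>lborel) \<le> ennreal (A * s)"
    using integral_moment_diff_le by blast
  obtain R where R: "0 < R"
    "\<And>q z e. q \<in> borel_measurable borel \<Longrightarrow> poly_on_lines 4 q \<Longrightarrow> norm z \<le> r \<Longrightarrow> 0 \<le> e \<Longrightarrow>
       (\<integral>\<^sup>+x. ennreal (fbar x * \<bar>q x\<bar>) \<partial>lborel) \<le> ennreal e \<Longrightarrow> \<bar>q z\<bar> \<le> R * e"
    using poly_on_lines_le_integral[of fbar r 4] fbar_nonneg fbar_supp fbar_integral fbar_measurable by auto
  have mom: "poly_on_lines 4 (moment k par) \<and> moment k par \<in> borel_measurable borel"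
    if H: "par \<in> box" "1 \<le> k" "k \<le> 4" for par k
  proof -
    obtain p a b where p: "degree p \<le> 4" "\<And>x. moment k par x = poly p (a \<bullet> x + b)"
      using moment_poly[OF H] by blast
    then have eq: "moment k par = (\<lambda>x. poly p (a \<bullet> x + b))" by auto
    have "continuous_on UNIV (\<lambda>x. poly p (a \<bullet> x + b))" by (intro continuous_intros)
    then show ?thesis unfolding eq using poly_on_lines_affine[OF p(1)]
      by (auto intro: borel_measurable_continuous_onI)
  qed
  show thesis
  proof (rule that)
    show "0 < R * A" using R A by simp
    fix par par' and s :: real and k :: nat and x :: "real ^ 'd"
    assume H: "par \<in> box" "par' \<in> box" "0 < s" "hellinger2 par par' \<le> ennreal (s\<^sup>2)" "1 \<le> k" "k \<le> 4" "norm x \<le> r"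
    have "\<bar>moment k par x - moment k par' x\<bar> \<le> R * (A * s)"
      using H A mom[OF H(1,5,6)] mom[OF H(2,5,6)]
      by (intro R(2) poly_on_lines_diff borel_measurable_diff A(2)) auto
    then show "\<bar>moment k par x - moment k par' x\<bar> \<le> R * A * s" by simp
  qed
qed

end

section \<open>Recovering the parameters from the moments\<close>

text \<open>Formally t = (t a)^2 / (t a^2), but a may be small. Instead, multiply the first relation
  by a' and subtract it from the second: t a (a - a') is small. If |a| < |a'| / 2, then |a - a'| is
  comparable to |a'| and t a a' would be small as well, against the signal condition. Hence t a' (a
  - a') is small, which turns t a a' into t a'^2.\<close>

lemma mixing_weight_from_shift:
  fixes t t' a a' e M K :: real
  assumes t: "0 \<le> t" "0 < t'" and M: "1 \<le> M" "\<bar>a'\<bar> \<le> M" and e: "0 < e"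
    and 1: "\<bar>t * a - t' * a'\<bar> \<le> e" and 2: "\<bar>t * a\<^sup>2 - t' * a'\<^sup>2\<bar> \<le> e"
    and signal: "K * e \<le> t' * a'\<^sup>2" and K: "1000 * M \<le> K"
  shows "\<bar>t - t'\<bar> * a'\<^sup>2 \<le> 5 * M * e" "\<bar>t - t'\<bar> \<le> t' / 100" "\<bar>a\<bar> \<le> 4 * \<bar>a'\<bar>"
proof -
  have "0 < K * e" using K M e by simp
  then have a': "a' \<noteq> 0" using signal by auto
  have Me: "e \<le> M * e" using M e by simp
  have "\<bar>(t * a - t' * a') * a'\<bar> \<le> e * M"
    unfolding abs_mult using 1 M e by (intro mult_mono) auto
  then have 3: "\<bar>t * a * a' - t' * a'\<^sup>2\<bar> \<le> M * e" by (simp add: algebra_simps power2_eq_square)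
  have "\<bar>t * a\<^sup>2 - t * a * a'\<bar> \<le> M * e + e" using 2 3 by linarith
  also have "t * a\<^sup>2 - t * a * a' = t * a * (a - a')" by (simp add: algebra_simps power2_eq_square)
  finally have 4: "\<bar>t * a\<bar> * \<bar>a - a'\<bar> \<le> 2 * M * e" using Me by (simp add: abs_mult)
  have half: "\<bar>a'\<bar> \<le> 2 * \<bar>a\<bar>"
  proof (rule ccontr)
    assume n: "\<not> ?thesis"
    then have "\<bar>a'\<bar> \<le> 2 * \<bar>a - a'\<bar>" by (smt (verit))
    then have "\<bar>t * a\<bar> * \<bar>a'\<bar> \<le> \<bar>t * a\<bar> * (2 * \<bar>a - a'\<bar>)" by (intro mult_left_mono) auto
    then have "\<bar>t * a * a'\<bar> \<le> 4 * M * e" using 4 by (simp add: abs_mult)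
    then have "t' * a'\<^sup>2 \<le> 5 * M * e" using 3 by linarith
    moreover have "1000 * M * e \<le> K * e" using K e by (intro mult_right_mono) auto
    moreover have "0 < M * e" using M e by simp
    ultimately show False using signal by linarith
  qed
  have "t * \<bar>a'\<bar> * \<bar>a - a'\<bar> \<le> t * (2 * \<bar>a\<bar>) * \<bar>a - a'\<bar>"
    using half t by (intro mult_right_mono mult_left_mono) auto
  also have "\<dots> \<le> 4 * M * e" using 4 t by (simp add: abs_mult)
  finally have "\<bar>t * a' * (a - a')\<bar> \<le> 4 * M * e" using t by (simp add: abs_mult)
  moreover have "(t - t') * a'\<^sup>2 = (t * a * a' - t' * a'\<^sup>2) - t * a' * (a - a')"
    by (simp add: algebra_simps power2_eq_square)
  ultimately have "\<bar>(t - t') * a'\<^sup>2\<bar> \<le> 5 * M * e" using 3 by linarith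
  then show A: "\<bar>t - t'\<bar> * a'\<^sup>2 \<le> 5 * M * e" by (simp add: abs_mult)
  \<comment> \<open>The error 5 M e is at most 1/200 of the signal t' a'^2, which gives the relative
    error 1/100 of the weight.\<close>
  have Ke: "1000 * (M * e) \<le> K * e" using K e by simp
  have Me0: "0 \<le> M * e" using M e by simp
  have "\<bar>t - t'\<bar> * a'\<^sup>2 \<le> t' / 100 * a'\<^sup>2" using A signal Ke Me0 by (simp add: mult.assoc)
  then show B: "\<bar>t - t'\<bar> \<le> t' / 100" using a' by (simp add: mult_le_cancel_right)
  have "e \<le> t' * \<bar>a'\<bar>"
  proof -
    have "M * e \<le> t' * a'\<^sup>2" using Ke Me0 signal by linarith
    also have "\<dots> = t' * \<bar>a'\<bar> * \<bar>a'\<bar>" by (simp add: power2_eq_square)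
    also have "\<dots> \<le> t' * \<bar>a'\<bar> * M" using M t by (intro mult_left_mono) auto
    finally show ?thesis using M by (simp add: mult.commute)
  qed
  moreover have "t * \<bar>a\<bar> \<le> t' * \<bar>a'\<bar> + e"
  proof -
    have "\<bar>t * a\<bar> \<le> \<bar>t' * a'\<bar> + e" using 1 by linarith
    then show ?thesis using t by (simp add: abs_mult)
  qed
  ultimately have "t * \<bar>a\<bar> \<le> 2 * (t' * \<bar>a'\<bar>)" by linarith
  moreover have "t' / 2 \<le> t" using B t by linarith
  then have "t' / 2 * \<bar>a\<bar> \<le> t * \<bar>a\<bar>" by (rule mult_right_mono) simp
  ultimately have "t' * \<bar>a\<bar> \<le> t' * (4 * \<bar>a'\<bar>)" by simp
  then show "\<bar>a\<bar> \<le> 4 * \<bar>a'\<bar>" using t by simp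
qed

text \<open>With $p = tB$ and $q = t(B^2 + S)$ the third and fourth moments are
  $3pq/t - 2p^3/t^2$ and $3q^2/t - 2p^4/t^3$. Since $p$ and $q$ are known up to $e$, they
  determine $\kappa = t'/t$ near $1$: the two derivatives with respect to $\kappa$ do not vanish
  simultaneously unless $B = S = 0$.\<close>
lemma mixing_weight_from_moments:
  fixes t t' B B' S S' e M :: real
  assumes t: "0 < t'" "\<bar>t - t'\<bar> \<le> t' / 100" and M: "1 \<le> M" and e: "0 \<le> e"
    and bnd: "\<bar>B\<bar> \<le> M" "\<bar>B'\<bar> \<le> M" "\<bar>S\<bar> \<le> M" "\<bar>S'\<bar> \<le> M"
    and 1: "\<bar>t * B - t' * B'\<bar> \<le> e"
    and 2: "\<bar>t * (B\<^sup>2 + S) - t' * (B'\<^sup>2 + S')\<bar> \<le> e"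
    and 3: "\<bar>t * (B ^ 3 + 3 * B * S) - t' * (B' ^ 3 + 3 * B' * S')\<bar> \<le> e"
    and 4: "\<bar>t * (B ^ 4 + 6 * B\<^sup>2 * S + 3 * S\<^sup>2) - t' * (B' ^ 4 + 6 * B'\<^sup>2 * S' + 3 * S'\<^sup>2)\<bar> \<le> e"
  shows "\<bar>t - t'\<bar> * B' ^ 4 \<le> 10000 * M ^ 3 * e" "\<bar>t - t'\<bar> * S'\<^sup>2 \<le> 60000 * M ^ 3 * e"
proof -
  define Q Q' \<kappa> where "Q = B\<^sup>2 + S" and "Q' = B'\<^sup>2 + S'" and "\<kappa> = t' / t"
  have t0: "0 < t" using t by linarith
  have \<kappa>t: "\<kappa> * t = t'" using t0 by (simp add: \<kappa>_def)
  have "t \<le> t' + t' / 100" "t' - t' / 100 \<le> t" using t(2) by linarith+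
  then have \<kappa>: "98 / 100 \<le> \<kappa>" "\<kappa> \<le> 102 / 100" using t t0 by (auto simp: \<kappa>_def field_simps)
  have MM: "M \<le> M\<^sup>2" "M\<^sup>2 \<le> M ^ 3" "1 \<le> M ^ 3"
    using M by (auto intro: self_le_power power_increasing one_le_power)
  have sq: "B\<^sup>2 \<le> M\<^sup>2" "B'\<^sup>2 \<le> M\<^sup>2" using bnd by (auto simp: abs_le_square_iff[symmetric])
  have Qb: "\<bar>Q\<bar> \<le> 2 * M\<^sup>2" "\<bar>Q'\<bar> \<le> 2 * M\<^sup>2"
    using sq MM bnd zero_le_power2[of B] zero_le_power2[of B'] unfolding Q_def Q'_def by linarith+
  define \<epsilon>1 \<epsilon>2 where "\<epsilon>1 = t * B - t' * B'" and "\<epsilon>2 = t * Q - t' * Q'"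
  have \<epsilon>: "\<bar>\<epsilon>1\<bar> \<le> e" "\<bar>\<epsilon>2\<bar> \<le> e" using 1 2 by (auto simp: \<epsilon>1_def \<epsilon>2_def Q_def Q'_def)
  \<comment> \<open>The estimates \<open>a1\<close> to \<open>a4\<close> replace p = t B and q = t Q
    by p' = t' B' and q' = t' Q' in pq/t, p^3/t^2, q^2/t and p^4/t^3 while t is kept. Since t' =
    \<kappa> t, each replaced monomial is a power of \<kappa> times the corresponding true
    one.\<close>
  have "\<bar>\<epsilon>1 * Q + \<kappa> * B' * \<epsilon>2\<bar> \<le> e * (2 * M\<^sup>2) + (2 * M\<^sup>2) * e"
  proof -
    have "\<bar>\<kappa> * B'\<bar> \<le> 2 * M" unfolding abs_mult using \<kappa> bnd by (intro mult_mono) auto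
    then have "\<bar>\<kappa> * B'\<bar> \<le> 2 * M\<^sup>2" using MM by linarith
    then have "\<bar>\<epsilon>1 * Q\<bar> \<le> e * (2 * M\<^sup>2)" "\<bar>\<kappa> * B' * \<epsilon>2\<bar> \<le> 2 * M\<^sup>2 * e"
      using \<epsilon> Qb e unfolding abs_mult[of \<epsilon>1] abs_mult[of "\<kappa> * B'"] by (auto intro!: mult_mono)
    then show ?thesis by linarith
  qed
  moreover have "\<epsilon>1 * Q + \<kappa> * B' * \<epsilon>2 = t * B * Q - \<kappa> * t' * B' * Q'"
    unfolding \<epsilon>1_def \<epsilon>2_def \<kappa>t[symmetric] by (simp add: algebra_simps)
  ultimately have a1: "\<bar>t * B * Q - \<kappa> * t' * B' * Q'\<bar> \<le> 4 * (M\<^sup>2 * e)" by (simp add: mult.commute)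
  have prods: "\<bar>B\<^sup>2\<bar> \<le> M\<^sup>2" "\<bar>\<kappa> * (B * B')\<bar> \<le> 2 * (M * M)" "\<bar>\<kappa>\<^sup>2 * B'\<^sup>2\<bar> \<le> 2\<^sup>2 * M\<^sup>2"
    "\<bar>B ^ 3\<bar> \<le> M ^ 3" "\<bar>\<kappa> * (B\<^sup>2 * B')\<bar> \<le> 2 * (M\<^sup>2 * M)" "\<bar>\<kappa>\<^sup>2 * (B * B'\<^sup>2)\<bar> \<le> 2\<^sup>2 * (M * M\<^sup>2)"
    "\<bar>\<kappa> ^ 3 * B' ^ 3\<bar> \<le> 2 ^ 3 * M ^ 3"
    unfolding abs_mult power_abs using bnd \<kappa> M
    by (intro mult_mono power_mono mult_nonneg_nonneg abs_ge_zero zero_le_power; simp)+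
  have mm: "M * M = M\<^sup>2" "M\<^sup>2 * M = M ^ 3" "M * M\<^sup>2 = M ^ 3"
    by (simp_all add: power2_eq_square power3_eq_cube)
  note prods = prods[unfolded mm]
  have sums: "\<bar>B\<^sup>2 + \<kappa> * (B * B') + \<kappa>\<^sup>2 * B'\<^sup>2\<bar> \<le> 7 * M\<^sup>2"
    "\<bar>B ^ 3 + \<kappa> * (B\<^sup>2 * B') + \<kappa>\<^sup>2 * (B * B'\<^sup>2) + \<kappa> ^ 3 * B' ^ 3\<bar> \<le> 15 * M ^ 3"
    using prods zero_le_power2[of B] zero_le_power2[of M] unfolding abs_le_iff by (simp, linarith, simp)
  have "\<bar>\<epsilon>1 * (B\<^sup>2 + \<kappa> * (B * B') + \<kappa>\<^sup>2 * B'\<^sup>2)\<bar> \<le> e * (7 * M\<^sup>2)"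
    unfolding abs_mult[of \<epsilon>1] using \<epsilon> sums e by (intro mult_mono) auto
  moreover have "\<epsilon>1 * (B\<^sup>2 + \<kappa> * (B * B') + \<kappa>\<^sup>2 * B'\<^sup>2) = t * B ^ 3 - \<kappa>\<^sup>2 * t' * B' ^ 3"
    unfolding \<epsilon>1_def \<kappa>t[symmetric] by (simp add: algebra_simps power2_eq_square power3_eq_cube)
  ultimately have a2: "\<bar>t * B ^ 3 - \<kappa>\<^sup>2 * t' * B' ^ 3\<bar> \<le> 7 * (M\<^sup>2 * e)" by (simp add: mult.commute)
  have "\<bar>\<epsilon>2 * (Q + \<kappa> * Q')\<bar> \<le> e * (6 * M\<^sup>2)"
  proof -
    have "\<bar>\<kappa> * Q'\<bar> \<le> 2 * (2 * M\<^sup>2)" unfolding abs_mult using \<kappa> Qb by (intro mult_mono) auto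
    then show ?thesis unfolding abs_mult[of \<epsilon>2] using \<epsilon> Qb e by (intro mult_mono) (auto simp: abs_le_iff)
  qed
  moreover have "\<epsilon>2 * (Q + \<kappa> * Q') = t * Q\<^sup>2 - \<kappa> * t' * Q'\<^sup>2"
    unfolding \<epsilon>2_def \<kappa>t[symmetric] by (simp add: algebra_simps power2_eq_square)
  ultimately have a3: "\<bar>t * Q\<^sup>2 - \<kappa> * t' * Q'\<^sup>2\<bar> \<le> 6 * (M\<^sup>2 * e)" by (simp add: mult.commute)
  have "\<bar>\<epsilon>1 * (B ^ 3 + \<kappa> * (B\<^sup>2 * B') + \<kappa>\<^sup>2 * (B * B'\<^sup>2) + \<kappa> ^ 3 * B' ^ 3)\<bar> \<le> e * (15 * M ^ 3)"
    unfolding abs_mult[of \<epsilon>1] using \<epsilon> sums e by (intro mult_mono) auto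
  moreover have "\<epsilon>1 * (B ^ 3 + \<kappa> * (B\<^sup>2 * B') + \<kappa>\<^sup>2 * (B * B'\<^sup>2) + \<kappa> ^ 3 * B' ^ 3) = t * B ^ 4 - \<kappa> ^ 3 * t' * B' ^ 4"
    unfolding \<epsilon>1_def \<kappa>t[symmetric] by (simp add: algebra_simps eval_nat_numeral)
  ultimately have a4: "\<bar>t * B ^ 4 - \<kappa> ^ 3 * t' * B' ^ 4\<bar> \<le> 15 * (M ^ 3 * e)" by (simp add: mult.commute)
  define x D where "x = B'\<^sup>2" and "D = t' * \<bar>\<kappa> - 1\<bar>"
  have x: "0 \<le> x" "x\<^sup>2 = B' ^ 4" by (simp_all add: x_def power_mult[symmetric])
  have D: "0 \<le> D" using t by (simp add: D_def)
  have Me: "e \<le> M ^ 3 * e" "M\<^sup>2 * e \<le> M ^ 3 * e" using mult_right_mono[OF MM(3) e] mult_right_mono[OF MM(2) e] by auto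
  have M3e: "0 \<le> M ^ 3 * e" using Me e by linarith
  \<comment> \<open>After the replacement the remaining discrepancy vanishes at \<kappa> = 1, so
    \<kappa> - 1 factors out. The constant is 3 * 4 + 2 * 7 + 1, from \<open>a1\<close>,
    \<open>a2\<close> and hypothesis \<open>3\<close>; likewise 49 = 3 * 6 + 2 * 15 + 1 in
    \<open>b2\<close>.\<close>
  have "D * \<bar>B'\<bar> * \<bar>3 * Q' - 2 * (\<kappa> + 1) * x\<bar> \<le> 27 * (M\<^sup>2 * e)"
  proof -
    have "t * (B ^ 3 + 3 * B * S) = 3 * (t * B * Q) - 2 * (t * B ^ 3)"
      "t' * (B' ^ 3 + 3 * B' * S') = 3 * (t' * B' * Q') - 2 * (t' * B' ^ 3)"
      by (simp_all add: Q_def Q'_def algebra_simps power2_eq_square power3_eq_cube)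
    moreover have "t' * (\<kappa> - 1) * B' * (3 * Q' - 2 * (\<kappa> + 1) * x) =
        3 * (\<kappa> * t' * B' * Q') - 2 * (\<kappa>\<^sup>2 * t' * B' ^ 3) - (3 * (t' * B' * Q') - 2 * (t' * B' ^ 3))"
      by (simp add: x_def algebra_simps power2_eq_square power3_eq_cube)
    moreover have "e \<le> M\<^sup>2 * e" using mult_right_mono[of 1 "M\<^sup>2" e] MM M e by simp
    ultimately have "\<bar>t' * (\<kappa> - 1) * B' * (3 * Q' - 2 * (\<kappa> + 1) * x)\<bar> \<le> 27 * (M\<^sup>2 * e)"
      using 3 a1 a2 by linarith
    then show ?thesis using t by (simp add: D_def abs_mult)
  qed
  \<comment> \<open>One more factor |B'| puts the cubic bound on the same scale as the quartic one:
    both become quadratic in (x, Q') with x = B'^2.\<close>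
  then have "D * \<bar>B'\<bar> * \<bar>3 * Q' - 2 * (\<kappa> + 1) * x\<bar> * \<bar>B'\<bar> \<le> 27 * (M\<^sup>2 * e) * M"
    by (rule mult_mono) (use bnd e in auto)
  then have b1: "D * x * \<bar>3 * Q' - 2 * (\<kappa> + 1) * x\<bar> \<le> 27 * (M ^ 3 * e)"
  proof -
    have eqs: "D * \<bar>B'\<bar> * Z * \<bar>B'\<bar> = D * x * Z" "27 * (M\<^sup>2 * e) * M = 27 * (M ^ 3 * e)" for Z
      by (simp_all add: x_def power2_eq_square power3_eq_cube mult_ac)
    show ?thesis
      using \<open>D * \<bar>B'\<bar> * \<bar>3 * Q' - 2 * (\<kappa> + 1) * x\<bar> * \<bar>B'\<bar> \<le> 27 * (M\<^sup>2 * e) * M\<close>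
      unfolding eqs .
  qed
  have b2: "D * \<bar>3 * Q'\<^sup>2 - 2 * (\<kappa>\<^sup>2 + \<kappa> + 1) * x\<^sup>2\<bar> \<le> 49 * (M ^ 3 * e)"
  proof -
    have "t * (B ^ 4 + 6 * B\<^sup>2 * S + 3 * S\<^sup>2) = 3 * (t * Q\<^sup>2) - 2 * (t * B ^ 4)"
      "t' * (B' ^ 4 + 6 * B'\<^sup>2 * S' + 3 * S'\<^sup>2) = 3 * (t' * Q'\<^sup>2) - 2 * (t' * B' ^ 4)"
      by (simp_all add: Q_def Q'_def algebra_simps eval_nat_numeral)
    moreover have "t' * (\<kappa> - 1) * (3 * Q'\<^sup>2 - 2 * (\<kappa>\<^sup>2 + \<kappa> + 1) * x\<^sup>2) =
        3 * (\<kappa> * t' * Q'\<^sup>2) - 2 * (\<kappa> ^ 3 * t' * B' ^ 4) - (3 * (t' * Q'\<^sup>2) - 2 * (t' * B' ^ 4))"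
      unfolding x(2) by (simp add: algebra_simps eval_nat_numeral)
    ultimately have "\<bar>t' * (\<kappa> - 1) * (3 * Q'\<^sup>2 - 2 * (\<kappa>\<^sup>2 + \<kappa> + 1) * x\<^sup>2)\<bar> \<le> 49 * (M ^ 3 * e)"
      using 4 a3 a4 Me by linarith
    then show ?thesis using t by (simp add: D_def abs_mult)
  qed
  have \<kappa>2: "\<kappa>\<^sup>2 \<le> 102 / 100 * (102 / 100)" "98 / 100 * (98 / 100) \<le> \<kappa>\<^sup>2"
    unfolding power2_eq_square using \<kappa> mult_mono[OF \<kappa>(2) \<kappa>(2)] mult_mono[OF \<kappa>(1) \<kappa>(1)] by simp_all
  have "D * x\<^sup>2 \<le> 2700 * (M ^ 3 * e) \<and> D * Q'\<^sup>2 \<le> 7300 * (M ^ 3 * e)"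
  \<comment> \<open>At \<kappa> = 1 the cubic factor vanishes for Q' = 4x/3, where 3 Q'^2 = 16/3 x^2
    stays away from the 6 x^2 of the quartic factor. For \<kappa> within 2 percent of 1 the gap
    persists as 5.5 x^2 against 5.8 x^2. So either the cubic factor is at least x / 100, or the
    quartic one is at least 3/10 x^2.\<close>
  proof (cases "x / 100 \<le> \<bar>3 * Q' - 2 * (\<kappa> + 1) * x\<bar>")
    case True
    then have "D * x * (x / 100) \<le> D * x * \<bar>3 * Q' - 2 * (\<kappa> + 1) * x\<bar>"
      using D x by (intro mult_left_mono) auto
    then have c1: "D * x\<^sup>2 \<le> 2700 * (M ^ 3 * e)" using b1 by (simp add: power2_eq_square)
    have "2 * (\<kappa>\<^sup>2 + \<kappa> + 1) * x\<^sup>2 \<le> 8 * x\<^sup>2" using \<kappa> \<kappa>2 by (intro mult_right_mono) auto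
    then have "3 * Q'\<^sup>2 \<le> \<bar>3 * Q'\<^sup>2 - 2 * (\<kappa>\<^sup>2 + \<kappa> + 1) * x\<^sup>2\<bar> + 8 * x\<^sup>2" by linarith
    then have "D * (3 * Q'\<^sup>2) \<le> D * (\<bar>3 * Q'\<^sup>2 - 2 * (\<kappa>\<^sup>2 + \<kappa> + 1) * x\<^sup>2\<bar> + 8 * x\<^sup>2)"
      using D by (rule mult_left_mono)
    then have "3 * (D * Q'\<^sup>2) \<le> D * \<bar>3 * Q'\<^sup>2 - 2 * (\<kappa>\<^sup>2 + \<kappa> + 1) * x\<^sup>2\<bar> + 8 * (D * x\<^sup>2)"
      by (simp add: distrib_left mult.left_commute)
    then show ?thesis using b2 c1 M3e by linarith
  next
    case False
    have "2 * (\<kappa> + 1) * x \<le> 404 / 100 * x" "396 / 100 * x \<le> 2 * (\<kappa> + 1) * x"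
      using \<kappa> x by (intro mult_right_mono; simp)+
    then have "\<bar>3 * Q'\<bar> \<le> 405 / 100 * x" using False x by linarith
    then have "\<bar>3 * Q'\<bar>\<^sup>2 \<le> (405 / 100 * x)\<^sup>2" by (intro power_mono) auto
    then have "9 * Q'\<^sup>2 \<le> 164025 / 10000 * x\<^sup>2"
      unfolding power2_abs power_mult_distrib by (simp add: power2_eq_square)
    then have Qx: "3 * Q'\<^sup>2 \<le> 55 / 10 * x\<^sup>2"
      using zero_le_power2[of x] by linarith
    have "58 / 10 * x\<^sup>2 \<le> 2 * (\<kappa>\<^sup>2 + \<kappa> + 1) * x\<^sup>2" using \<kappa> \<kappa>2 by (intro mult_right_mono) auto
    then have "3 / 10 * x\<^sup>2 \<le> \<bar>3 * Q'\<^sup>2 - 2 * (\<kappa>\<^sup>2 + \<kappa> + 1) * x\<^sup>2\<bar>" using Qx by linarith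
    then have "D * (3 / 10 * x\<^sup>2) \<le> D * \<bar>3 * Q'\<^sup>2 - 2 * (\<kappa>\<^sup>2 + \<kappa> + 1) * x\<^sup>2\<bar>"
      using D by (rule mult_left_mono)
    then have c1: "3 / 10 * (D * x\<^sup>2) \<le> 49 * (M ^ 3 * e)" using b2 by (simp add: mult.left_commute)
    have "D * (3 * Q'\<^sup>2) \<le> D * (55 / 10 * x\<^sup>2)" using Qx D by (rule mult_left_mono)
    then have "3 * (D * Q'\<^sup>2) \<le> 55 / 10 * (D * x\<^sup>2)" by (simp add: mult.left_commute)
    then show ?thesis using c1 M3e by linarith
  qed
  moreover have "\<bar>t - t'\<bar> \<le> 2 * D"
  proof -
    have "\<bar>t - t'\<bar> = t * \<bar>\<kappa> - 1\<bar>"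
      unfolding \<kappa>t[symmetric] using t0 abs_mult[of t "\<kappa> - 1"] by (simp add: algebra_simps abs_minus_commute)
    also have "t \<le> 2 * t'" using t by linarith
    then have "t * \<bar>\<kappa> - 1\<bar> \<le> 2 * t' * \<bar>\<kappa> - 1\<bar>" by (rule mult_right_mono) simp
    finally show ?thesis by (simp add: D_def)
  qed
  moreover have "0 \<le> x\<^sup>2" "0 \<le> Q'\<^sup>2" by simp_all
  ultimately have f: "\<bar>t - t'\<bar> * x\<^sup>2 \<le> 5400 * (M ^ 3 * e)" "\<bar>t - t'\<bar> * Q'\<^sup>2 \<le> 14600 * (M ^ 3 * e)"
    using mult_right_mono[of "\<bar>t - t'\<bar>" "2 * D" "x\<^sup>2"] mult_right_mono[of "\<bar>t - t'\<bar>" "2 * D" "Q'\<^sup>2"] by linarith+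
  then show "\<bar>t - t'\<bar> * B' ^ 4 \<le> 10000 * M ^ 3 * e" using x M3e by simp
  have "S'\<^sup>2 \<le> 2 * Q'\<^sup>2 + 2 * x\<^sup>2"
  proof -
    have "0 \<le> (Q' + x)\<^sup>2" by simp
    moreover have "S' = Q' - x" by (simp add: Q'_def x_def)
    then have "S'\<^sup>2 = (Q' - x)\<^sup>2" by simp
    ultimately show ?thesis by (simp add: power2_eq_square algebra_simps)
  qed
  then have "\<bar>t - t'\<bar> * S'\<^sup>2 \<le> \<bar>t - t'\<bar> * (2 * Q'\<^sup>2 + 2 * x\<^sup>2)" by (intro mult_left_mono) auto
  then show "\<bar>t - t'\<bar> * S'\<^sup>2 \<le> 60000 * M ^ 3 * e" using f M3e by (simp add: distrib_left)
qed

text \<open>Once $|t - t'|\,X^2 = O(e)$ with $X = \|A'\| + B'^2 + |S'|$ is known, every other loss term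
  follows from $t'(v - v') = (t' - t)v + (tv - t'v')$.\<close>
lemma parameter_deviation_le:
  fixes A A' :: "real ^ 'd" and t t' B B' S S' e M K :: real
  assumes t: "0 \<le> t" "0 < t'" and M: "1 \<le> M" and e: "0 < e"
    and bnd: "norm A' \<le> M" "\<bar>B\<bar> \<le> M" "\<bar>B'\<bar> \<le> M" "\<bar>S\<bar> \<le> M" "\<bar>S'\<bar> \<le> M"
    and A1: "\<And>i. \<bar>t * A $ i - t' * A' $ i\<bar> \<le> e"
    and A2: "\<And>i. \<bar>t * (A $ i)\<^sup>2 - t' * (A' $ i)\<^sup>2\<bar> \<le> e"
    and B1: "\<bar>t * B - t' * B'\<bar> \<le> e"
    and B2: "\<bar>t * (B\<^sup>2 + S) - t' * (B'\<^sup>2 + S')\<bar> \<le> e"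
    and B3: "\<bar>t * (B ^ 3 + 3 * B * S) - t' * (B' ^ 3 + 3 * B' * S')\<bar> \<le> e"
    and B4: "\<bar>t * (B ^ 4 + 6 * B\<^sup>2 * S + 3 * S\<^sup>2) - t' * (B' ^ 4 + 6 * B'\<^sup>2 * S' + 3 * S'\<^sup>2)\<bar> \<le> e"
    and sA: "\<And>i. 1000 * M ^ 3 * e \<le> t' * (A' $ i)\<^sup>2" and sB: "1000 * M ^ 3 * e \<le> t' * B' ^ 4"
  defines "X \<equiv> norm A' + B'\<^sup>2 + \<bar>S'\<bar>"
  defines "C \<equiv> 3 * (5 * M * CARD('d) + 70000 * M ^ 3)"
  shows "\<bar>t - t'\<bar> * X\<^sup>2 \<le> C * e"
    and "t' * X * (norm (A - A') + \<bar>B - B'\<bar>\<^sup>2 + \<bar>S - S'\<bar>) \<le> (32 * C + (CARD('d) + 10 * M\<^sup>2) * (3 * M\<^sup>2)) * e"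
proof -
  have MM: "M \<le> M\<^sup>2" "M\<^sup>2 \<le> M ^ 3" "M \<le> M ^ 3" "1 \<le> M ^ 3" "1 \<le> M\<^sup>2"
    using M by (auto intro: self_le_power power_increasing one_le_power)
  have coord: "\<bar>t - t'\<bar> * (A' $ i)\<^sup>2 \<le> 5 * M * e" "\<bar>t - t'\<bar> \<le> t' / 100" "\<bar>A $ i\<bar> \<le> 4 * \<bar>A' $ i\<bar>" for i
  proof -
    have 1: "\<bar>A' $ i\<bar> \<le> M" using component_le_norm_cart[of A' i] bnd by linarith
    have 2: "1000 * M \<le> 1000 * M ^ 3" using MM by simp
    note * = mixing_weight_from_shift[OF t M 1 e A1[of i] A2[of i] sA[of i] 2]
    show "\<bar>t - t'\<bar> * (A' $ i)\<^sup>2 \<le> 5 * M * e" "\<bar>t - t'\<bar> \<le> t' / 100" "\<bar>A $ i\<bar> \<le> 4 * \<bar>A' $ i\<bar>"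
      by (rule *)+
  qed
  have t2: "\<bar>t - t'\<bar> \<le> t' / 100" by (rule coord)
  have half: "t' / 2 \<le> t" using t2 t by linarith
  have "(norm A')\<^sup>2 = (\<Sum>i\<in>UNIV. (A' $ i)\<^sup>2)"
    unfolding power2_norm_eq_inner inner_vec_def by (simp add: power2_eq_square)
  then have "\<bar>t - t'\<bar> * (norm A')\<^sup>2 = (\<Sum>i\<in>UNIV. \<bar>t - t'\<bar> * (A' $ i)\<^sup>2)" by (simp add: sum_distrib_left)
  also have "\<dots> \<le> (\<Sum>i\<in>(UNIV :: 'd set). 5 * M * e)" by (intro sum_mono coord)
  finally have cA: "\<bar>t - t'\<bar> * (norm A')\<^sup>2 \<le> 5 * M * CARD('d) * e" by (simp add: mult_ac)
  note cB = mixing_weight_from_moments[OF t(2) t2 M less_imp_le[OF e] bnd(2-5) B1 B2 B3 B4]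
  have "X\<^sup>2 \<le> 3 * ((norm A')\<^sup>2 + B' ^ 4 + S'\<^sup>2)"
  proof -
    have "(u + v + w)\<^sup>2 \<le> 3 * (u\<^sup>2 + v\<^sup>2 + w\<^sup>2)" for u v w :: real
    proof -
      have "0 \<le> (u - v)\<^sup>2 + (u - w)\<^sup>2 + (v - w)\<^sup>2" by simp
      then show ?thesis by (simp add: power2_eq_square algebra_simps)
    qed
    from this[of "norm A'" "B'\<^sup>2" "\<bar>S'\<bar>"] show ?thesis
      by (simp add: X_def power_mult[symmetric])
  qed
  then have "\<bar>t - t'\<bar> * X\<^sup>2 \<le> \<bar>t - t'\<bar> * (3 * ((norm A')\<^sup>2 + B' ^ 4 + S'\<^sup>2))"
    by (intro mult_left_mono) auto
  also have "\<dots> = 3 * (\<bar>t - t'\<bar> * (norm A')\<^sup>2 + \<bar>t - t'\<bar> * B' ^ 4 + \<bar>t - t'\<bar> * S'\<^sup>2)"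
    by (simp add: algebra_simps)
  also have "\<dots> \<le> 3 * (5 * M * CARD('d) * e + 10000 * M ^ 3 * e + 60000 * M ^ 3 * e)"
    by (intro mult_left_mono add_mono cA cB) auto
  also have "\<dots> = C * e" by (simp add: C_def algebra_simps)
  finally show X2: "\<bar>t - t'\<bar> * X\<^sup>2 \<le> C * e" .
  have X: "0 \<le> X" "norm A' \<le> X" "B'\<^sup>2 \<le> X" "\<bar>S'\<bar> \<le> X" by (auto simp: X_def)
  have B'2: "B'\<^sup>2 \<le> M\<^sup>2" using bnd M by (simp add: abs_le_square_iff[symmetric])
  have XM: "X \<le> 3 * M\<^sup>2" using bnd B'2 MM unfolding X_def by linarith
  have M3e: "M ^ 3 * e \<le> t' * B' ^ 4 / 1000" "M * e \<le> M ^ 3 * e" "e \<le> M ^ 3 * e" "0 \<le> M ^ 3 * e"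
    using sB mult_right_mono[OF MM(3) less_imp_le[OF e]] mult_right_mono[OF MM(4) less_imp_le[OF e]] e M by auto
  \<comment> \<open>The fitted deviations are at most 4 times the true scale: \<open>normA\<close>,
    \<open>absB\<close> and \<open>absS\<close>. The crude bound M on them would lose a factor X in
    (t' - t) v, and |t - t'| X^2 is the quantity under control.\<close>
  have normA: "norm A \<le> 4 * norm A'"
  proof -
    have "norm A \<le> norm (4 *\<^sub>R A')" by (rule norm_le_componentwise_cart) (use coord(3) in \<open>simp add: abs_mult\<close>)
    then show ?thesis by simp
  qed
  have absB: "\<bar>B\<bar> \<le> 4 * \<bar>B'\<bar>"
  proof -
    have "M ^ 3 * e \<le> M ^ 3 * (t' * \<bar>B'\<bar>)"
    proof -
      have "t' * B' ^ 4 = t' * \<bar>B'\<bar> * \<bar>B'\<bar> ^ 3"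
        by (simp add: eval_nat_numeral mult_ac)
      also have "\<dots> \<le> t' * \<bar>B'\<bar> * M ^ 3" using bnd t by (intro mult_left_mono power_mono) auto
      finally have "t' * B' ^ 4 \<le> M ^ 3 * (t' * \<bar>B'\<bar>)" by (simp add: mult_ac)
      moreover have "0 \<le> t' * B' ^ 4" using t by simp
      ultimately show ?thesis using M3e by linarith
    qed
    then have "e \<le> t' * \<bar>B'\<bar>" using M by simp
    moreover have "t * \<bar>B\<bar> \<le> t' * \<bar>B'\<bar> + e"
    proof -
      have "\<bar>t * B\<bar> \<le> \<bar>t' * B'\<bar> + e" using B1 by linarith
      then show ?thesis using t by (simp add: abs_mult)
    qed
    moreover have "t' / 2 * \<bar>B\<bar> \<le> t * \<bar>B\<bar>" using half by (rule mult_right_mono) simp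
    ultimately have "t' * \<bar>B\<bar> \<le> t' * (4 * \<bar>B'\<bar>)" by simp
    then show ?thesis using t by simp
  qed
  have dB: "t' * \<bar>B - B'\<bar> \<le> 4 * \<bar>t - t'\<bar> * \<bar>B'\<bar> + e"
  proof -
    have "t' * (B - B') = (t' - t) * B + (t * B - t' * B')" by (simp add: algebra_simps)
    then have "\<bar>t' * (B - B')\<bar> \<le> \<bar>(t' - t) * B\<bar> + e" using B1 by linarith
    also have "\<bar>(t' - t) * B\<bar> \<le> \<bar>t - t'\<bar> * (4 * \<bar>B'\<bar>)"
      unfolding abs_mult using absB by (intro mult_mono) auto
    finally show ?thesis using t by (simp add: abs_mult)
  qed
  \<comment> \<open>S is not itself observed. It is B^2 + S minus B^2, with t B^2 - t' B'^2 = (B +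
    B') (t B - t' B') + (t' - t) B B'.\<close>
  have dS0: "\<bar>t * S - t' * S'\<bar> \<le> 4 * \<bar>t - t'\<bar> * B'\<^sup>2 + 3 * (M * e)"
  proof -
    have "t * S - t' * S' = (t * (B\<^sup>2 + S) - t' * (B'\<^sup>2 + S')) - B * (t * B - t' * B') - B' * (t * B - t' * B') - (t' - t) * B * B'"
      by (simp add: algebra_simps power2_eq_square)
    moreover have "\<bar>B * (t * B - t' * B')\<bar> \<le> M * e" "\<bar>B' * (t * B - t' * B')\<bar> \<le> M * e"
      unfolding abs_mult using bnd B1 M by (auto intro!: mult_mono)
    moreover have "\<bar>(t' - t) * B * B'\<bar> \<le> 4 * \<bar>t - t'\<bar> * B'\<^sup>2"
    proof -
      have "\<bar>(t' - t) * B * B'\<bar> = \<bar>t - t'\<bar> * \<bar>B\<bar> * \<bar>B'\<bar>" by (simp add: abs_mult abs_minus_commute)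
      also have "\<dots> \<le> \<bar>t - t'\<bar> * (4 * \<bar>B'\<bar>) * \<bar>B'\<bar>" using absB by (intro mult_right_mono mult_left_mono) auto
      also have "\<dots> = 4 * \<bar>t - t'\<bar> * B'\<^sup>2" by (simp add: power2_eq_square)
      finally show ?thesis .
    qed
    moreover have "e \<le> M * e" using M e by simp
    ultimately show ?thesis using B2 by linarith
  qed
  have absS: "\<bar>S\<bar> \<le> 4 * X"
  proof -
    have "4 * \<bar>t - t'\<bar> * B'\<^sup>2 \<le> t' / 25 * B'\<^sup>2" using t2 by (intro mult_right_mono) auto
    moreover have "3 * (M * e) \<le> t' / 2 * B'\<^sup>2"
    proof -
      have "t' * B' ^ 4 = t' * B'\<^sup>2 * B'\<^sup>2" by (simp add: eval_nat_numeral mult_ac)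
      also have "\<dots> \<le> t' * B'\<^sup>2 * M\<^sup>2" using B'2 t by (intro mult_left_mono) auto
      finally have "1000 * (M ^ 3 * e) \<le> M\<^sup>2 * (t' * B'\<^sup>2)" using M3e by (simp add: mult_ac)
      then have "M\<^sup>2 * (1000 * (M * e)) \<le> M\<^sup>2 * (t' * B'\<^sup>2)" by (simp add: power2_eq_square power3_eq_cube mult_ac)
      then have "1000 * (M * e) \<le> t' * B'\<^sup>2" using M by (simp add: mult_le_cancel_left)
      moreover have "0 \<le> M * e" using M e by simp
      ultimately show ?thesis by simp
    qed
    moreover have "t * \<bar>S\<bar> \<le> t' * \<bar>S'\<bar> + \<bar>t * S - t' * S'\<bar>"
      using abs_triangle_ineq2[of "t * S" "t' * S'"] t by (simp add: abs_mult)
    moreover have "0 \<le> t' * B'\<^sup>2" "0 \<le> t' * \<bar>S'\<bar>" "0 \<le> t' * norm A'" using t by auto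
    moreover have "t' / 2 * \<bar>S\<bar> \<le> t * \<bar>S\<bar>" using half by (rule mult_right_mono) simp
    ultimately have "t' * \<bar>S\<bar> \<le> 4 * (t' * norm A') + 4 * (t' * B'\<^sup>2) + 4 * (t' * \<bar>S'\<bar>)"
      using dS0 by simp
    also have "\<dots> = t' * (4 * X)" by (simp add: X_def algebra_simps)
    finally show ?thesis using t by simp
  qed
  have dS: "t' * \<bar>S - S'\<bar> \<le> 8 * \<bar>t - t'\<bar> * X + 3 * (M * e)"
  proof -
    have "t' * (S - S') = (t' - t) * S + (t * S - t' * S')" by (simp add: algebra_simps)
    then have "\<bar>t' * (S - S')\<bar> \<le> \<bar>(t' - t) * S\<bar> + \<bar>t * S - t' * S'\<bar>" by linarith
    moreover have "\<bar>(t' - t) * S\<bar> \<le> \<bar>t - t'\<bar> * (4 * X)"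
      unfolding abs_mult using absS by (intro mult_mono) auto
    moreover have "4 * \<bar>t - t'\<bar> * B'\<^sup>2 \<le> 4 * \<bar>t - t'\<bar> * X" using X by (intro mult_left_mono) auto
    ultimately show ?thesis using t dS0 by (simp add: abs_mult)
  qed
  have dA: "t' * norm (A - A') \<le> 4 * \<bar>t - t'\<bar> * X + CARD('d) * e"
  proof -
    have "t' *\<^sub>R (A - A') = (t' - t) *\<^sub>R A + (t *\<^sub>R A - t' *\<^sub>R A')" by (simp add: algebra_simps)
    then have "norm (t' *\<^sub>R (A - A')) \<le> norm ((t' - t) *\<^sub>R A) + norm (t *\<^sub>R A - t' *\<^sub>R A')"
      by (metis norm_triangle_ineq)
    moreover have "norm ((t' - t) *\<^sub>R A) \<le> \<bar>t - t'\<bar> * (4 * X)"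
      using normA X by (simp add: abs_minus_commute mult_left_mono)
    moreover have "norm (t *\<^sub>R A - t' *\<^sub>R A') \<le> CARD('d) * e"
    proof -
      have "norm (t *\<^sub>R A - t' *\<^sub>R A') \<le> (\<Sum>i\<in>UNIV. \<bar>(t *\<^sub>R A - t' *\<^sub>R A') $ i\<bar>)" by (rule norm_le_l1_cart)
      also have "\<dots> \<le> (\<Sum>i\<in>(UNIV :: 'd set). e)" by (intro sum_mono) (use A1 in simp)
      finally show ?thesis by simp
    qed
    ultimately show ?thesis using t by simp
  qed
  \<comment> \<open>X contains B'^2 and not |B'|, so the bound \<open>dB\<close> must be multiplied
    by |B - B'| \<le> 5 |B'| before it can be compared with |t - t'| X. This is where the loss gets
    its fourth power of the intercept error.\<close>
  have dB2: "t' * \<bar>B - B'\<bar>\<^sup>2 \<le> 20 * \<bar>t - t'\<bar> * X + 2 * (M * e)"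
  proof -
    have 5: "\<bar>B - B'\<bar> \<le> 5 * \<bar>B'\<bar>" using absB by linarith
    have 2: "\<bar>B - B'\<bar> \<le> 2 * M" using bnd by linarith
    have "t' * \<bar>B - B'\<bar> * \<bar>B - B'\<bar> \<le> (4 * \<bar>t - t'\<bar> * \<bar>B'\<bar> + e) * \<bar>B - B'\<bar>"
      using dB by (rule mult_right_mono) simp
    also have "\<dots> = 4 * \<bar>t - t'\<bar> * \<bar>B'\<bar> * \<bar>B - B'\<bar> + e * \<bar>B - B'\<bar>" by (simp add: algebra_simps)
    also have "\<dots> \<le> 4 * \<bar>t - t'\<bar> * \<bar>B'\<bar> * (5 * \<bar>B'\<bar>) + e * (2 * M)"
      using 5 2 e by (intro add_mono mult_left_mono) auto
    also have "\<dots> = 20 * \<bar>t - t'\<bar> * B'\<^sup>2 + 2 * (M * e)" by (simp add: power2_eq_square)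
    also have "\<dots> \<le> 20 * \<bar>t - t'\<bar> * X + 2 * (M * e)" using X by (intro add_right_mono mult_left_mono) auto
    finally show ?thesis by (simp add: power2_eq_square)
  qed
  have "t' * X * (norm (A - A') + \<bar>B - B'\<bar>\<^sup>2 + \<bar>S - S'\<bar>) =
      X * (t' * norm (A - A') + t' * \<bar>B - B'\<bar>\<^sup>2 + t' * \<bar>S - S'\<bar>)" by (simp add: algebra_simps)
  also have "\<dots> \<le> X * (32 * (\<bar>t - t'\<bar> * X) + (CARD('d) + 10 * M\<^sup>2) * e)"
  proof (intro mult_left_mono)
    have "M * e \<le> M\<^sup>2 * e" using MM e by (intro mult_right_mono) auto
    moreover have "0 \<le> M\<^sup>2 * e" using e by simp
    moreover have "(CARD('d) + 10 * M\<^sup>2) * e = CARD('d) * e + 10 * (M\<^sup>2 * e)" by (simp add: algebra_simps)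
    ultimately show "t' * norm (A - A') + t' * \<bar>B - B'\<bar>\<^sup>2 + t' * \<bar>S - S'\<bar> \<le> 32 * (\<bar>t - t'\<bar> * X) + (CARD('d) + 10 * M\<^sup>2) * e"
      using dA dB2 dS by simp
  qed (rule X)
  also have "\<dots> = 32 * (\<bar>t - t'\<bar> * X\<^sup>2) + (CARD('d) + 10 * M\<^sup>2) * e * X"
    by (simp add: algebra_simps power2_eq_square)
  also have "\<dots> \<le> 32 * (C * e) + (CARD('d) + 10 * M\<^sup>2) * e * (3 * M\<^sup>2)"
    using X2 XM e by (intro add_mono mult_left_mono) auto
  finally show "t' * X * (norm (A - A') + \<bar>B - B'\<bar>\<^sup>2 + \<bar>S - S'\<bar>) \<le> (32 * C + (CARD('d) + 10 * M\<^sup>2) * (3 * M\<^sup>2)) * e"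
    by (simp add: algebra_simps)
qed

section \<open>From pointwise moment bounds to the two losses\<close>

lemma min_dev_le: "min_dev a0 b0 nu0 a b nu \<le> ((a - a0) $ i)\<^sup>2" "min_dev a0 b0 nu0 a b nu \<le> (b - b0) ^ 4"
proof -
  let ?S = "(\<lambda>i. \<bar>(a - a0) $ i\<bar> ^ 2) ` UNIV \<union> {\<bar>b - b0\<bar> ^ 4, \<bar>nu - nu0\<bar> ^ 2}"
  have "finite ?S" by simp
  moreover have "\<bar>(a - a0) $ i\<bar> ^ 2 \<in> ?S" "\<bar>b - b0\<bar> ^ 4 \<in> ?S" by blast+
  ultimately have "Min ?S \<le> \<bar>(a - a0) $ i\<bar> ^ 2" "Min ?S \<le> \<bar>b - b0\<bar> ^ 4"
    by (blast intro: Min_le)+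
  then show "min_dev a0 b0 nu0 a b nu \<le> ((a - a0) $ i)\<^sup>2" "min_dev a0 b0 nu0 a b nu \<le> (b - b0) ^ 4"
    unfolding min_dev_def by auto
qed

lemma sum_squares_le_square_sum:
  fixes u v w :: real
  assumes "0 \<le> u" "0 \<le> v" "0 \<le> w"
  shows "u\<^sup>2 + v\<^sup>2 + w\<^sup>2 \<le> (u + v + w)\<^sup>2"
proof -
  have "0 \<le> u * v" "0 \<le> u * w" "0 \<le> v * w" using assms by auto
  then show ?thesis by (simp add: power2_eq_square algebra_simps)
qed

definition weight_loss :: "real ^ 'd \<Rightarrow> real \<Rightarrow> real \<Rightarrow> real \<times> (real ^ 'd) \<times> real \<times> real
    \<Rightarrow> real \<times> (real ^ 'd) \<times> real \<times> real \<Rightarrow> real" where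
  "weight_loss a0 b0 nu0 par est = (case par of (lam, a, b, nu) \<Rightarrow>
     (norm (a - a0) ^ 4 + \<bar>b - b0\<bar> ^ 8 + \<bar>nu - nu0\<bar> ^ 4) * \<bar>fst est - lam\<bar> ^ 2)"

definition expert_loss :: "real ^ 'd \<Rightarrow> real \<Rightarrow> real \<Rightarrow> real \<times> (real ^ 'd) \<times> real \<times> real
    \<Rightarrow> real \<times> (real ^ 'd) \<times> real \<times> real \<Rightarrow> real" where
  "expert_loss a0 b0 nu0 par est = (case par of (lam, a, b, nu) \<Rightarrow>
     lam ^ 2 * (norm (a - a0) ^ 2 + \<bar>b - b0\<bar> ^ 4 + \<bar>nu - nu0\<bar> ^ 2)
       * (norm (fst (snd est) - a) ^ 2 + \<bar>fst (snd (snd est)) - b\<bar> ^ 4 + \<bar>snd (snd (snd est)) - nu\<bar> ^ 2))"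

context gaussian_mixture
begin

lemma box_bounds:
  assumes "(lam, a, b, nu) \<in> box"
  shows "0 \<le> lam" "lam \<le> 1" "norm (a - a0) \<le> 2 * r + v1" "\<bar>b - b0\<bar> \<le> 2 * r + v1" "\<bar>nu - nu0\<bar> \<le> 2 * r + v1"
  using assms par0 r v norm_triangle_ineq4[of a a0] by (auto simp: box_def)

text \<open>The deterministic half of the argument: a parameter within Hellinger distance s of the
  truth has both losses O(s^2), provided that s is small compared with the true weight times the
  smallest deviation. That proviso is the signal condition of the algebraic lemmas at error level f
  s.\<close>

lemma loss_le_hellinger:
  obtains C K where "0 < C" "0 < K"
    "\<And>est par s. est \<in> box \<Longrightarrow> par \<in> box \<Longrightarrow> 0 < s \<Longrightarrow> hellinger2 est par \<le> ennreal (s\<^sup>2) \<Longrightarrow>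
      (case par of (lam, a, b, nu) \<Rightarrow> K * s \<le> lam * min_dev a0 b0 nu0 a b nu) \<Longrightarrow>
      weight_loss a0 b0 nu0 par est \<le> C * s\<^sup>2 \<and> expert_loss a0 b0 nu0 par est \<le> C * s\<^sup>2"
proof -
  obtain c where c: "0 < c"
    "\<And>par par' s k x. par \<in> box \<Longrightarrow> par' \<in> box \<Longrightarrow> 0 < s \<Longrightarrow> hellinger2 par par' \<le> ennreal (s\<^sup>2) \<Longrightarrow>
      1 \<le> k \<Longrightarrow> k \<le> 4 \<Longrightarrow> norm x \<le> r \<Longrightarrow> \<bar>moment k par x - moment k par' x\<bar> \<le> c * s"
    using moment_diff_le by blast
  define M where "M = 2 * r + v1"
  have M: "1 \<le> M" using r v by (simp add: M_def)
  \<comment> \<open>The 2 pays for differencing moments at two or three points, the 6 v1 for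
    removing the lower moments multiplied by 3 nu0 or 6 nu0.\<close>
  define f where "f = (2 + 6 * v1) * c"
  have f: "0 < f" using c v by (simp add: f_def)
  define K where "K = 1000 * M ^ 3 * f"
  define C1 where "C1 = 3 * (5 * M * CARD('d) + 70000 * M ^ 3)"
  define C2 where "C2 = 32 * C1 + (CARD('d) + 10 * M\<^sup>2) * (3 * M\<^sup>2)"
  have C1: "0 < C1" using M by (simp add: C1_def add_nonneg_pos)
  have C2: "0 < C2" using C1 M by (simp add: C2_def add_pos_nonneg)
  show thesis
  proof (rule that)
    show "0 < (C1 * f)\<^sup>2 + (C2 * f)\<^sup>2" using C1 f by (simp add: add_pos_nonneg)
    show "0 < K" using M f by (simp add: K_def)
    fix est par s
    assume est: "est \<in> box" and par: "par \<in> box" and s: "0 < s" and hel: "hellinger2 est par \<le> ennreal (s\<^sup>2)"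
      and signal: "case par of (lam, a, b, nu) \<Rightarrow> K * s \<le> lam * min_dev a0 b0 nu0 a b nu"
    obtain t a b nu where e: "est = (t, a, b, nu)" by (cases est) auto
    obtain t' a' b' nu' where p: "par = (t', a', b', nu')" by (cases par) auto
    define A B S where "A = a - a0" and "B = b - b0" and "S = nu - nu0"
    define A' B' S' where "A' = a' - a0" and "B' = b' - b0" and "S' = nu' - nu0"
    note defs = A_def B_def S_def A'_def B'_def S'_def
    have bd: "0 \<le> t" "0 \<le> t'" "norm A' \<le> M" "\<bar>B\<bar> \<le> M" "\<bar>B'\<bar> \<le> M" "\<bar>S\<bar> \<le> M" "\<bar>S'\<bar> \<le> M"
      using box_bounds[of t a b nu] box_bounds[of t' a' b' nu'] est par unfolding e p defs M_def by auto
    have sig: "K * s \<le> t' * min_dev a0 b0 nu0 a' b' nu'" using signal by (simp add: p)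
    have Ks: "0 < K * s" using \<open>0 < K\<close> s by simp
    have t': "0 < t'" using sig Ks bd by (cases "t' = 0") auto
    have sA: "K * s \<le> t' * (A' $ i)\<^sup>2" and sB: "K * s \<le> t' * B' ^ 4" for i
      using sig mult_left_mono[OF min_dev_le(1)[of a0 b0 nu0 a' b' nu' i] bd(2)]
        mult_left_mono[OF min_dev_le(2)[of a0 b0 nu0 a' b' nu'] bd(2)] unfolding defs by linarith+
    have cs: "0 \<le> c * s" using c s by simp
    have vcs: "c * s \<le> f * s" "2 * (c * s) \<le> f * s" "c * s + 3 * (nu0 * (c * s)) \<le> f * s" "c * s + 6 * (nu0 * (c * s)) \<le> f * s"
    proof -
      have "f * s = 2 * (c * s) + 6 * (v1 * (c * s))" by (simp add: f_def algebra_simps)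
      moreover have "nu0 * (c * s) \<le> v1 * (c * s)" "0 \<le> nu0 * (c * s)"
        using par0 v cs by (auto intro: mult_right_mono)
      ultimately show "c * s \<le> f * s" "2 * (c * s) \<le> f * s" "c * s + 3 * (nu0 * (c * s)) \<le> f * s" "c * s + 6 * (nu0 * (c * s)) \<le> f * s"
        using cs by linarith+
    qed
    have nrm: "norm (axis i 1 :: real ^ 'd) \<le> r" "norm (axis i (-1) :: real ^ 'd) \<le> r" "norm (0 :: real ^ 'd) \<le> r" for i
      using r by (auto simp: norm_eq_sqrt_inner inner_axis_axis)
    note mm = mixture_moments[OF est[unfolded e]] mixture_moments[OF par[unfolded p]]
    have inn: "v \<bullet> axis i 1 = v $ i" "v \<bullet> axis i (-1) = - (v $ i)" for v :: "real ^ 'd" and i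
      by (simp_all add: inner_axis)
    have d: "\<bar>moment k est x - moment k par x\<bar> \<le> c * s" if "1 \<le> k" "k \<le> 4" "norm x \<le> r" for k x
      using c(2)[OF est par s hel that] .
    have m1: "moment 1 est x - moment 1 par x = t * (A \<bullet> x + B) - t' * (A' \<bullet> x + B')" for x
      unfolding e p mm defs by simp
    have m2: "moment 2 est x - moment 2 par x = t * ((A \<bullet> x + B)\<^sup>2 + S) - t' * ((A' \<bullet> x + B')\<^sup>2 + S')" for x
      unfolding e p mm defs by simp
    have m3: "moment 3 est 0 - moment 3 par 0 =
        t * (B ^ 3 + 3 * B * S) - t' * (B' ^ 3 + 3 * B' * S') + 3 * (nu0 * (t * B - t' * B'))"
      unfolding e p mm defs by (simp add: algebra_simps)
    have m4: "moment 4 est 0 - moment 4 par 0 =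
        t * (B ^ 4 + 6 * B\<^sup>2 * S + 3 * S\<^sup>2) - t' * (B' ^ 4 + 6 * B'\<^sup>2 * S' + 3 * S'\<^sup>2)
        + 6 * (nu0 * (t * (B\<^sup>2 + S) - t' * (B'\<^sup>2 + S')))"
      unfolding e p mm defs by (simp add: algebra_simps)
    have h1: "\<bar>t * B - t' * B'\<bar> \<le> c * s" using d[of 1 0] nrm(3) m1[of 0] by simp
    have h2: "\<bar>t * (B\<^sup>2 + S) - t' * (B'\<^sup>2 + S')\<bar> \<le> c * s" using d[of 2 0] nrm(3) m2[of 0] by simp
    have nu0: "0 \<le> nu0" using par0 v by simp
    have n1: "\<bar>nu0 * (t * B - t' * B')\<bar> \<le> nu0 * (c * s)" "\<bar>nu0 * (t * (B\<^sup>2 + S) - t' * (B'\<^sup>2 + S'))\<bar> \<le> nu0 * (c * s)"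
      using h1 h2 nu0 by (auto simp: abs_mult intro!: mult_left_mono)
    have h3: "\<bar>t * (B ^ 3 + 3 * B * S) - t' * (B' ^ 3 + 3 * B' * S')\<bar> \<le> f * s"
      using d[of 3 0] nrm(3) n1(1) vcs(3) unfolding m3 by (simp add: abs_le_iff)
    have h4: "\<bar>t * (B ^ 4 + 6 * B\<^sup>2 * S + 3 * S\<^sup>2) - t' * (B' ^ 4 + 6 * B'\<^sup>2 * S' + 3 * S'\<^sup>2)\<bar> \<le> f * s"
      using d[of 4 0] nrm(3) n1(2) vcs(4) unfolding m4 by (simp add: abs_le_iff)
    have hA: "\<bar>t * A $ i - t' * A' $ i\<bar> \<le> f * s" for i
    proof -
      have "\<bar>t * (A $ i + B) - t' * (A' $ i + B')\<bar> \<le> c * s"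
        using d[of 1 "axis i 1"] nrm(1) m1[of "axis i 1"] by (simp add: inn)
      moreover have "t * A $ i - t' * A' $ i = (t * (A $ i + B) - t' * (A' $ i + B')) - (t * B - t' * B')"
        by (simp add: algebra_simps)
      ultimately have "\<bar>t * A $ i - t' * A' $ i\<bar> \<le> 2 * (c * s)" using h1 by linarith
      then show ?thesis using vcs by linarith
    qed
    \<comment> \<open>The second difference of the second moment at e_i, -e_i and 0 cancels the
      cross term A_i B as well as B^2 + S, leaving 2 t A_i^2.\<close>
    have hAA: "\<bar>t * (A $ i)\<^sup>2 - t' * (A' $ i)\<^sup>2\<bar> \<le> f * s" for i
    proof -
      have "\<bar>t * ((A $ i + B)\<^sup>2 + S) - t' * ((A' $ i + B')\<^sup>2 + S')\<bar> \<le> c * s"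
        using d[of 2 "axis i 1"] nrm(1) m2[of "axis i 1"] by (simp add: inn)
      moreover have "\<bar>t * ((- A $ i + B)\<^sup>2 + S) - t' * ((- A' $ i + B')\<^sup>2 + S')\<bar> \<le> c * s"
        using d[of 2 "axis i (-1)"] nrm(2) m2[of "axis i (-1)"] by (simp add: inn)
      moreover have "2 * (t * (A $ i)\<^sup>2 - t' * (A' $ i)\<^sup>2) =
          (t * ((A $ i + B)\<^sup>2 + S) - t' * ((A' $ i + B')\<^sup>2 + S'))
          + (t * ((- A $ i + B)\<^sup>2 + S) - t' * ((- A' $ i + B')\<^sup>2 + S'))
          - 2 * (t * (B\<^sup>2 + S) - t' * (B'\<^sup>2 + S'))"
        by (simp add: algebra_simps power2_eq_square)
      moreover have "\<bar>z\<bar> \<le> 2 * k" if "\<bar>p\<bar> \<le> k" "\<bar>q\<bar> \<le> k" "2 * z = p + q - 2 * w" "\<bar>w\<bar> \<le> k" for p q w z k :: real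
        using that by linarith
      ultimately have "\<bar>t * (A $ i)\<^sup>2 - t' * (A' $ i)\<^sup>2\<bar> \<le> 2 * (c * s)" using h2 by blast
      then show ?thesis using vcs by linarith
    qed
    have h1': "\<bar>t * B - t' * B'\<bar> \<le> f * s" and h2': "\<bar>t * (B\<^sup>2 + S) - t' * (B'\<^sup>2 + S')\<bar> \<le> f * s"
      using h1 h2 vcs by linarith+
    have fs: "0 < f * s" using f s by simp
    have Kfs: "1000 * M ^ 3 * (f * s) = K * s" by (simp add: K_def)
    define X where "X = norm A' + B'\<^sup>2 + \<bar>S'\<bar>"
    define Y where "Y = norm (A - A') + \<bar>B - B'\<bar>\<^sup>2 + \<bar>S - S'\<bar>"
    have XY: "0 \<le> X" "0 \<le> Y" by (simp_all add: X_def Y_def)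
    note dev = parameter_deviation_le[OF bd(1) t' M fs bd(3-7) hA hAA h1' h2' h3 h4 sA[folded Kfs] sB[folded Kfs],
        folded C1_def C2_def X_def Y_def]
    \<comment> \<open>The two losses are at most (|t - t'| X^2)^2 and (t' X Y)^2, the squares of the
      two controlled quantities.\<close>
    have X2: "(norm A')\<^sup>2 + B' ^ 4 + S'\<^sup>2 \<le> X\<^sup>2"
      using sum_squares_le_square_sum[of "norm A'" "B'\<^sup>2" "\<bar>S'\<bar>"] by (simp add: X_def power_mult[symmetric])
    have X4: "norm A' ^ 4 + B' ^ 8 + S' ^ 4 \<le> (X\<^sup>2)\<^sup>2"
    proof -
      have "norm A' ^ 4 + B' ^ 8 + S' ^ 4 \<le> ((norm A')\<^sup>2 + B' ^ 4 + S'\<^sup>2)\<^sup>2"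
        using sum_squares_le_square_sum[of "(norm A')\<^sup>2" "B' ^ 4" "S'\<^sup>2"] by (simp add: power_mult[symmetric])
      also have "\<dots> \<le> (X\<^sup>2)\<^sup>2" using X2 by (intro power_mono) auto
      finally show ?thesis .
    qed
    have Y2: "norm (a - a') ^ 2 + (b - b') ^ 4 + (nu - nu')\<^sup>2 \<le> Y\<^sup>2"
      using sum_squares_le_square_sum[of "norm (A - A')" "\<bar>B - B'\<bar>\<^sup>2" "\<bar>S - S'\<bar>"]
      unfolding Y_def by (simp add: defs power_mult[symmetric])
    have "weight_loss a0 b0 nu0 par est \<le> (X\<^sup>2)\<^sup>2 * \<bar>t - t'\<bar>\<^sup>2"
      unfolding weight_loss_def e p using X4 by (auto simp: defs intro!: mult_right_mono)
    also have "\<dots> = (\<bar>t - t'\<bar> * X\<^sup>2)\<^sup>2" by (simp add: power_mult_distrib)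
    also have "\<dots> \<le> (C1 * (f * s))\<^sup>2" using dev(1) by (intro power_mono) auto
    also have "\<dots> \<le> ((C1 * f)\<^sup>2 + (C2 * f)\<^sup>2) * s\<^sup>2" by (simp add: power_mult_distrib algebra_simps)
    finally have w: "weight_loss a0 b0 nu0 par est \<le> ((C1 * f)\<^sup>2 + (C2 * f)\<^sup>2) * s\<^sup>2" .
    have "expert_loss a0 b0 nu0 par est = t'\<^sup>2 * ((norm A')\<^sup>2 + B' ^ 4 + S'\<^sup>2)
        * (norm (a - a') ^ 2 + (b - b') ^ 4 + (nu - nu')\<^sup>2)"
      unfolding expert_loss_def e p by (simp add: defs)
    also have "\<dots> \<le> t'\<^sup>2 * X\<^sup>2 * Y\<^sup>2"
      using X2 Y2 by (intro mult_mono mult_left_mono) auto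
    also have "\<dots> = (t' * X * Y)\<^sup>2" by (simp add: power_mult_distrib)
    also have "\<dots> \<le> (C2 * (f * s))\<^sup>2" using dev(2) XY t' by (intro power_mono) auto
    also have "\<dots> \<le> ((C1 * f)\<^sup>2 + (C2 * f)\<^sup>2) * s\<^sup>2" by (simp add: power_mult_distrib algebra_simps)
    finally show "weight_loss a0 b0 nu0 par est \<le> ((C1 * f)\<^sup>2 + (C2 * f)\<^sup>2) * s\<^sup>2 \<and>
        expert_loss a0 b0 nu0 par est \<le> ((C1 * f)\<^sup>2 + (C2 * f)\<^sup>2) * s\<^sup>2" using w by simp
  qed
qed

end

section \<open>Maximum likelihood\<close>

context gaussian_mixture
begin

section \<open>Laws of the observations and the likelihood ratio bound\<close>

lemma obs_law_eq:
  "obs_law fbar a0 b0 nu0 par = density lborel (\<lambda>z. ennreal (fbar (fst z) * mix par (fst z) (snd z)))"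
  by (cases par) (simp add: obs_law_def mix_def case_prod_unfold)

lemma prob_space_obs_law:
  assumes "par \<in> box"
  shows "prob_space (obs_law fbar a0 b0 nu0 par)"
proof (rule prob_spaceI)
  show "emeasure (obs_law fbar a0 b0 nu0 par) (space (obs_law fbar a0 b0 nu0 par)) = 1"
    unfolding obs_law_eq by (subst emeasure_density) (auto simp: nn_integral_fbar_mix[OF assms])
qed

lemma prob_space_sample_law: "par \<in> box \<Longrightarrow> prob_space (sample_law fbar a0 b0 nu0 par n)"
  unfolding sample_law_def by (intro prob_space_PiM prob_space_obs_law)

lemma nn_integral_sample_law_prod:
  assumes "par \<in> box" and [measurable]: "h \<in> borel_measurable borel"
  shows "(\<integral>\<^sup>+D. (\<Prod>i<n. h (D i)) \<partial>sample_law fbar a0 b0 nu0 par n)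
    = (\<integral>\<^sup>+z. ennreal (fbar (fst z) * mix par (fst z) (snd z)) * h z \<partial>lborel) ^ n"
proof -
  interpret prob_space "obs_law fbar a0 b0 nu0 par" by (rule prob_space_obs_law) fact
  interpret product_sigma_finite "\<lambda>_::nat. obs_law fbar a0 b0 nu0 par" ..
  have [measurable]: "h \<in> borel_measurable (obs_law fbar a0 b0 nu0 par)" by (simp add: obs_law_eq)
  have "(\<integral>\<^sup>+D. (\<Prod>i<n. h (D i)) \<partial>sample_law fbar a0 b0 nu0 par n)
      = (\<Prod>i<n. \<integral>\<^sup>+z. h z \<partial>obs_law fbar a0 b0 nu0 par)"
    unfolding sample_law_def by (rule product_nn_integral_prod) auto
  also have "(\<integral>\<^sup>+z. h z \<partial>obs_law fbar a0 b0 nu0 par)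
      = (\<integral>\<^sup>+z. ennreal (fbar (fst z) * mix par (fst z) (snd z)) * h z \<partial>lborel)"
    unfolding obs_law_eq by (subst nn_integral_density) auto
  finally show ?thesis by simp
qed

lemma loglik_eq: "loglik a0 b0 nu0 n D par = (\<Sum>i<n. ln (mix par (fst (D i)) (snd (D i))))"
  by (cases par) (simp add: loglik_def mix_def)

lemma norm_box_le:
  assumes "par \<in> box"
  shows "norm par \<le> 1 + 2 * r + v1"
proof -
  obtain lam a b nu where p: "par = (lam, a, b, nu)" "0 \<le> lam" "lam \<le> 1" "norm a \<le> r" "\<bar>b\<bar> \<le> r" "v0 \<le> nu" "nu \<le> v1"
    using assms by (auto simp: box_def)
  have "norm par \<le> norm lam + (norm a + (norm b + norm nu))"
    unfolding p(1) by (intro order_trans[OF norm_Pair_le] add_left_mono order_refl)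
  then show ?thesis using p v by simp
qed

text \<open>The second conclusion ensures that 1 - \<delta> / 2 is nonnegative, so that
  \<open>ennreal\<close> does not truncate it when further terms are added.\<close>

lemma affinity_le:
  assumes "par \<in> box" "par' \<in> box" "\<not> hellinger2 par par' \<le> ennreal \<delta>" "0 \<le> \<delta>"
  shows "affinity par par' \<le> ennreal (1 - \<delta> / 2)" "\<delta> \<le> 2"
proof -
  have sum: "hellinger2 par par' + 2 * affinity par par' = 2"
    by (rule hellinger2_add_affinity) fact+
  have "hellinger2 par par' \<noteq> \<top>" "affinity par par' \<noteq> \<top>"
    using sum by (auto simp: ennreal_mult_top)
  then obtain h \<alpha> where h: "hellinger2 par par' = ennreal h" "0 \<le> h" and \<alpha>: "affinity par par' = ennreal \<alpha>" "0 \<le> \<alpha>"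
    by (metis ennreal_cases)
  have "ennreal (h + 2 * \<alpha>) = ennreal 2"
    using sum h \<alpha> by (simp add: ennreal_mult)
  then have "h + 2 * \<alpha> = 2" using h \<alpha> by (subst (asm) ennreal_inj) auto
  moreover have "\<delta> < h" using assms h by (simp add: not_le)
  ultimately show "affinity par par' \<le> ennreal (1 - \<delta> / 2)" "\<delta> \<le> 2"
    using \<alpha> by (auto intro!: ennreal_leI)
qed

text \<open>A version of the bracketing argument of Wong and Shen. Let $F$ be a $n^{-2}$-net of the set of
  parameters at squared Hellinger distance at least $\delta$ from the truth. If such a
  parameter has larger likelihood than the truth, then for a nearby $\theta \in F$ the upper
  bracket $g_\theta$ satisfies $\prod_i (g_\theta / p)(D_i) \ge 1$, and the square root of the product
  has expectation at most $(1 - \delta/2 + O(1/n))^n$.\<close>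
lemma likelihood_ratio_tail:
  obtains c C where "0 < c" "0 < C"
    "\<And>n par. 2 \<le> n \<Longrightarrow> par \<in> box \<Longrightarrow> \<exists>W. (\<integral>\<^sup>+D. W D \<partial>sample_law fbar a0 b0 nu0 par n) \<le> ennreal (C / n) \<and>
      W \<in> borel_measurable (sample_law fbar a0 b0 nu0 par n) \<and>
      (\<forall>D \<theta>. \<theta> \<in> box \<longrightarrow> loglik a0 b0 nu0 n D par \<le> loglik a0 b0 nu0 n D \<theta> \<longrightarrow>
        \<not> hellinger2 \<theta> par \<le> ennreal (c * ln n / n) \<longrightarrow> 1 \<le> W D)"
proof -
  obtain L where L: "0 < L"
    "\<And>par par' x y. par \<in> box \<Longrightarrow> par' \<in> box \<Longrightarrow> norm x \<le> r \<Longrightarrow>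
      \<bar>mix par x y - mix par' x y\<bar> \<le> L * norm (par - par') / (1 + y\<^sup>2)"
    using mix_lipschitz by blast
  obtain Kb where Kb: "0 < Kb" "\<And>par x y. par \<in> box \<Longrightarrow> mix par x y \<le> Kb"
    using mix_bounded by blast
  obtain I where I: "0 \<le> I" "(\<integral>\<^sup>+y. ennreal (1 / (1 + (y::real)\<^sup>2)) \<partial>lborel) = ennreal I"
    by (rule nn_integral_inverse_1_plus_square)
  define H where "H = sqrt L * (1 + I) / 2"
  have H: "0 < H" using L I by (simp add: H_def)
  define d where "d = DIM(real \<times> (real ^ 'd) \<times> real \<times> real)"
  define Kc where "Kc = 2 * (1 + 2 * r + v1) * d + 3"
  have Kc: "0 < Kc" using r v by (simp add: Kc_def add_nonneg_pos)
  \<comment> \<open>A net of mesh n^(-2) in dimension d has O(n^(2d)) points, and exp (- n \<delta>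
    / 2) = n^(-(2d+1)) with this c; the product is O(1/n).\<close>
  define c :: real where "c = 2 * (2 * d + 1)"
  show thesis
  proof (rule that)
    show "0 < c" by (simp add: c_def)
    show "0 < Kc ^ d * exp H" using Kc by simp
    fix n :: nat and par
    assume n: "2 \<le> n" and par: "par \<in> box"
    define \<delta> where "\<delta> = c * ln n / n"
    have \<delta>: "0 \<le> \<delta>" using n by (simp add: \<delta>_def c_def)
    define \<epsilon> where "\<epsilon> = 1 / (real n)\<^sup>2"
    have \<epsilon>: "0 < \<epsilon>" "\<epsilon> \<le> 1" using n by (simp_all add: \<epsilon>_def)
    define Bad where "Bad = {\<theta> \<in> box. \<not> hellinger2 \<theta> par \<le> ennreal \<delta>}"
    obtain F where F: "finite F" "F \<subseteq> Bad" "\<And>\<theta>. \<theta> \<in> Bad \<Longrightarrow> \<exists>\<theta>'\<in>F. norm (\<theta> - \<theta>') \<le> \<epsilon>"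
      "real (card F) \<le> (Kc / \<epsilon>) ^ d"
    proof (rule finite_net_card_le[of Bad "1 + 2 * r + v1" \<epsilon>])
      show "norm \<theta> \<le> 1 + 2 * r + v1" if "\<theta> \<in> Bad" for \<theta>
        using that norm_box_le by (auto simp: Bad_def)
      show "0 \<le> 1 + 2 * r + v1" using r v by simp
    qed (use \<epsilon> in \<open>auto simp: d_def Kc_def\<close>)
    \<comment> \<open>The bracket must dominate at every sample point. Outside the ball the constant
      Kb does so at no cost, since \<open>fbar\<close> vanishes there.\<close>
    define g where "g \<theta> z = (if norm (fst z) \<le> r then mix \<theta> (fst z) (snd z) + L * \<epsilon> * (1 / (1 + (snd z)\<^sup>2)) else Kb)"
      for \<theta> and z :: "(real ^ 'd) \<times> real"
    have g_measurable [measurable]: "g \<theta> \<in> borel_measurable borel" for \<theta>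
      unfolding g_def by measurable
    have w: "0 < 1 / (1 + y\<^sup>2)" for y :: real by (simp add: add_pos_nonneg)
    have g_pos: "0 < g \<theta> z" if "\<theta> \<in> box" for \<theta> z
      using mix_pos[OF that] Kb L \<epsilon> w[of "snd z"] by (simp add: g_def add_pos_pos)
    have g_ge: "mix \<theta> (fst z) (snd z) \<le> g \<theta>' z" if "\<theta> \<in> box" "\<theta>' \<in> box" "norm (\<theta> - \<theta>') \<le> \<epsilon>" for \<theta> \<theta>' z
    proof (cases "norm (fst z) \<le> r")
      case True
      have "\<bar>mix \<theta> (fst z) (snd z) - mix \<theta>' (fst z) (snd z)\<bar> \<le> L * norm (\<theta> - \<theta>') / (1 + (snd z)\<^sup>2)"
        using L(2) that True by blast
      also have "\<dots> \<le> L * \<epsilon> / (1 + (snd z)\<^sup>2)"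
        using L that by (intro divide_right_mono mult_left_mono) auto
      finally show ?thesis using True by (simp add: g_def)
    qed (simp add: g_def Kb(2) that)
    define h where "h \<theta> z = sqrt (g \<theta> z / mix par (fst z) (snd z))" for \<theta> and z :: "(real ^ 'd) \<times> real"
    have h_measurable [measurable]: "h \<theta> \<in> borel_measurable borel" for \<theta>
      unfolding h_def by measurable
    have h_pos: "0 < h \<theta> z" if "\<theta> \<in> box" for \<theta> z
      using g_pos[OF that] mix_pos[OF par] by (simp add: h_def)
    \<comment> \<open>The sum over the net is the union bound, and the square root of each
      likelihood ratio product is the variable in Markov's inequality. Keeping W itself makes the
      tail estimate a bound on its integral.\<close>
    define W where "W D = (\<Sum>\<theta>\<in>F. \<Prod>i<n. ennreal (h \<theta> (D i)))" for D :: "nat \<Rightarrow> (real ^ 'd) \<times> real"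
    have meas: "(\<lambda>D. \<Prod>i<n. ennreal (h \<theta> (D i))) \<in> borel_measurable (sample_law fbar a0 b0 nu0 par n)" for \<theta>
    proof -
      have [measurable]: "(\<lambda>D. D i) \<in> sample_law fbar a0 b0 nu0 par n \<rightarrow>\<^sub>M borel" if "i < n" for i
        unfolding sample_law_def using that
        measurable_component_singleton[of i "{..<n}" "\<lambda>_. obs_law fbar a0 b0 nu0 par"]
        by (simp add: obs_law_eq cong: measurable_cong_sets)
      show ?thesis by measurable
    qed
    \<comment> \<open>The square root is subadditive, so the factor per observation is the affinity
      plus the integral of sqrt (L \<epsilon>) times the root of weight times density. As sqrt (L
      \<epsilon>) = sqrt L / n, the bracket margin adds only H / n, which after n factors is the
      constant exp H.\<close>
    have one: "(\<integral>\<^sup>+z. ennreal (fbar (fst z) * mix par (fst z) (snd z)) * ennreal (h \<theta> z) \<partial>lborel)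
        \<le> ennreal (exp (- \<delta> / 2 + H / n))" if \<theta>: "\<theta> \<in> Bad" for \<theta>
    proof -
      have \<theta>b: "\<theta> \<in> box" and bad: "\<not> hellinger2 \<theta> par \<le> ennreal \<delta>" using \<theta> by (auto simp: Bad_def)
      have eps: "sqrt (L * \<epsilon>) = sqrt L / n" by (simp add: \<epsilon>_def real_sqrt_mult real_sqrt_divide)
      have "(\<integral>\<^sup>+z. ennreal (fbar (fst z) * mix par (fst z) (snd z)) * ennreal (h \<theta> z) \<partial>lborel)
          \<le> (\<integral>\<^sup>+z. ennreal (fbar (fst z) * sqrt (mix \<theta> (fst z) (snd z) * mix par (fst z) (snd z)))
            + ennreal (sqrt L / n / 2) * (ennreal (fbar (fst z) * mix par (fst z) (snd z)) + ennreal (fbar (fst z) * (1 / (1 + (snd z)\<^sup>2)))) \<partial>lborel)"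
      proof (intro nn_integral_mono)
        fix z :: "(real ^ 'd) \<times> real"
        let ?p = "mix par (fst z) (snd z)" and ?q = "mix \<theta> (fst z) (snd z)" and ?w = "1 / (1 + (snd z)\<^sup>2)" and ?f = "fbar (fst z)"
        have p: "0 < ?p" "0 < ?q" using mix_pos par \<theta>b by auto
        have "?f * ?p * h \<theta> z \<le> ?f * sqrt (?q * ?p) + sqrt L / n / 2 * (?f * ?p + ?f * ?w)"
        proof (cases "norm (fst z) \<le> r")
          case True
          have "?p * h \<theta> z = sqrt (g \<theta> z * ?p)"
          proof -
            have "?p * h \<theta> z = sqrt (?p * ?p) * sqrt (g \<theta> z / ?p)" using p by (simp add: h_def)
            also have "\<dots> = sqrt (?p * ?p * (g \<theta> z / ?p))" by (rule real_sqrt_mult[symmetric])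
            also have "?p * ?p * (g \<theta> z / ?p) = g \<theta> z * ?p" using p by simp
            finally show ?thesis .
          qed
          also have "g \<theta> z * ?p = ?q * ?p + L * \<epsilon> * (?w * ?p)" using True by (simp add: g_def algebra_simps)
          also have "sqrt (?q * ?p + L * \<epsilon> * (?w * ?p)) \<le> sqrt (?q * ?p) + sqrt (L * \<epsilon> * (?w * ?p))"
            using p L \<epsilon> by (intro sqrt_add_le_add_sqrt mult_nonneg_nonneg) auto
          also have "sqrt (L * \<epsilon> * (?w * ?p)) = sqrt L / n * sqrt (?w * ?p)"
            unfolding real_sqrt_mult[of "L * \<epsilon>"] eps ..
          also have "\<dots> \<le> sqrt L / n * ((?w + ?p) / 2)"
            using arith_geo_mean_sqrt[of ?w ?p] p w[of "snd z"] L by (intro mult_left_mono) auto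
          finally have "?p * h \<theta> z \<le> sqrt (?q * ?p) + sqrt L / n * ((?w + ?p) / 2)" by simp
          from mult_left_mono[OF this fbar_nonneg[of "fst z"]] show ?thesis
            by (simp add: algebra_simps add_divide_distrib)
        qed (simp add: fbar_supp)
        then have "ennreal (?f * ?p * h \<theta> z) \<le> ennreal (?f * sqrt (?q * ?p) + sqrt L / n / 2 * (?f * ?p + ?f * ?w))"
          by (rule ennreal_leI)
        also have "\<dots> = ennreal (?f * sqrt (?q * ?p)) + ennreal (sqrt L / n / 2) * (ennreal (?f * ?p) + ennreal (?f * ?w))"
          using p L fbar_nonneg[of "fst z"] w[of "snd z"]
          by (subst ennreal_plus[symmetric], simp, simp, subst ennreal_mult[symmetric], simp, simp, subst ennreal_plus[symmetric]) auto
        finally show "ennreal (?f * ?p) * ennreal (h \<theta> z) \<le> ennreal (?f * sqrt (?q * ?p)) + ennreal (sqrt L / n / 2) * (ennreal (?f * ?p) + ennreal (?f * ?w))"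
          using p fbar_nonneg[of "fst z"] h_pos[OF \<theta>b, of z] by (simp add: ennreal_mult[symmetric])
      qed
      also have "\<dots> = affinity \<theta> par + ennreal (sqrt L / n / 2) * (1 + (\<integral>\<^sup>+z. ennreal (fbar (fst (z :: (real ^ 'd) \<times> real)) * (1 / (1 + (snd z)\<^sup>2))) \<partial>lborel))"
        unfolding affinity_def
        by (simp add: nn_integral_add nn_integral_cmult nn_integral_fbar_mix[OF par])
      also have "(\<integral>\<^sup>+z. ennreal (fbar (fst (z :: (real ^ 'd) \<times> real)) * (1 / (1 + (snd z)\<^sup>2))) \<partial>lborel) = ennreal I"
        using I fbar_integral by (subst nn_integral_fbar_mult) (auto simp: nn_integral_multc)
      also have "affinity \<theta> par + ennreal (sqrt L / n / 2) * (1 + ennreal I)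
          \<le> ennreal (1 - \<delta> / 2) + ennreal (sqrt L / n / 2) * (1 + ennreal I)"
        by (intro add_right_mono affinity_le[OF \<theta>b par bad \<delta>])
      also have "\<dots> = ennreal (1 - \<delta> / 2 + H / n)"
      proof -
        have "1 + ennreal I = ennreal (1 + I)" using I by simp
        moreover have "sqrt L / n / 2 * (1 + I) = H / n" by (simp add: H_def)
        ultimately show ?thesis
          using L I H affinity_le(2)[OF \<theta>b par bad \<delta>]
          by (simp add: ennreal_mult[symmetric] ennreal_plus[symmetric] del: ennreal_plus)
      qed
      also have "\<dots> \<le> ennreal (exp (- \<delta> / 2 + H / n))"
        using exp_ge_add_one_self[of "- \<delta> / 2 + H / n"] by (intro ennreal_leI) linarith
      finally show ?thesis .
    qed
    have "(\<integral>\<^sup>+D. W D \<partial>sample_law fbar a0 b0 nu0 par n)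
        = (\<Sum>\<theta>\<in>F. (\<integral>\<^sup>+z. ennreal (fbar (fst z) * mix par (fst z) (snd z)) * ennreal (h \<theta> z) \<partial>lborel) ^ n)"
      unfolding W_def
      by (subst nn_integral_sum)
        (auto intro!: meas sum.cong nn_integral_sample_law_prod[OF par, where h = "\<lambda>z. ennreal (h _ z)"])
    also have "\<dots> \<le> (\<Sum>\<theta>\<in>F. ennreal (exp (- \<delta> / 2 + H / n)) ^ n)"
      using F by (intro sum_mono power_mono one) auto
    also have "\<dots> = ennreal (real (card F) * exp (- \<delta> / 2 + H / n) ^ n)"
      by (simp add: ennreal_power ennreal_mult ennreal_of_nat_eq_real_of_nat)
    also have "\<dots> \<le> ennreal (Kc ^ d * exp H / n)"
    proof (intro ennreal_leI)
      have "exp (- \<delta> / 2 + H / n) ^ n = exp (n * (- \<delta> / 2 + H / n))" by (rule exp_of_nat_mult[symmetric])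
      also have "n * (- \<delta> / 2 + H / n) = H - real (2 * d + 1) * ln n"
        using n by (simp add: \<delta>_def c_def field_simps)
      also have "exp \<dots> = exp H / real n ^ (2 * d + 1)"
        using n by (simp only: exp_diff exp_of_nat_mult) simp
      finally have E: "exp (- \<delta> / 2 + H / n) ^ n = exp H / real n ^ (2 * d + 1)" .
      have "(Kc / \<epsilon>) ^ d = Kc ^ d * real n ^ (2 * d)"
        using n by (simp add: \<epsilon>_def power_mult_distrib power_mult)
      then have "real (card F) * (exp H / real n ^ (2 * d + 1)) \<le> Kc ^ d * real n ^ (2 * d) * (exp H / real n ^ (2 * d + 1))"
        using F(4) by (intro mult_right_mono) auto
      also have "\<dots> = Kc ^ d * exp H / n" using n by simp
      finally show "real (card F) * exp (- \<delta> / 2 + H / n) ^ n \<le> Kc ^ d * exp H / n" unfolding E .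
    qed
    finally have intW: "(\<integral>\<^sup>+D. W D \<partial>sample_law fbar a0 b0 nu0 par n) \<le> ennreal (Kc ^ d * exp H / n)" .
    have big: "1 \<le> W D" if \<theta>: "\<theta> \<in> box" and lik: "loglik a0 b0 nu0 n D par \<le> loglik a0 b0 nu0 n D \<theta>"
      and bad: "\<not> hellinger2 \<theta> par \<le> ennreal \<delta>" for D \<theta>
    proof -
      obtain \<theta>' where \<theta>': "\<theta>' \<in> F" "norm (\<theta> - \<theta>') \<le> \<epsilon>"
        using F(3)[of \<theta>] \<theta> bad by (auto simp: Bad_def)
      then have \<theta>'b: "\<theta>' \<in> box" using F(2) by (auto simp: Bad_def)
      have "0 \<le> (\<Sum>i<n. ln (mix \<theta> (fst (D i)) (snd (D i))) - ln (mix par (fst (D i)) (snd (D i))))"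
        using lik by (simp add: loglik_eq sum_subtractf)
      also have "\<dots> \<le> (\<Sum>i<n. 2 * ln (h \<theta>' (D i)))"
      proof (intro sum_mono)
        fix i
        have "ln (mix \<theta> (fst (D i)) (snd (D i))) \<le> ln (g \<theta>' (D i))"
          using g_ge[OF \<theta> \<theta>'b \<theta>'(2), of "D i"] mix_pos[OF \<theta>] by (intro ln_mono) auto
        moreover have "2 * ln (h \<theta>' (D i)) = ln (g \<theta>' (D i)) - ln (mix par (fst (D i)) (snd (D i)))"
        proof -
          have q: "0 < g \<theta>' (D i)" "0 < mix par (fst (D i)) (snd (D i))"
            using g_pos[OF \<theta>'b] mix_pos[OF par] by auto
          then have "0 < g \<theta>' (D i) / mix par (fst (D i)) (snd (D i))" by simp
          then show ?thesis unfolding h_def ln_sqrt[OF less_imp_le[OF \<open>0 < g \<theta>' (D i) / _\<close>]]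
            using q by (simp add: ln_div)
        qed
        ultimately show "ln (mix \<theta> (fst (D i)) (snd (D i))) - ln (mix par (fst (D i)) (snd (D i))) \<le> 2 * ln (h \<theta>' (D i))"
          by simp
      qed
      finally have "0 \<le> (\<Sum>i<n. ln (h \<theta>' (D i)))" by (simp add: sum_distrib_left[symmetric])
      then have "1 \<le> exp (\<Sum>i<n. ln (h \<theta>' (D i)))" by simp
      also have "\<dots> = (\<Prod>i<n. h \<theta>' (D i))"
        using h_pos[OF \<theta>'b] by (simp add: exp_sum)
      finally have "1 \<le> ennreal (\<Prod>i<n. h \<theta>' (D i))" by simp
      also have "\<dots> = (\<Prod>i<n. ennreal (h \<theta>' (D i)))"
        using h_pos[OF \<theta>'b] by (simp add: prod_ennreal less_imp_le)
      also have "\<dots> \<le> W D" unfolding W_def using \<theta>' F by (intro member_le_sum) auto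
      finally show ?thesis .
    qed
    have "W \<in> borel_measurable (sample_law fbar a0 b0 nu0 par n)"
      unfolding W_def by (intro borel_measurable_sum meas)
    with intW big show "\<exists>W. (\<integral>\<^sup>+D. W D \<partial>sample_law fbar a0 b0 nu0 par n) \<le> ennreal (Kc ^ d * exp H / n) \<and>
      W \<in> borel_measurable (sample_law fbar a0 b0 nu0 par n) \<and>
      (\<forall>D \<theta>. \<theta> \<in> box \<longrightarrow> loglik a0 b0 nu0 n D par \<le> loglik a0 b0 nu0 n D \<theta> \<longrightarrow>
        \<not> hellinger2 \<theta> par \<le> ennreal (c * ln n / n) \<longrightarrow> 1 \<le> W D)"
      unfolding \<delta>_def by blast
  qed
qed

text \<open>A crude bound for use on the bad event. One expression dominates both losses, so they
  can share the integration argument.\<close>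

lemma loss_bounded:
  assumes est: "est \<in> box" and par: "par \<in> box"
  defines "M \<equiv> 2 * r + v1"
  shows "weight_loss a0 b0 nu0 par est \<le> (M ^ 4 + M ^ 8 + M ^ 4) * (M\<^sup>2 + M ^ 4 + M\<^sup>2 + 1)"
    and "expert_loss a0 b0 nu0 par est \<le> (M ^ 4 + M ^ 8 + M ^ 4) * (M\<^sup>2 + M ^ 4 + M\<^sup>2 + 1)"
proof -
  obtain t a b nu where e: "est = (t, a, b, nu)" by (cases est) auto
  obtain t' a' b' nu' where p: "par = (t', a', b', nu')" by (cases par) auto
  have M: "1 \<le> M" using r v by (simp add: M_def)
  note bd = box_bounds[OF est[unfolded e]] box_bounds[OF par[unfolded p]]
  have d: "norm (a - a') \<le> M" "\<bar>b - b'\<bar> \<le> M" "\<bar>nu - nu'\<bar> \<le> M"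
    using est par v r norm_triangle_ineq4[of a a'] by (auto simp: e p box_def M_def)
  have t: "\<bar>t - t'\<bar> \<le> 1" using bd by linarith
  have pw: "M ^ 2 \<le> M ^ 4" "M ^ 4 \<le> M ^ 8" "0 \<le> M ^ 4" using M by (auto intro: power_increasing)
  have "(norm (a' - a0) ^ 4 + \<bar>b' - b0\<bar> ^ 8 + \<bar>nu' - nu0\<bar> ^ 4) * \<bar>t - t'\<bar>\<^sup>2
      \<le> (M ^ 4 + M ^ 8 + M ^ 4) * (M\<^sup>2 + M ^ 4 + M\<^sup>2 + 1)"
  proof (intro mult_mono add_mono power_mono)
    have "\<bar>t - t'\<bar>\<^sup>2 \<le> 1\<^sup>2" using t by (intro power_mono) auto
    then show "\<bar>t - t'\<bar>\<^sup>2 \<le> M\<^sup>2 + M ^ 4 + M\<^sup>2 + 1"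
      using pw zero_le_power2[of M] unfolding one_power2 by linarith
  qed (use bd pw in \<open>auto simp: M_def\<close>)
  then show "weight_loss a0 b0 nu0 par est \<le> (M ^ 4 + M ^ 8 + M ^ 4) * (M\<^sup>2 + M ^ 4 + M\<^sup>2 + 1)"
    by (simp add: weight_loss_def e p)
  have "t'\<^sup>2 * (norm (a' - a0) ^ 2 + \<bar>b' - b0\<bar> ^ 4 + \<bar>nu' - nu0\<bar> ^ 2)
      * (norm (a - a') ^ 2 + \<bar>b - b'\<bar> ^ 4 + \<bar>nu - nu'\<bar> ^ 2)
      \<le> (1\<^sup>2 * (M ^ 2 + M ^ 4 + M ^ 2)) * (M\<^sup>2 + M ^ 4 + M\<^sup>2)"
    using bd d pw by (intro mult_mono add_mono power_mono) (auto simp: M_def)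
  also have "\<dots> \<le> (M ^ 4 + M ^ 8 + M ^ 4) * (M\<^sup>2 + M ^ 4 + M\<^sup>2 + 1)"
    using pw by (intro mult_mono) auto
  finally show "expert_loss a0 b0 nu0 par est \<le> (M ^ 4 + M ^ 8 + M ^ 4) * (M\<^sup>2 + M ^ 4 + M\<^sup>2 + 1)"
    by (simp add: expert_loss_def e p)
qed

lemma mle_loss_le:
  obtains C K where "0 < C" "0 < K"
    "\<And>n par est. 3 \<le> n \<Longrightarrow> par \<in> box \<Longrightarrow>
      (\<And>D. est D \<in> box \<and> loglik a0 b0 nu0 n D par \<le> loglik a0 b0 nu0 n D (est D)) \<Longrightarrow>
      (case par of (lam, a, b, nu) \<Rightarrow> K * sqrt (ln n / n) \<le> lam * min_dev a0 b0 nu0 a b nu) \<Longrightarrow>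
      (\<integral>\<^sup>+D. ennreal (weight_loss a0 b0 nu0 par (est D)) \<partial>sample_law fbar a0 b0 nu0 par n) \<le> ennreal (C * ln n / n) \<and>
      (\<integral>\<^sup>+D. ennreal (expert_loss a0 b0 nu0 par (est D)) \<partial>sample_law fbar a0 b0 nu0 par n) \<le> ennreal (C * ln n / n)"
proof -
  obtain C1 K1 where CK: "0 < C1" "0 < K1"
    "\<And>est par s. est \<in> box \<Longrightarrow> par \<in> box \<Longrightarrow> 0 < s \<Longrightarrow> hellinger2 est par \<le> ennreal (s\<^sup>2) \<Longrightarrow>
      (case par of (lam, a, b, nu) \<Rightarrow> K1 * s \<le> lam * min_dev a0 b0 nu0 a b nu) \<Longrightarrow>
      weight_loss a0 b0 nu0 par est \<le> C1 * s\<^sup>2 \<and> expert_loss a0 b0 nu0 par est \<le> C1 * s\<^sup>2"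
    using loss_le_hellinger by blast
  obtain c C2 where c: "0 < c" "0 < C2"
    and tail: "\<And>n par. 2 \<le> n \<Longrightarrow> par \<in> box \<Longrightarrow> \<exists>W. (\<integral>\<^sup>+D. W D \<partial>sample_law fbar a0 b0 nu0 par n) \<le> ennreal (C2 / n) \<and>
      W \<in> borel_measurable (sample_law fbar a0 b0 nu0 par n) \<and>
      (\<forall>D \<theta>. \<theta> \<in> box \<longrightarrow> loglik a0 b0 nu0 n D par \<le> loglik a0 b0 nu0 n D \<theta> \<longrightarrow>
        \<not> hellinger2 \<theta> par \<le> ennreal (c * ln n / n) \<longrightarrow> 1 \<le> W D)"
    using likelihood_ratio_tail by blast
  define M where "M = 2 * r + v1"
  define B where "B = (M ^ 4 + M ^ 8 + M ^ 4) * (M\<^sup>2 + M ^ 4 + M\<^sup>2 + 1)"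
  have B: "0 \<le> B" by (simp add: B_def)
  define C where "C = C1 * c + B * C2"
  show thesis
  proof (rule that)
    show "0 < C" using CK c B by (simp add: C_def add_pos_nonneg)
    show "0 < K1 * sqrt c" using CK c by simp
    fix n :: nat and par est
    assume n: "3 \<le> n" and par: "par \<in> box"
      and est: "\<And>D. est D \<in> box \<and> loglik a0 b0 nu0 n D par \<le> loglik a0 b0 nu0 n D (est D)"
      and signal: "case par of (lam, a, b, nu) \<Rightarrow> K1 * sqrt c * sqrt (ln n / n) \<le> lam * min_dev a0 b0 nu0 a b nu"
    \<comment> \<open>From n = 3 on, ln n \<ge> 1, so the O(1/n) contribution of the bad event is
      absorbed into ln n / n.\<close>
    have "exp 1 \<le> real n" using n exp_le by linarith
    then have ln1: "1 \<le> ln (real n)" using n by (simp add: ln_ge_iff)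
    define s where "s = sqrt (c * ln n / n)"
    have s: "0 < s" "s\<^sup>2 = c * ln n / n" using c n ln1 by (simp_all add: s_def)
    have "s = sqrt c * sqrt (ln n / n)" by (simp add: s_def real_sqrt_mult[symmetric])
    then have sig: "case par of (lam, a, b, nu) \<Rightarrow> K1 * s \<le> lam * min_dev a0 b0 nu0 a b nu"
      using signal by (simp add: mult.assoc)
    obtain W where W: "(\<integral>\<^sup>+D. W D \<partial>sample_law fbar a0 b0 nu0 par n) \<le> ennreal (C2 / n)"
      "W \<in> borel_measurable (sample_law fbar a0 b0 nu0 par n)"
      "\<And>D \<theta>. \<theta> \<in> box \<Longrightarrow> loglik a0 b0 nu0 n D par \<le> loglik a0 b0 nu0 n D \<theta> \<Longrightarrow>
        \<not> hellinger2 \<theta> par \<le> ennreal (c * ln n / n) \<Longrightarrow> 1 \<le> W D"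
      using tail[of n par] n par by auto
    interpret S: prob_space "sample_law fbar a0 b0 nu0 par n" by (rule prob_space_sample_law[OF par])
    have bound: "(\<integral>\<^sup>+D. ennreal (loss (est D)) \<partial>sample_law fbar a0 b0 nu0 par n) \<le> ennreal (C * ln n / n)"
      if good: "\<And>\<theta>. \<theta> \<in> box \<Longrightarrow> hellinger2 \<theta> par \<le> ennreal (s\<^sup>2) \<Longrightarrow> loss \<theta> \<le> C1 * s\<^sup>2"
        and bad: "\<And>\<theta>. \<theta> \<in> box \<Longrightarrow> loss \<theta> \<le> B" for loss
    proof -
      \<comment> \<open>A pointwise bound replaces the split of the sample space: either the
        estimate is close to the truth, or W D \<ge> 1. The right-hand side is measurable, so
        additivity of the integral is applied to it alone.\<close>
      have "ennreal (loss (est D)) \<le> ennreal (C1 * s\<^sup>2) + ennreal B * W D" for D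
      proof (cases "hellinger2 (est D) par \<le> ennreal (s\<^sup>2)")
        case True
        then have "ennreal (loss (est D)) \<le> ennreal (C1 * s\<^sup>2)" using good est by (intro ennreal_leI) auto
        then show ?thesis by (rule order_trans) simp
      next
        case False
        have "ennreal (loss (est D)) \<le> ennreal B * 1" using bad est by (simp add: ennreal_leI)
        also have "\<dots> \<le> ennreal B * W D"
          using False s W(3)[of "est D" D] est[of D] by (intro mult_left_mono) auto
        finally show ?thesis by (rule order_trans) simp
      qed
      then have "(\<integral>\<^sup>+D. ennreal (loss (est D)) \<partial>sample_law fbar a0 b0 nu0 par n)
          \<le> (\<integral>\<^sup>+D. ennreal (C1 * s\<^sup>2) + ennreal B * W D \<partial>sample_law fbar a0 b0 nu0 par n)"
        by (intro nn_integral_mono)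
      also have "\<dots> = ennreal (C1 * s\<^sup>2) + ennreal B * (\<integral>\<^sup>+D. W D \<partial>sample_law fbar a0 b0 nu0 par n)"
        using W(2) by (simp add: nn_integral_add nn_integral_cmult S.emeasure_space_1)
      also have "\<dots> \<le> ennreal (C1 * s\<^sup>2) + ennreal B * ennreal (C2 / n)"
        by (intro add_left_mono mult_left_mono W) simp
      also have "\<dots> = ennreal (C1 * s\<^sup>2 + B * (C2 / n))"
        using CK(1) B c(2) by (simp add: ennreal_mult[symmetric] ennreal_plus[symmetric] del: ennreal_plus)
      also have "\<dots> \<le> ennreal (C * ln n / n)"
      proof (intro ennreal_leI)
        have "B * C2 / n * 1 \<le> B * C2 / n * ln n" using B c ln1 by (intro mult_left_mono) auto
        then show "C1 * s\<^sup>2 + B * (C2 / n) \<le> C * ln n / n"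
          by (simp add: s(2) C_def add_divide_distrib algebra_simps)
      qed
      finally show ?thesis .
    qed
    have good: "weight_loss a0 b0 nu0 par \<theta> \<le> C1 * s\<^sup>2 \<and> expert_loss a0 b0 nu0 par \<theta> \<le> C1 * s\<^sup>2"
      if "\<theta> \<in> box" "hellinger2 \<theta> par \<le> ennreal (s\<^sup>2)" for \<theta>
      using CK(3)[OF that(1) par s(1) that(2) sig] .
    note bad = loss_bounded[OF _ par, folded M_def, folded B_def]
    show "(\<integral>\<^sup>+D. ennreal (weight_loss a0 b0 nu0 par (est D)) \<partial>sample_law fbar a0 b0 nu0 par n) \<le> ennreal (C * ln n / n) \<and>
      (\<integral>\<^sup>+D. ennreal (expert_loss a0 b0 nu0 par (est D)) \<partial>sample_law fbar a0 b0 nu0 par n) \<le> ennreal (C * ln n / n)"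
      by (intro conjI bound bad conjunct1[OF good] conjunct2[OF good])
  qed
qed

end

section \<open>Reduction of the theorem to uniform bounds on the parameters\<close>

lemma compact_parameters_bounded:
  fixes Theta :: "((real ^ 'd) \<times> real \<times> real) set"
  assumes "compact Theta" "\<forall>p\<in>Theta. 0 < snd (snd p)" "Theta \<noteq> {}"
  shows "\<exists>R v0 v1. 0 < v0 \<and>
    (\<forall>a b nu. (a, b, nu) \<in> Theta \<longrightarrow> norm a \<le> R \<and> \<bar>b\<bar> \<le> R \<and> v0 \<le> nu \<and> nu \<le> v1)"
proof -
  have cont: "continuous_on Theta (\<lambda>p. snd (snd p))" by (intro continuous_intros)
  obtain p where p: "p \<in> Theta" "\<And>q. q \<in> Theta \<Longrightarrow> snd (snd p) \<le> snd (snd q)"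
    using continuous_attains_inf[OF assms(1,3) cont] by blast
  obtain q where q: "q \<in> Theta" "\<And>q'. q' \<in> Theta \<Longrightarrow> snd (snd q') \<le> snd (snd q)"
    using continuous_attains_sup[OF assms(1,3) cont] by blast
  obtain R where R: "\<And>q. q \<in> Theta \<Longrightarrow> norm q \<le> R"
    using compact_imp_bounded[OF assms(1)] by (auto simp: bounded_iff)
  show ?thesis
  proof (intro exI conjI[of "_ < _"] allI impI)
    show "0 < snd (snd p)" using assms(2) p(1) by blast
    fix a b nu assume H: "(a, b, nu) \<in> Theta"
    have "norm a \<le> R" using R[OF H] norm_fst_le[of a "(b, nu)"] by linarith
    moreover have "\<bar>b\<bar> \<le> R" using R[OF H] norm_snd_le[of "(b, nu)" a] norm_fst_le[of b nu] by simp
    ultimately show "norm a \<le> R \<and> \<bar>b\<bar> \<le> R \<and> snd (snd p) \<le> nu \<and> nu \<le> snd (snd q)"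
      using p(2)[OF H] q(2)[OF H] by simp
  qed
qed

theorem theorem4:
  fixes Xset :: "((real ^ 'd)) set"
    and fbar :: "(real ^ 'd) \<Rightarrow> real"
    and Theta :: "((real ^ 'd) \<times> real \<times> real) set"
    and a0 :: "(real ^ 'd)" and b0 nu0 :: real
    and l :: "nat \<Rightarrow> real"
  assumes "bounded Xset"
    and "fbar \<in> borel_measurable borel"
    and "\<And>x. fbar x \<ge> 0"
    and "\<And>x. x \<notin> Xset \<Longrightarrow> fbar x = 0"
    and "(\<integral>\<^sup>+ x. ennreal (fbar x) \<partial>lborel) = 1"
    and "compact Theta"
    and "\<And>a b nu. (a, b, nu) \<in> Theta \<Longrightarrow> nu > 0"
    and "(a0, b0, nu0) \<in> Theta"
    and "a0 \<noteq> 0"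
    and "filterlim (\<lambda>n. l n / ln (real n)) at_top sequentially"
  shows "\<exists>C N. \<forall>est. is_MLE Theta a0 b0 nu0 est \<longrightarrow>
           (\<forall>n \<ge> N. \<forall>par \<in> Xi1 Theta a0 b0 nu0 l n.
              (case par of (lam, a, b, nu) \<Rightarrow>
                 (\<integral>\<^sup>+ D. ennreal
                    ((norm (a - a0) ^ 4 + \<bar>b - b0\<bar> ^ 8 + \<bar>nu - nu0\<bar> ^ 4)
                      * \<bar>fst (est n D) - lam\<bar> ^ 2)
                    \<partial>sample_law fbar a0 b0 nu0 par n)
                   \<le> ennreal (C * ln (real n) / real n)
               \<and> (\<integral>\<^sup>+ D. ennreal
                    (lam ^ 2 * (norm (a - a0) ^ 2 + \<bar>b - b0\<bar> ^ 4 + \<bar>nu - nu0\<bar> ^ 2)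
                      * (norm (fst (snd (est n D)) - a) ^ 2
                         + \<bar>fst (snd (snd (est n D))) - b\<bar> ^ 4
                         + \<bar>snd (snd (snd (est n D))) - nu\<bar> ^ 2))
                    \<partial>sample_law fbar a0 b0 nu0 par n)
                   \<le> ennreal (C * ln (real n) / real n)))"
proof -
  have Theta: "\<forall>p\<in>Theta. 0 < snd (snd p)" "Theta \<noteq> {}"
    using assms(7,8) by force+
  obtain R v0 v1 where v0: "0 < v0"
    and "\<forall>a b nu. (a, b, nu) \<in> Theta \<longrightarrow> norm a \<le> R \<and> \<bar>b\<bar> \<le> R \<and> v0 \<le> nu \<and> nu \<le> v1"
    using compact_parameters_bounded[OF assms(6) Theta] by (elim exE conjE)
  then have R: "norm a \<le> R \<and> \<bar>b\<bar> \<le> R \<and> v0 \<le> nu \<and> nu \<le> v1" if "(a, b, nu) \<in> Theta" for a b nu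
    using that by blast
  obtain RX where RX: "\<And>x. x \<in> Xset \<Longrightarrow> norm x \<le> RX"
    using assms(1) by (auto simp: bounded_iff)
  define r where "r = max 1 (max R RX)"
  interpret gaussian_mixture fbar a0 b0 nu0 r v0 v1
  proof
    show "fbar x = 0" if "r < norm x" for x
    proof (rule assms(4))
      show "x \<notin> Xset" using RX[of x] that by (auto simp: r_def)
    qed
  qed (use assms v0 R[OF assms(8)] in \<open>auto simp: r_def\<close>)
  have box: "Xi Theta \<subseteq> box"
  proof
    fix p assume "p \<in> Xi Theta"
    then obtain lam a b nu where p: "p = (lam, a, b, nu)" "0 \<le> lam" "lam \<le> 1" "(a, b, nu) \<in> Theta"
      by (auto simp: Xi_def)
    moreover have "R \<le> r" by (simp add: r_def)
    ultimately show "p \<in> box" using R[OF p(4)] by (simp add: box_def)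
  qed
  obtain C K where CK: "0 < C" "0 < K"
    "\<And>n par est. 3 \<le> n \<Longrightarrow> par \<in> box \<Longrightarrow>
      (\<And>D. est D \<in> box \<and> loglik a0 b0 nu0 n D par \<le> loglik a0 b0 nu0 n D (est D)) \<Longrightarrow>
      (case par of (lam, a, b, nu) \<Rightarrow> K * sqrt (ln n / n) \<le> lam * min_dev a0 b0 nu0 a b nu) \<Longrightarrow>
      (\<integral>\<^sup>+D. ennreal (weight_loss a0 b0 nu0 par (est D)) \<partial>sample_law fbar a0 b0 nu0 par n) \<le> ennreal (C * ln n / n) \<and>
      (\<integral>\<^sup>+D. ennreal (expert_loss a0 b0 nu0 par (est D)) \<partial>sample_law fbar a0 b0 nu0 par n) \<le> ennreal (C * ln n / n)"
    using mle_loss_le by blast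
  obtain N0 where N0: "\<And>n. N0 \<le> n \<Longrightarrow> K \<le> l n / ln (real n)"
    using assms(10) unfolding filterlim_at_top eventually_sequentially by blast
  show ?thesis
  \<comment> \<open>The constant C comes from the locale bounds alone; the sequence l enters only
    the threshold N0. Neither depends on the estimator or the true parameter.\<close>
  proof (intro exI[of _ C] exI[of _ "max 3 N0"] allI impI ballI)
    fix est n par
    assume mle: "is_MLE Theta a0 b0 nu0 est" and n: "max 3 N0 \<le> n" and par: "par \<in> Xi1 Theta a0 b0 nu0 l n"
    obtain lam a b nu where p: "par = (lam, a, b, nu)" by (cases par) auto
    have n3: "3 \<le> n" using n by simp
    have pX: "par \<in> Xi Theta" and md: "0 < min_dev a0 b0 nu0 a b nu"
      and lam: "l n / (min_dev a0 b0 nu0 a b nu * sqrt n) \<le> lam"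
      using par by (auto simp: p Xi1_def)
    have "exp 1 \<le> real n" using n3 exp_le by linarith
    then have ln1: "1 \<le> ln (real n)" using n3 by (simp add: ln_ge_iff)
    \<comment> \<open>The signal condition is of order sqrt (ln n / n). It follows because l n \<ge>
      K ln n \<ge> K sqrt (ln n) eventually, while membership in \<open>Xi1\<close> gives weight
      times smallest deviation at least l n / sqrt n.\<close>
    have "K * sqrt (ln n) \<le> K * ln n"
      using CK ln1 mult_right_mono[OF ln1, of "ln n"]
      by (intro mult_left_mono real_le_lsqrt) (auto simp: power2_eq_square)
    also have "\<dots> \<le> l n" using N0[of n] n ln1 by (simp add: le_divide_eq)
    finally have "K * sqrt (ln n / n) \<le> l n / sqrt n"
      using n3 by (simp add: real_sqrt_divide divide_right_mono)
    also have "\<dots> \<le> lam * min_dev a0 b0 nu0 a b nu"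
      using lam md n3 by (simp add: field_simps)
    finally have "case par of (lam, a, b, nu) \<Rightarrow> K * sqrt (ln n / n) \<le> lam * min_dev a0 b0 nu0 a b nu"
      by (simp add: p)
    moreover have "est n D \<in> box \<and> loglik a0 b0 nu0 n D par \<le> loglik a0 b0 nu0 n D (est n D)" for D
      using mle pX box unfolding is_MLE_def by blast
    ultimately have "(\<integral>\<^sup>+D. ennreal (weight_loss a0 b0 nu0 par (est n D)) \<partial>sample_law fbar a0 b0 nu0 par n) \<le> ennreal (C * ln n / n) \<and>
      (\<integral>\<^sup>+D. ennreal (expert_loss a0 b0 nu0 par (est n D)) \<partial>sample_law fbar a0 b0 nu0 par n) \<le> ennreal (C * ln n / n)"
      using pX box n3 by (intro CK(3)) auto
    then show "case par of (lam, a, b, nu) \<Rightarrow>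
                 (\<integral>\<^sup>+ D. ennreal
                    ((norm (a - a0) ^ 4 + \<bar>b - b0\<bar> ^ 8 + \<bar>nu - nu0\<bar> ^ 4)
                      * \<bar>fst (est n D) - lam\<bar> ^ 2)
                    \<partial>sample_law fbar a0 b0 nu0 par n)
                   \<le> ennreal (C * ln (real n) / real n)
               \<and> (\<integral>\<^sup>+ D. ennreal
                    (lam ^ 2 * (norm (a - a0) ^ 2 + \<bar>b - b0\<bar> ^ 4 + \<bar>nu - nu0\<bar> ^ 2)
                      * (norm (fst (snd (est n D)) - a) ^ 2
                         + \<bar>fst (snd (snd (est n D))) - b\<bar> ^ 4
                         + \<bar>snd (snd (snd (est n D))) - nu\<bar> ^ 2))
                    \<partial>sample_law fbar a0 b0 nu0 par n)
                   \<le> ennreal (C * ln (real n) / real n)"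
      unfolding p weight_loss_def expert_loss_def prod.case .
  qed
qed

end
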